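(* Let $d\ge 3$, let $\{N_t\}$ be a holomorphic family of degree $d$ Newton maps, and let $\{M_t\}$ be a rescaling of period $q\ge 2$ for $\{N_t\}$. Suppose that $M_t^{-1}\circ N^q_t\circ M_t$ converges to $f$ subalgebraically. Then $f\not\in\mathrm{Rat}_{d^q}^{ss}$.
   Context: For $D\ge1$, a point $f\in\mathbb{P}^{2D+1}$ is identified with a pair $[F_a(X,Y):F_b(X,Y)]$ of homogeneous degree $D$ polynomials over $\mathbb{C}$ (not both zero, up to common scaling); write $f=H_f\hat f$ with $H_f=\gcd(F_a,F_b)$ and $\hat f=[F_a/H_f:F_b/H_f]$. $\mathrm{Rat}_D$ is the set of $f$ with $\deg\hat f=D$. A Newton map of degree $d$ is $N_P(z)=z-P(z)/P'(z)$ where $P$ is a monic degree $d$ complex polynomial with $d$ distinct roots. A holomorphic family $\{f_t\}$ of degree $D$ rational maps is a holomorphic map $\mathbb{D}\to\mathbb{P}^{2D+1}$, $t\mapsto f_t$, with $f_t\in\mathrm{Rat}_D$ for $t\neq0$; it is a family of Newton maps if each $f_t$, $t\ne0$, is a Newton map. A moving frame is a holomorphic family $\{M_t\}$ of degree $1$ rational maps. It is a rescaling for $\{f_t\}$ of period $q\ge1$ if there are a rational map $g$ of degree at least $2$ and a finite set $S\subset\mathbb{P}^1$ with $M_t^{-1}\circ f_t^q\circ M_t\to g$ locally uniformly on $\mathbb{P}^1\setminus S$ as $t\to0$, and $q$ is minimal with this property. A family in $\mathrm{Rat}_D$ converges subalgebraically to $f\in\mathbb{P}^{2D+1}$ if it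 converges to $f$ in $\mathbb{P}^{2D+1}$ as $t\to0$ (here $D=d^q$). $\mathrm{Rat}_D^{ss}\subset\mathbb{P}^{2D+1}$ is the semistable locus (in the sense of geometric invariant theory) for the conjugation action of $\mathrm{SL}_2(\mathbb{C})$. Equivalently (Silverman; DeMarco): $f=H_f\hat f\in\mathrm{Rat}_D^{ss}$ if and only if every zero $h\in\mathbb{P}^1$ of $H_f$ has multiplicity at most $(D+1)/2$, and whenever the multiplicity of $h$ is at least $D/2$ one has $\hat f(h)\ne h$. *)

theory Defs
  imports "HOL-Analysis.Analysis" "HOL-Computational_Algebra.Polynomial" "HOL-Library.Poly_Mapping"
begin

section \<open>Binary forms and the spaces \<open>P\<^sup>2\<^sup>D\<^sup>+\<^sup>1\<close> and \<open>P\<^sup>1\<close>\<close>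

text \<open>
  A binary form \<open>\<Sum>i\<le>D. a\<^sub>i X\<^sup>i Y\<^sup>D\<^sup>-\<^sup>i\<close> of degree \<open>D\<close> is encoded by its dehomogenization
  \<open>\<Sum>i\<le>D. a\<^sub>i X\<^sup>i\<close>, a polynomial of degree at most \<open>D\<close>; the number \<open>D\<close> is always passed
  separately, because powers of \<open>Y\<close> are invisible in the dehomogenization.  A product of forms
  is then a product of polynomials.  Points of projective spaces are the lines through the
  origin, with the origin removed.
\<close>

type_synonym form_pair = "complex poly \<times> complex poly"
type_synonym proj_pt = "form_pair set"
type_synonym line_pt = "(complex \<times> complex) set"

definition form_pairs :: "nat \<Rightarrow> form_pair set" where
  "form_pairs D = {(a, b). degree a \<le> D \<and> degree b \<le> D}"

definition proj_class :: "form_pair \<Rightarrow> proj_pt" where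
  "proj_class v = {(smult c (fst v), smult c (snd v)) | c. c \<noteq> 0}"

definition proj_space :: "nat \<Rightarrow> proj_pt set" where
  "proj_space D = proj_class ` (form_pairs D - {(0, 0)})"

definition line_class :: "complex \<times> complex \<Rightarrow> line_pt" where
  "line_class z = {(c * fst z, c * snd z) | c. c \<noteq> 0}"

definition proj_line :: "line_pt set" where
  "proj_line = line_class ` (UNIV - {(0, 0)})"

text \<open>The chordal metric; the set below is a singleton, since its members do not depend on the
  chosen homogeneous coordinates.\<close>

definition chordal :: "line_pt \<Rightarrow> line_pt \<Rightarrow> real" where
  "chordal z w = the_elem {cmod (x * v - y * u) / (norm (x, y) * norm (u, v)) | x y u v.
     (x, y) \<in> z \<and> (u, v) \<in> w}"


section \<open>Rational maps\<close>

text \<open>\<open>rat_maps D\<close>: the homogeneous greatest common divisor of the two forms is constant, i.e. they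
  have no common factor \<open>H\<close> that is a form of positive degree \<open>k\<close>.\<close>

definition rat_maps :: "nat \<Rightarrow> proj_pt set" where
  "rat_maps D = {proj_class (F, G) | F G. (F, G) \<in> form_pairs D - {(0, 0)} \<and>
     (\<forall>k H A B. k \<le> D \<and> degree H \<le> k \<and> (A, B) \<in> form_pairs (D - k) \<and>
        F = H * A \<and> G = H * B \<longrightarrow> k = 0)}"

definition form_eval :: "nat \<Rightarrow> complex poly \<Rightarrow> complex \<Rightarrow> complex \<Rightarrow> complex" where
  "form_eval D F x y = (\<Sum>i\<le>D. coeff F i * x ^ i * y ^ (D - i))"

definition form_subst :: "nat \<Rightarrow> complex poly \<Rightarrow> form_pair \<Rightarrow> complex poly" where
  "form_subst D F G = (\<Sum>i\<le>D. smult (coeff F i) (fst G ^ i * snd G ^ (D - i)))"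

definition pair_comp :: "nat \<Rightarrow> form_pair \<Rightarrow> form_pair \<Rightarrow> form_pair" where
  "pair_comp D F G = (form_subst D (fst F) G, form_subst D (snd F) G)"

text \<open>Operations on projective points collect the results over all representatives.  On rational
  maps this is again a single projective class.  In \<open>rat_comp D f g\<close>, \<open>D\<close> is the degree
  of the outer map \<open>f\<close>.\<close>

definition rat_eval :: "nat \<Rightarrow> proj_pt \<Rightarrow> line_pt \<Rightarrow> line_pt" where
  "rat_eval D f z = {(form_eval D F x y, form_eval D G x y) | F G x y. (F, G) \<in> f \<and> (x, y) \<in> z}"

definition rat_comp :: "nat \<Rightarrow> proj_pt \<Rightarrow> proj_pt \<Rightarrow> proj_pt" where
  "rat_comp D f g = {pair_comp D F G | F G. F \<in> f \<and> G \<in> g}"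

fun rat_iter :: "nat \<Rightarrow> proj_pt \<Rightarrow> nat \<Rightarrow> proj_pt" where
  "rat_iter D f 0 = proj_class ([:0, 1:], 1)"
| "rat_iter D f (Suc n) = rat_comp D f (rat_iter D f n)"

text \<open>A pair of linear forms \<open>(\<alpha>X + \<beta>Y, \<gamma>X + \<delta>Y)\<close> is the matrix with rows \<open>(\<alpha>, \<beta>)\<close> and
  \<open>(\<gamma>, \<delta>)\<close>; its adjugate represents the inverse Moebius transformation.\<close>

definition pair_det :: "form_pair \<Rightarrow> complex" where
  "pair_det M = coeff (fst M) 1 * coeff (snd M) 0 - coeff (fst M) 0 * coeff (snd M) 1"

definition pair_adj :: "form_pair \<Rightarrow> form_pair" where
  "pair_adj M = ([:- coeff (fst M) 0, coeff (snd M) 0:], [:coeff (fst M) 1, - coeff (snd M) 1:])"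

definition pair_conj :: "nat \<Rightarrow> form_pair \<Rightarrow> form_pair \<Rightarrow> form_pair" where
  "pair_conj D M F = pair_comp 1 (pair_adj M) (pair_comp D F M)"

definition rat_conj :: "nat \<Rightarrow> proj_pt \<Rightarrow> proj_pt \<Rightarrow> proj_pt" where
  "rat_conj D m f = rat_comp 1 (pair_adj ` m) (rat_comp D f m)"


section \<open>Holomorphic families, Newton maps and rescalings\<close>

definition holomorphic_family :: "nat \<Rightarrow> (complex \<Rightarrow> proj_pt) \<Rightarrow> bool" where
  "holomorphic_family D f \<longleftrightarrow>
     (\<forall>t\<in>ball 0 1. \<exists>U v. open U \<and> t \<in> U \<and> U \<subseteq> ball 0 1 \<and>
        (\<forall>s\<in>U. v s \<in> form_pairs D - {(0, 0)} \<and> f s = proj_class (v s)) \<and>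
        (\<forall>i\<le>D. (\<lambda>s. coeff (fst (v s)) i) holomorphic_on U \<and>
               (\<lambda>s. coeff (snd (v s)) i) holomorphic_on U)) \<and>
     (\<forall>t\<in>ball 0 1 - {0}. f t \<in> rat_maps D)"

definition newton_point :: "complex poly \<Rightarrow> proj_pt" where
  "newton_point P = proj_class ([:0, 1:] * pderiv P - P, pderiv P)"

definition is_newton_map :: "nat \<Rightarrow> proj_pt \<Rightarrow> bool" where
  "is_newton_map d f \<longleftrightarrow> (\<exists>P. degree P = d \<and> lead_coeff P = 1 \<and> card {z. poly P z = 0} = d \<and>
     f = newton_point P)"

definition newton_family :: "nat \<Rightarrow> (complex \<Rightarrow> proj_pt) \<Rightarrow> bool" where
  "newton_family d f \<longleftrightarrow> holomorphic_family d f \<and> (\<forall>t\<in>ball 0 1 - {0}. is_newton_map d (f t))"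

text \<open>Locally uniform convergence of self-maps of the sphere on the complement of a set \<open>S\<close>,
  as \<open>t \<rightarrow> 0\<close>.\<close>

definition locally_uniform_limit_off ::
    "line_pt set \<Rightarrow> (complex \<Rightarrow> line_pt \<Rightarrow> line_pt) \<Rightarrow> (line_pt \<Rightarrow> line_pt) \<Rightarrow> bool" where
  "locally_uniform_limit_off S \<phi> \<psi> \<longleftrightarrow>
     (\<forall>z \<in> proj_line - S. \<exists>r>0. \<forall>\<epsilon>>0. \<forall>\<^sub>F t in at 0.
        \<forall>w \<in> proj_line - S. chordal z w < r \<longrightarrow> chordal (\<phi> t w) (\<psi> w) < \<epsilon>)"

definition rescales :: "nat \<Rightarrow> (complex \<Rightarrow> proj_pt) \<Rightarrow> (complex \<Rightarrow> proj_pt) \<Rightarrow> nat \<Rightarrow> bool" where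
  "rescales D f M q \<longleftrightarrow>
     (\<exists>e g S. e \<ge> 2 \<and> g \<in> rat_maps e \<and> finite S \<and> S \<subseteq> proj_line \<and>
        locally_uniform_limit_off S
          (\<lambda>t. rat_eval (D ^ q) (rat_conj (D ^ q) (M t) (rat_iter D (f t) q)))
          (rat_eval e g))"

definition is_rescaling :: "nat \<Rightarrow> (complex \<Rightarrow> proj_pt) \<Rightarrow> (complex \<Rightarrow> proj_pt) \<Rightarrow> nat \<Rightarrow> bool" where
  "is_rescaling D f M q \<longleftrightarrow> holomorphic_family 1 M \<and> q \<ge> 1 \<and> rescales D f M q \<and>
     (\<forall>p. 1 \<le> p \<and> p < q \<longrightarrow> \<not> rescales D f M p)"

text \<open>Convergence in projective space, as \<open>t \<rightarrow> 0\<close>: homogeneous coordinates can be chosen so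
  that they converge to homogeneous coordinates of the limit.\<close>

definition converges_subalgebraically :: "nat \<Rightarrow> (complex \<Rightarrow> proj_pt) \<Rightarrow> proj_pt \<Rightarrow> bool" where
  "converges_subalgebraically D f l \<longleftrightarrow>
     (\<exists>v v0. v0 \<in> form_pairs D - {(0, 0)} \<and> l = proj_class v0 \<and>
        (\<forall>\<^sub>F t in at 0. v t \<in> form_pairs D - {(0, 0)} \<and> f t = proj_class (v t)) \<and>
        (\<forall>i\<le>D. ((\<lambda>t. coeff (fst (v t)) i) \<longlongrightarrow> coeff (fst v0) i) (at 0) \<and>
               ((\<lambda>t. coeff (snd (v t)) i) \<longlongrightarrow> coeff (snd v0) i) (at 0)))"


section \<open>The semistable locus\<close>

text \<open>
  Polynomial functions on the vector space of pairs of forms of degree \<open>D\<close>, whose coordinates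
  are \<open>Inl i\<close> and \<open>Inr i\<close> (coefficient \<open>i\<close> of the first and second form), \<open>i \<le> D\<close>.
  The group \<open>SL\<^sub>2\<close> acts linearly on it by conjugation, and a point is semistable if some
  invariant homogeneous polynomial of positive degree does not vanish there.
\<close>

type_synonym mpoly = "((nat + nat) \<Rightarrow>\<^sub>0 nat) \<Rightarrow>\<^sub>0 complex"

definition mpoly_eval :: "mpoly \<Rightarrow> form_pair \<Rightarrow> complex" where
  "mpoly_eval Q v = (\<Sum>m\<in>Poly_Mapping.keys Q. Poly_Mapping.lookup Q m *
     (\<Prod>x\<in>Poly_Mapping.keys m. case_sum (coeff (fst v)) (coeff (snd v)) x ^ Poly_Mapping.lookup m x))"

definition homogeneous_mpoly :: "nat \<Rightarrow> nat \<Rightarrow> mpoly \<Rightarrow> bool" where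
  "homogeneous_mpoly D n Q \<longleftrightarrow>
     (\<forall>m\<in>Poly_Mapping.keys Q. Poly_Mapping.keys m \<subseteq> {..D} <+> {..D} \<and> (\<Sum>x\<in>Poly_Mapping.keys m. Poly_Mapping.lookup m x) = n)"

definition SL2_invariant :: "nat \<Rightarrow> mpoly \<Rightarrow> bool" where
  "SL2_invariant D Q \<longleftrightarrow>
     (\<forall>A\<in>form_pairs 1. pair_det A = 1 \<longrightarrow>
        (\<forall>v\<in>form_pairs D. mpoly_eval Q (pair_conj D A v) = mpoly_eval Q v))"

definition Rat_ss :: "nat \<Rightarrow> proj_pt set" where
  "Rat_ss D = {f \<in> proj_space D. \<exists>n Q. n \<ge> 1 \<and> homogeneous_mpoly D n Q \<and> SL2_invariant D Q \<and>
     (\<forall>v\<in>f. mpoly_eval Q v \<noteq> 0)}"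

end

theory Submission
  imports Defs "HOL-Complex_Analysis.Complex_Analysis" "HOL-Computational_Algebra.Fundamental_Theorem_Algebra"
begin

text \<open>
  Fix an ultrafilter \<open>U\<close> refining \<open>t \<rightarrow> 0\<close>; along it every complex-valued family converges or tends to
  infinity, so families of discs \<open>c(t) + \<rho>(t) z\<close> behave like type II points of the Berkovich line.
  Call such a disc near a root if it contains a root of \<open>P\<^sub>t\<close> up to bounded rescaling.  A Newton map
  fixes a disc near two roots, contracts a disc near a single root towards that root, and
  sends a disc near no root but near a critical point of \<open>P\<^sub>t\<close> to a disc near a root.  Hence the
  disc of a rescaling of period \<open>q \<ge> 2\<close> and its iterates are near neither, and between these discs the
  Newton map has polynomial limits; as \<open>N' = P P'' / P'\<^sup>2\<close>, such a limit has degree \<open>e\<^sub>i = 1 + z\<^sub>i\<close>,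
  where \<open>z\<^sub>i\<close> counts the zeros of \<open>P''\<close> in the disc.  Consecutive discs are disjoint, since
  otherwise they would be strictly nested all around the cycle, or equal, and there would be a
  rescaling of period one.  So \<open>e\<^sub>i + e\<^sub>i\<^sub>+\<^sub>1 \<le> d\<close>, and the limit of the \<open>q\<close>-th iterate is a
  polynomial of degree \<open>\<Prod> e\<^sub>i \<le> (d/2)\<^sup>q \<le> d\<^sup>q/2\<close> with all its holes at infinity.  A
  one-parameter subgroup shows that such a form is not semistable.
\<close>

section \<open>Limits along ultrafilters\<close>

text \<open>Three notions of limit meet here: minimality of \<open>q\<close> speaks of locally
  uniform limits as t tends to 0, semistability of limits of coefficients, the dynamics of limits
  along \<open>U\<close>. A locally uniform limit sees only the quotient of the two limit forms, so
  it is matched with the coefficient limit by cross multiplication. Passing to \<open>U\<close> is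
  harmless for the given limit \<open>f\<close>, but minimality can only be contradicted by a limit
  as t tends to 0; this is where holomorphy in t enters. Suppose that the Newton map sends the disc
  of the frame to itself. If the first conjugate has, after cancelling common factors, a coefficient
  limit of degree at least 2, then minimality fails; otherwise the limit is a Moebius map, hence so
  is that of the q-th iterate, which must have degree at least 2. The other obstacle is that a
  moving frame need not fix infinity, while polynomial limits only show in affine coordinates. Each
  frame is therefore factored through an affine one, with a correction that converges to a matrix of
  determinant 1, and invariants do not notice this matrix. The bound \<open>d\<close> is 2 plus the
  d - 2 zeros of P'', shared out between two disjoint discs.\<close>

definition ultra :: "'a filter \<Rightarrow> bool" where
  "ultra U \<longleftrightarrow> U \<noteq> bot \<and> (\<forall>P. eventually P U \<or> eventually (\<lambda>x. \<not> P x) U)"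

lemma ultra_neq_bot: "ultra U \<Longrightarrow> U \<noteq> bot"
  by (simp add: ultra_def)

lemma ultra_cases:
  assumes "ultra U"
  obtains "eventually P U" | "eventually (\<lambda>x. \<not> P x) U"
  using assms by (auto simp: ultra_def)

text \<open>Zorn's lemma for the proper filters below \<open>F\<close>, finer filters counting as
  larger. A maximal one decides every property, as otherwise intersecting with the principal filter
  of that property would give a finer proper filter.\<close>

lemma exists_ultra_le:
  fixes F :: "'a filter"
  assumes F: "F \<noteq> bot"
  shows "\<exists>U. ultra U \<and> U \<le> F"
proof -
  define A where "A = {G. G \<noteq> bot \<and> G \<le> F}"
  have po: "partial_order_on A (relation_of (\<lambda>a b. b \<le> a) A)"
    by (rule partial_order_on_relation_ofI) auto
  have "\<exists>m \<in> A. \<forall>a \<in> A. a \<le> m \<longrightarrow> a = m"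
  proof (rule predicate_Zorn[OF po])
    fix C assume C: "C \<in> Chains (relation_of (\<lambda>a b. b \<le> a) A)"
    have CA: "C \<subseteq> A" using C by (auto simp: Chains_def relation_of_def)
    have tot: "a \<le> b \<or> b \<le> a" if "a \<in> C" "b \<in> C" for a b
      using C that by (auto simp: Chains_def relation_of_def)
    show "\<exists>u\<in>A. \<forall>a\<in>C. u \<le> a"
    proof (cases "C = {}")
      case True
      then show ?thesis using F by (auto simp: A_def)
    next
      case False
      \<comment> \<open>What is eventual for the infimum of a chain is already eventual for one
        member, so the infimum is proper.\<close>
      have base: "eventually P (Inf C) \<longleftrightarrow> (\<exists>b\<in>C. eventually P b)" for P
      proof (rule eventually_Inf_base[OF False])
        fix G H assume "G \<in> C" "H \<in> C"
        then show "\<exists>x\<in>C. x \<le> inf G H"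
          using tot[of G H] by (metis inf.absorb1 inf.absorb2 order_refl)
      qed
      have "Inf C \<noteq> bot"
        using base[of "\<lambda>x. False"] CA by (auto simp: A_def trivial_limit_def)
      moreover have "Inf C \<le> F"
        using False CA by (metis (no_types, lifting) A_def Inf_lower all_not_in_conv mem_Collect_eq order_trans subsetD)
      ultimately show ?thesis
        by (intro bexI[of _ "Inf C"]) (auto simp: A_def Inf_lower)
    qed
  qed
  then obtain U where U: "U \<in> A" "\<And>a. a \<in> A \<Longrightarrow> a \<le> U \<Longrightarrow> a = U" by blast
  have "eventually P U \<or> eventually (\<lambda>x. \<not> P x) U" for P
  proof (cases "inf U (principal {x. P x}) = bot")
    case True
    then have "eventually (\<lambda>x. \<not> P x) U"
      by (simp add: trivial_limit_def eventually_inf_principal)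
    then show ?thesis ..
  next
    case False
    then have "inf U (principal {x. P x}) \<in> A"
      using U(1) by (auto simp: A_def intro: le_infI1)
    then have "inf U (principal {x. P x}) = U" by (intro U(2)) auto
    then have "U \<le> principal {x. P x}" by (metis inf.cobounded2)
    then have "eventually P U" by (simp add: le_principal)
    then show ?thesis ..
  qed
  then show ?thesis using U(1) by (auto simp: A_def ultra_def)
qed

text \<open>The image filter has a cluster point in \<open>K\<close> by compactness; an ultrafilter
  decides membership in each neighbourhood, which turns a cluster point into a limit.\<close>

lemma ultra_compact:
  fixes f :: "'a \<Rightarrow> 'b :: topological_space"
  assumes U: "ultra U" and K: "compact K" and f: "eventually (\<lambda>x. f x \<in> K) U"
  shows "\<exists>l\<in>K. (f \<longlongrightarrow> l) U"
proof -
  have "filtermap f U \<noteq> bot" using U by (simp add: ultra_def filtermap_bot_iff)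
  moreover have "eventually (\<lambda>y. y \<in> K) (filtermap f U)"
    using f by (simp add: eventually_filtermap)
  ultimately obtain l where l: "l \<in> K" "inf (nhds l) (filtermap f U) \<noteq> bot"
    using K unfolding compact_filter by blast
  have "(f \<longlongrightarrow> l) U"
  proof (rule topological_tendstoI)
    fix S assume S: "open S" "l \<in> S"
    show "eventually (\<lambda>x. f x \<in> S) U"
    proof (rule ultra_cases[OF U, of "\<lambda>x. f x \<in> S"], assumption)
      assume "eventually (\<lambda>x. f x \<notin> S) U"
      then have "eventually (\<lambda>y. y \<notin> S) (filtermap f U)" by (simp add: eventually_filtermap)
      moreover have "eventually (\<lambda>y. y \<in> S) (nhds l)" using S by (rule eventually_nhds_in_open)
      ultimately have "eventually (\<lambda>y. False) (inf (nhds l) (filtermap f U))"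
        unfolding eventually_inf by blast
      then show ?thesis using l(2) by (simp add: trivial_limit_def)
    qed
  qed
  then show ?thesis using l(1) by blast
qed

lemma ultra_lim_or_infinity:
  fixes f :: "'a \<Rightarrow> complex"
  assumes U: "ultra U"
  shows "(\<exists>l. (f \<longlongrightarrow> l) U) \<or> filterlim f at_infinity U"
proof (cases "\<exists>B. eventually (\<lambda>x. norm (f x) \<le> B) U")
  case True
  then obtain B where B: "eventually (\<lambda>x. norm (f x) \<le> B) U" by blast
  have "\<exists>l\<in>cball 0 B. (f \<longlongrightarrow> l) U"
    by (rule ultra_compact[OF U compact_cball]) (use B in simp)
  then show ?thesis by blast
next
  case False
  have "filterlim f at_infinity U"
    unfolding filterlim_at_infinity[OF order_refl]
  proof safe
    fix r :: real assume "r > 0"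
    from False have "\<not> eventually (\<lambda>x. norm (f x) \<le> r) U" by blast
    then have "eventually (\<lambda>x. \<not> norm (f x) \<le> r) U" using U by (auto simp: ultra_def)
    then show "eventually (\<lambda>x. r \<le> norm (f x)) U" by eventually_elim auto
  qed
  then show ?thesis ..
qed

lemma ultra_ratio_cases:
  fixes a b :: "'a \<Rightarrow> complex"
  assumes U: "ultra U"
  obtains l where "((\<lambda>t. a t / b t) \<longlongrightarrow> l) U" | "((\<lambda>t. b t / a t) \<longlongrightarrow> 0) U"
proof -
  consider l where "((\<lambda>t. a t / b t) \<longlongrightarrow> l) U" | "filterlim (\<lambda>t. a t / b t) at_infinity U"
    using ultra_lim_or_infinity[OF U] by blast
  then show ?thesis
  proof cases
    case 2
    then have "((\<lambda>t. inverse (a t / b t)) \<longlongrightarrow> 0) U"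
      using filterlim_inverse_at_iff[of "\<lambda>t. a t / b t" U] by (auto simp: filterlim_at)
    then show ?thesis using that(2) by (simp add: field_simps)
  qed (use that in blast)
qed

text \<open>The finiteness of the fibres of the limit is what makes such limits composable.\<close>

definition lim_off :: "'a filter \<Rightarrow> ('a \<Rightarrow> complex \<Rightarrow> complex) \<Rightarrow> (complex \<Rightarrow> complex) \<Rightarrow> complex set \<Rightarrow> bool" where
  "lim_off U F h S \<longleftrightarrow> finite S \<and> (\<forall>a. finite {z. z \<notin> S \<and> h z = a}) \<and>
     (\<forall>z w. z \<notin> S \<longrightarrow> (w \<longlongrightarrow> z) U \<longrightarrow> ((\<lambda>t. F t (w t)) \<longlongrightarrow> h z) U)"

lemma lim_offI:
  assumes "finite S" "\<And>a. finite {z. z \<notin> S \<and> h z = a}"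
    and "\<And>z w. z \<notin> S \<Longrightarrow> (w \<longlongrightarrow> z) U \<Longrightarrow> ((\<lambda>t. F t (w t)) \<longlongrightarrow> h z) U"
  shows "lim_off U F h S"
  unfolding lim_off_def using assms by simp

lemma lim_offD: "lim_off U F h S \<Longrightarrow> z \<notin> S \<Longrightarrow> (w \<longlongrightarrow> z) U \<Longrightarrow> ((\<lambda>t. F t (w t)) \<longlongrightarrow> h z) U"
  unfolding lim_off_def by blast

lemma lim_off_finite: "lim_off U F h S \<Longrightarrow> finite S"
  unfolding lim_off_def by blast

lemma lim_off_fibre: "lim_off U F h S \<Longrightarrow> finite {z. z \<notin> S \<and> h z = a}"
  unfolding lim_off_def by blast

text \<open>Limits along moving points \<open>w t\<close>, not only at fixed ones, allow the inner
  value to be fed into the outer limit. The exceptional set grows by the preimage of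
  \<open>T\<close>, finite because the fibres of \<open>h\<close> are.\<close>

lemma lim_off_comp:
  assumes F: "lim_off U F h S" and G: "lim_off U G k T"
  shows "lim_off U (\<lambda>t z. G t (F t z)) (k \<circ> h) (S \<union> {z. z \<notin> S \<and> h z \<in> T})"
proof -
  have pre: "finite {z. z \<notin> S \<and> h z \<in> A}" if "finite A" for A
  proof -
    have "{z. z \<notin> S \<and> h z \<in> A} = (\<Union>a\<in>A. {z. z \<notin> S \<and> h z = a})" by auto
    then show ?thesis using that lim_off_fibre[OF F] by simp
  qed
  show ?thesis
  proof (rule lim_offI)
    show "finite (S \<union> {z. z \<notin> S \<and> h z \<in> T})"
      using lim_off_finite[OF F] pre[OF lim_off_finite[OF G]] by simp
    show "finite {z. z \<notin> S \<union> {z. z \<notin> S \<and> h z \<in> T} \<and> (k \<circ> h) z = a}" for a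
      by (rule finite_subset[OF _ pre[OF lim_off_fibre[OF G, of a]]]) auto
    fix z w assume z: "z \<notin> S \<union> {z. z \<notin> S \<and> h z \<in> T}" and w: "(w \<longlongrightarrow> z) U"
    have "((\<lambda>t. F t (w t)) \<longlongrightarrow> h z) U" using z by (intro lim_offD[OF F _ w]) simp
    moreover have "h z \<notin> T" using z by blast
    ultimately show "((\<lambda>t. G t (F t (w t))) \<longlongrightarrow> (k \<circ> h) z) U"
      unfolding comp_def by (intro lim_offD[OF G, of "h z" "\<lambda>t. F t (w t)"])
  qed
qed

lemma lim_off_eq:
  assumes "lim_off U F h S" "lim_off U F k T" "ultra U" "z \<notin> S \<union> T"
  shows "h z = k z"
  using tendsto_unique[OF ultra_neq_bot[OF assms(3)] lim_offD[OF assms(1), of z "\<lambda>_. z"]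
      lim_offD[OF assms(2), of z "\<lambda>_. z"]] assms(4) by simp

section \<open>Affine discs and the comparison of their sizes and positions\<close>

text \<open>A pair \<open>(c, \<rho>)\<close> stands for the moving frame \<open>z \<mapsto> c + \<rho> z\<close>.\<close>

type_synonym 'a scale = "('a \<Rightarrow> complex) \<times> ('a \<Rightarrow> complex)"

definition up :: "'a scale \<Rightarrow> 'a \<Rightarrow> complex \<Rightarrow> complex" where
  "up A t z = fst A t + snd A t * z"

definition down :: "'a scale \<Rightarrow> 'a \<Rightarrow> complex \<Rightarrow> complex" where
  "down A t z = (z - fst A t) / snd A t"

definition scale :: "'a scale \<Rightarrow> bool" where
  "scale A \<longleftrightarrow> (\<forall>t. snd A t \<noteq> 0)"

lemma down_up [simp]: "scale A \<Longrightarrow> down A t (up A t z) = z"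
  by (simp add: down_def up_def scale_def)

lemma up_down [simp]: "scale A \<Longrightarrow> up A t (down A t z) = z"
  by (simp add: down_def up_def scale_def)

text \<open>The transition map from the coordinate of \<open>A\<close> to that of \<open>B\<close>
  tends to \<open>l * z + m\<close>. Thus \<open>l \<noteq> 0\<close> says that both pairs describe
  the same disc up to bounded rescaling, and \<open>l = 0\<close> that the disc of \<open>A\<close>
  is strictly smaller and lies in that of \<open>B\<close>.\<close>

definition rel_scale :: "'a filter \<Rightarrow> 'a scale \<Rightarrow> 'a scale \<Rightarrow> complex \<Rightarrow> complex \<Rightarrow> bool" where
  "rel_scale U A B l m \<longleftrightarrow> ((\<lambda>t. snd A t / snd B t) \<longlongrightarrow> l) U \<and> ((\<lambda>t. down B t (fst A t)) \<longlongrightarrow> m) U"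

lemma rel_scale_tendsto:
  assumes "rel_scale U A B l m" "(w \<longlongrightarrow> z) U"
  shows "((\<lambda>t. down B t (up A t (w t))) \<longlongrightarrow> l * z + m) U"
proof -
  have "((\<lambda>t. (snd A t / snd B t) * w t + down B t (fst A t)) \<longlongrightarrow> l * z + m) U"
    using assms unfolding rel_scale_def by (intro tendsto_intros) auto
  then show ?thesis
    by (simp add: down_def up_def algebra_simps diff_divide_distrib add_divide_distrib)
qed

lemma rel_scale_sym:
  assumes "rel_scale U A B l m" "l \<noteq> 0" "scale A" "scale B"
  shows "rel_scale U B A (1 / l) (- m / l)"
proof -
  have 1: "((\<lambda>t. inverse (snd A t / snd B t)) \<longlongrightarrow> inverse l) U"
    using assms by (intro tendsto_intros) (auto simp: rel_scale_def)
  have "((\<lambda>t. - down B t (fst A t) * inverse (snd A t / snd B t)) \<longlongrightarrow> - m * inverse l) U"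
    using assms by (intro tendsto_mult tendsto_minus 1) (auto simp: rel_scale_def)
  moreover have "- down B t (fst A t) * inverse (snd A t / snd B t) = down A t (fst B t)" for t
    using assms(3,4) by (simp add: scale_def down_def field_simps)
  ultimately show ?thesis using 1 by (simp add: rel_scale_def field_simps)
qed

text \<open>An affine map is determined by the images of two points, and so is its limit as long as
  the two points stay apart in the coordinate of \<open>A\<close>.\<close>

lemma rel_scaleI_two_points:
  assumes "scale A" "scale B" "a \<noteq> a'"
    and "((\<lambda>t. down A t (x t)) \<longlongrightarrow> a) U" "((\<lambda>t. down A t (x' t)) \<longlongrightarrow> a') U"
    and "((\<lambda>t. down B t (x t)) \<longlongrightarrow> b) U" "((\<lambda>t. down B t (x' t)) \<longlongrightarrow> b') U"
  shows "rel_scale U A B ((b - b') / (a - a')) (b - (b - b') / (a - a') * a)"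
proof -
  have "((\<lambda>t. (down B t (x t) - down B t (x' t)) / (down A t (x t) - down A t (x' t))) \<longlongrightarrow> (b - b') / (a - a')) U"
    by (intro tendsto_divide tendsto_diff assms(4-7)) (use assms(3) in simp)
  moreover have "eventually (\<lambda>t. down A t (x t) - down A t (x' t) \<noteq> 0) U"
    by (rule tendsto_imp_eventually_ne[OF tendsto_diff[OF assms(4,5)]]) (use assms(3) in simp)
  then have "eventually (\<lambda>t. (down B t (x t) - down B t (x' t)) / (down A t (x t) - down A t (x' t)) = snd A t / snd B t) U"
  proof eventually_elim
    case (elim t)
    have e: "(down B t (x t) - down B t (x' t)) = (x t - x' t) / snd B t"
        "(down A t (x t) - down A t (x' t)) = (x t - x' t) / snd A t"
      by (simp_all add: down_def diff_divide_distrib)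
    have "x t - x' t \<noteq> 0" using elim unfolding e by auto
    moreover have "snd A t \<noteq> 0" "snd B t \<noteq> 0" using assms(1,2) by (auto simp: scale_def)
    ultimately show ?case unfolding e by (simp add: field_simps)
  qed
  ultimately have 1: "((\<lambda>t. snd A t / snd B t) \<longlongrightarrow> (b - b') / (a - a')) U"
    by (rule Lim_transform_eventually)
  have "((\<lambda>t. down B t (x t) - snd A t / snd B t * down A t (x t)) \<longlongrightarrow> b - (b - b') / (a - a') * a) U"
    by (intro tendsto_diff tendsto_mult 1 assms(4-7))
  moreover have "down B t (x t) - snd A t / snd B t * down A t (x t) = down B t (fst A t)" for t
  proof -
    have "snd A t \<noteq> 0" "snd B t \<noteq> 0" using assms(1,2) by (auto simp: scale_def)
    then show ?thesis by (simp add: down_def field_simps)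
  qed
  ultimately show ?thesis using 1 by (simp add: rel_scale_def)
qed

text \<open>Uniqueness of the image disc: the scale at which a family of maps has a nonconstant
  limit is determined up to bounded rescaling. Two points of the source that both limits separate
  serve as test points.\<close>

lemma rel_scale_of_lims:
  assumes "ultra U" "scale A" "scale B"
    and "lim_off U (\<lambda>t z. down A t (F t z)) h S" "lim_off U (\<lambda>t z. down B t (F t z)) k T"
  obtains l m where "l \<noteq> 0" "rel_scale U A B l m"
proof -
  have inf: "infinite (UNIV :: complex set)" by (rule infinite_UNIV_char_0)
  have fin: "finite (S \<union> T)"
    using lim_off_finite[OF assms(4)] lim_off_finite[OF assms(5)] by simp
  obtain x where x: "x \<notin> S \<union> T" using ex_new_if_finite[OF inf fin] ..
  have "finite (S \<union> T \<union> {z. z \<notin> S \<and> h z = h x} \<union> {z. z \<notin> T \<and> k z = k x})"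
    using fin lim_off_fibre[OF assms(4)] lim_off_fibre[OF assms(5)] by simp
  \<comment> \<open>Avoiding the fibres through \<open>x\<close> of both limits gives
    \<open>h x \<noteq> h y\<close>, so that the transition converges, and
    \<open>k x \<noteq> k y\<close>, so that its factor is nonzero.\<close>
  from ex_new_if_finite[OF inf this] obtain y
    where y: "y \<notin> S \<union> T \<union> {z. z \<notin> S \<and> h z = h x} \<union> {z. z \<notin> T \<and> k z = k x}" ..
  have h: "h x \<noteq> h y" and k: "k x \<noteq> k y" and xy: "x \<notin> S" "y \<notin> S" "x \<notin> T" "y \<notin> T"
    using x y by auto
  show ?thesis
  proof (rule that)
    show "(k x - k y) / (h x - h y) \<noteq> 0" using h k by simp
    show "rel_scale U A B ((k x - k y) / (h x - h y)) (k x - (k x - k y) / (h x - h y) * h x)"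
      by (rule rel_scaleI_two_points[OF assms(2,3) h])
         (rule lim_offD[OF assms(4)] lim_offD[OF assms(5)], rule xy, rule tendsto_const)+
  qed
qed

lemma lim_off_affine:
  assumes F: "lim_off U F h S" and l: "l \<noteq> 0"
    and G: "\<And>z w. (w \<longlongrightarrow> z) U \<Longrightarrow> ((\<lambda>t. G t (w t)) \<longlongrightarrow> l * z + m) U"
  shows "lim_off U (\<lambda>t z. G t (F t z)) (\<lambda>z. l * h z + m) S"
proof -
  have "{z. l * z + m = a} = {(a - m) / l}" for a using l by (auto simp: field_simps)
  then have "finite {z. z \<notin> {} \<and> l * z + m = a}" for a by simp
  then have "lim_off U G (\<lambda>z. l * z + m) {}" using G by (intro lim_offI) auto
  from lim_off_comp[OF F this] show ?thesis by (simp add: comp_def)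
qed

lemma lim_off_rescale:
  assumes "lim_off U (\<lambda>t z. down A t (F t z)) h S" "rel_scale U A B l m" "l \<noteq> 0" "scale A"
  shows "lim_off U (\<lambda>t z. down B t (F t z)) (\<lambda>z. l * h z + m) S"
proof -
  have "lim_off U (\<lambda>t z. down B t (up A t (down A t (F t z)))) (\<lambda>z. l * h z + m) S"
    by (rule lim_off_affine[OF assms(1,3)]) (rule rel_scale_tendsto[OF assms(2)])
  then show ?thesis using assms(4) by simp
qed

lemma scaleD: "scale A \<Longrightarrow> snd A t \<noteq> 0"
  by (simp add: scale_def)

text \<open>If the claim failed, chosen bad points would converge in \<open>K\<close> along
  \<open>U\<close>, against the hypothesis at their limit. This is how convergence along moving
  points becomes uniform on compact sets.\<close>

lemma ultra_uniform:
  fixes K :: "complex set"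
  assumes U: "ultra U" and K: "compact K"
    and Q: "\<And>z w. z \<in> K \<Longrightarrow> (w \<longlongrightarrow> z) U \<Longrightarrow> eventually (\<lambda>t. Q t (w t)) U"
  shows "eventually (\<lambda>t. \<forall>z\<in>K. Q t z) U"
proof (rule ultra_cases[OF U, of "\<lambda>t. \<forall>z\<in>K. Q t z"], assumption)
  assume bad: "eventually (\<lambda>t. \<not> (\<forall>z\<in>K. Q t z)) U"
  define w where "w t = (SOME z. z \<in> K \<and> \<not> Q t z)" for t
  have w: "eventually (\<lambda>t. w t \<in> K \<and> \<not> Q t (w t)) U"
    using bad
  proof eventually_elim
    case (elim t)
    then have "\<exists>z. z \<in> K \<and> \<not> Q t z" by blast
    then show ?case unfolding w_def by (rule someI_ex)
  qed
  then have "eventually (\<lambda>t. w t \<in> K) U" by eventually_elim simp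
  from ultra_compact[OF U K this] obtain z where "z \<in> K" "(w \<longlongrightarrow> z) U" ..
  from Q[OF this] w have "eventually (\<lambda>t. False) U" by eventually_elim simp
  then show ?thesis by eventually_elim simp
qed

section \<open>Reduction of polynomials and logarithmic derivatives at a disc\<close>

definition near :: "'a filter \<Rightarrow> 'a scale \<Rightarrow> ('a \<Rightarrow> complex) \<Rightarrow> bool" where
  "near U A x \<longleftrightarrow> (\<exists>l. ((\<lambda>t. down A t (x t)) \<longlongrightarrow> l) U)"

definition nlim :: "'a filter \<Rightarrow> 'a scale \<Rightarrow> ('a \<Rightarrow> complex) \<Rightarrow> complex" where
  "nlim U A x = (SOME l. ((\<lambda>t. down A t (x t)) \<longlongrightarrow> l) U)"

lemma nlim: "near U A x \<Longrightarrow> ((\<lambda>t. down A t (x t)) \<longlongrightarrow> nlim U A x) U"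
  unfolding near_def nlim_def by (rule someI_ex)

lemma not_near: "ultra U \<Longrightarrow> \<not> near U A x \<Longrightarrow> filterlim (\<lambda>t. down A t (x t)) at_infinity U"
  using ultra_lim_or_infinity[of U "\<lambda>t. down A t (x t)"] unfolding near_def by blast

lemma near_rel_scale:
  assumes "rel_scale U A B l m" "scale A" "near U A x"
  shows "near U B x"
proof -
  have "((\<lambda>t. down B t (up A t (down A t (x t)))) \<longlongrightarrow> l * nlim U A x + m) U"
    by (rule rel_scale_tendsto[OF assms(1) nlim[OF assms(3)]])
  then show ?thesis using assms(2) by (auto simp: near_def)
qed

lemma up_minus: "scale A \<Longrightarrow> up A t z - x = snd A t * (z - down A t x)"
  using scaleD[of A t] by (simp add: up_def down_def field_simps)

text \<open>A factor with a near root survives as a factor of the limit; one with a far root becomes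
  constant on the disc, and only its size remains, which is normalised away.\<close>

lemma linear_scale:
  fixes U :: "'a filter"
  assumes U: "ultra U" and A: "scale A"
  obtains k where "\<And>t. k t \<noteq> 0" "\<And>z w. (w \<longlongrightarrow> z) U \<Longrightarrow>
    ((\<lambda>t. k t * (up A t (w t) - x t)) \<longlongrightarrow> (if near U A x then z - nlim U A x else 1)) U"
proof (cases "near U A x")
  case True
  have sA: "snd A t \<noteq> 0" for t using A by (simp add: scale_def)
  show ?thesis
  proof (rule that)
    show "1 / snd A t \<noteq> 0" for t using sA by simp
    fix z and w :: "'a \<Rightarrow> complex" assume w: "(w \<longlongrightarrow> z) U"
    have "((\<lambda>t. w t - down A t (x t)) \<longlongrightarrow> z - nlim U A x) U"
      by (intro tendsto_diff w nlim True)
    then show "((\<lambda>t. 1 / snd A t * (up A t (w t) - x t)) \<longlongrightarrow> (if near U A x then z - nlim U A x else 1)) U"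
      using True by (simp add: up_minus[OF A] sA)
  qed
next
  case False
  have sA: "snd A t \<noteq> 0" for t using A by (simp add: scale_def)
  have inf: "filterlim (\<lambda>t. down A t (x t)) at_infinity U" using not_near[OF U False] .
  \<comment> \<open>Up to \<open>snd A t\<close> the factor is \<open>w t - down A t (x t)\<close>;
    division by minus its large term leaves \<open>1 - w t / down A t (x t)\<close>. The value 1
    only keeps \<open>k\<close> nonzero for every t.\<close>
  define k where "k t = (if down A t (x t) = 0 then 1 else - 1 / (snd A t * down A t (x t)))" for t
  show ?thesis
  proof (rule that)
    show "k t \<noteq> 0" for t using sA by (simp add: k_def)
    fix z and w :: "'a \<Rightarrow> complex" assume w: "(w \<longlongrightarrow> z) U"
    have "((\<lambda>t. 1 - w t / down A t (x t)) \<longlongrightarrow> 1 - 0) U"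
      by (intro tendsto_diff tendsto_const tendsto_divide_0[OF w inf])
    moreover have "eventually (\<lambda>t. down A t (x t) \<noteq> 0) U"
      using inf by (rule filterlim_at_infinity_imp_eventually_ne)
    then have "eventually (\<lambda>t. 1 - w t / down A t (x t) = k t * (up A t (w t) - x t)) U"
    proof eventually_elim
      case (elim t)
      then show ?case using sA[of t] by (simp add: up_minus[OF A] k_def field_simps)
    qed
    ultimately have "((\<lambda>t. k t * (up A t (w t) - x t)) \<longlongrightarrow> 1 - 0) U"
      by (rule Lim_transform_eventually)
    then show "((\<lambda>t. k t * (up A t (w t) - x t)) \<longlongrightarrow> (if near U A x then z - nlim U A x else 1)) U"
      using False by simp
  qed
qed

definition root_prod :: "nat set \<Rightarrow> (nat \<Rightarrow> complex) \<Rightarrow> complex poly" where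
  "root_prod J x = (\<Prod>j\<in>J. [:- x j, 1:])"

definition near_set :: "'a filter \<Rightarrow> 'a scale \<Rightarrow> nat set \<Rightarrow> ('a \<Rightarrow> nat \<Rightarrow> complex) \<Rightarrow> nat set" where
  "near_set U A J x = {j\<in>J. near U A (\<lambda>t. x t j)}"

text \<open>The reduction of \<open>root_prod\<close> at the disc of \<open>A\<close>, up to a
  scalar. For finite \<open>J\<close> its degree is the number of near indices, so roots that
  collide in the limit are counted with multiplicity.\<close>

definition near_poly :: "'a filter \<Rightarrow> 'a scale \<Rightarrow> nat set \<Rightarrow> ('a \<Rightarrow> nat \<Rightarrow> complex) \<Rightarrow> complex poly" where
  "near_poly U A J x = root_prod (near_set U A J x) (\<lambda>j. nlim U A (\<lambda>t. x t j))"

lemma poly_root_prod: "poly (root_prod J x) z = (\<Prod>j\<in>J. z - x j)"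
  by (simp add: root_prod_def poly_prod)

lemma root_prod_nonzero: "finite J \<Longrightarrow> root_prod J x \<noteq> 0"
  by (simp add: root_prod_def)

lemma root_prod_monic: "finite J \<Longrightarrow> lead_coeff (root_prod J x) = 1"
proof (induction J rule: finite_induct)
  case (insert a J)
  then have "root_prod (insert a J) x = [:- x a, 1:] * root_prod J x" by (simp add: root_prod_def)
  then have "lead_coeff (root_prod (insert a J) x) = lead_coeff [:- x a, 1:] * lead_coeff (root_prod J x)"
    by (metis lead_coeff_mult)
  then show ?case using insert by simp
qed (simp add: root_prod_def)

lemma degree_root_prod: "finite J \<Longrightarrow> degree (root_prod J x) = card J"
  unfolding root_prod_def by (subst degree_prod_eq_sum_degree) auto

lemma poly_root_prod_factorization:
  fixes p :: "complex poly"
  obtains x where "p = smult (lead_coeff p) (root_prod {..<degree p} x)"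
proof -
  have "\<exists>x. p = smult (lead_coeff p) (root_prod {..<degree p} x)"
  proof (induction "degree p" arbitrary: p)
    case 0
    then obtain c where "p = [:c:]" using degree_eq_zeroE[of p] by metis
    then show ?case by (simp add: root_prod_def)
  next
    case (Suc n)
    then have "\<not> constant (poly p)" by (simp add: constant_degree)
    then obtain c where "poly p c = 0" using fundamental_theorem_of_algebra by blast
    then obtain q where q: "p = [:- c, 1:] * q" by (auto simp: poly_eq_0_iff_dvd)
    then have "q \<noteq> 0" using Suc(2) by auto
    then have dq: "degree q = n" using Suc(2) unfolding q by (subst (asm) degree_mult_eq) auto
    from Suc(1)[OF dq[symmetric]] obtain x where x: "q = smult (lead_coeff q) (root_prod {..<n} x)"
      using dq by auto
    have l: "lead_coeff p = lead_coeff q" unfolding q lead_coeff_mult by simp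
    have "root_prod {..<Suc n} (x(n := c)) = [:- c, 1:] * root_prod {..<n} x"
      by (simp add: root_prod_def lessThan_Suc)
    then have "p = smult (lead_coeff p) (root_prod {..<Suc n} (x(n := c)))"
      unfolding l using q x by (metis mult_smult_right)
    then show ?case using Suc(2) by auto
  qed
  then show ?thesis using that by blast
qed

lemma logderiv_root_prod:
  assumes "finite J" "\<forall>j\<in>J. z \<noteq> x j"
  shows "poly (pderiv (root_prod J x)) z = poly (root_prod J x) z * (\<Sum>j\<in>J. 1 / (z - x j))"
  using assms
proof (induction J rule: finite_induct)
  case empty
  then show ?case by (simp add: root_prod_def)
next
  case (insert a J)
  have e: "root_prod (insert a J) x = [:- x a, 1:] * root_prod J x"
    using insert by (simp add: root_prod_def)
  have "poly (pderiv (root_prod (insert a J) x)) z =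
     (z - x a) * poly (pderiv (root_prod J x)) z + poly (root_prod J x) z"
    unfolding e pderiv_mult poly_add poly_mult by (simp add: pderiv_pCons algebra_simps)
  also have "\<dots> = (z - x a) * poly (root_prod J x) z * (1 / (z - x a) + (\<Sum>j\<in>J. 1 / (z - x j)))"
  proof -
    have "z - x a \<noteq> 0" using insert by simp
    then show ?thesis using insert by (simp add: distrib_left mult.assoc)
  qed
  finally show ?case using insert by (simp add: poly_root_prod)
qed

lemma root_prod_scale:
  fixes U :: "'a filter"
  assumes U: "ultra U" and A: "scale A" and J: "finite J" and a: "\<And>t. a t \<noteq> 0"
  obtains k where "\<And>t. k t \<noteq> 0" "\<And>z w. (w \<longlongrightarrow> z) U \<Longrightarrow>
    ((\<lambda>t. k t * poly (smult (a t) (root_prod J (x t))) (up A t (w t))) \<longlongrightarrow> poly (near_poly U A J x) z) U"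
proof -
  have "\<forall>j. \<exists>k. (\<forall>t. k t \<noteq> 0) \<and> (\<forall>z w. (w \<longlongrightarrow> z) U \<longrightarrow>
    ((\<lambda>t. k t * (up A t (w t) - x t j)) \<longlongrightarrow>
      (if near U A (\<lambda>t. x t j) then z - nlim U A (\<lambda>t. x t j) else 1)) U)"
  proof
    fix j
    from linear_scale[OF U A, of "\<lambda>t. x t j"] obtain k where "\<And>t. k t \<noteq> 0" "\<And>z w. (w \<longlongrightarrow> z) U \<Longrightarrow>
      ((\<lambda>t. k t * (up A t (w t) - x t j)) \<longlongrightarrow>
        (if near U A (\<lambda>t. x t j) then z - nlim U A (\<lambda>t. x t j) else 1)) U" by blast
    then show "\<exists>k. (\<forall>t. k t \<noteq> 0) \<and> (\<forall>z w. (w \<longlongrightarrow> z) U \<longrightarrow>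
      ((\<lambda>t. k t * (up A t (w t) - x t j)) \<longlongrightarrow>
        (if near U A (\<lambda>t. x t j) then z - nlim U A (\<lambda>t. x t j) else 1)) U)" by blast
  qed
  from choice[OF this] obtain k where k: "\<And>j t. k j t \<noteq> 0" "\<And>j z w. (w \<longlongrightarrow> z) U \<Longrightarrow>
      ((\<lambda>t. k j t * (up A t (w t) - x t j)) \<longlongrightarrow>
        (if near U A (\<lambda>t. x t j) then z - nlim U A (\<lambda>t. x t j) else 1)) U" by blast
  show ?thesis
  proof (rule that)
    show "(\<Prod>j\<in>J. k j t) / a t \<noteq> 0" for t using k(1) J a by simp
    fix z and w :: "'a \<Rightarrow> complex" assume w: "(w \<longlongrightarrow> z) U"
    have "((\<lambda>t. \<Prod>j\<in>J. k j t * (up A t (w t) - x t j)) \<longlongrightarrow>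
       (\<Prod>j\<in>J. if near U A (\<lambda>t. x t j) then z - nlim U A (\<lambda>t. x t j) else 1)) U"
      by (intro tendsto_prod k(2) w)
    moreover have "(\<Prod>j\<in>J. k j t * (up A t (w t) - x t j)) =
        (\<Prod>j\<in>J. k j t) / a t * poly (smult (a t) (root_prod J (x t))) (up A t (w t))" for t
      using a[of t] by (simp add: poly_root_prod prod.distrib)
    moreover have "(\<Prod>j\<in>J. if near U A (\<lambda>t. x t j) then z - nlim U A (\<lambda>t. x t j) else 1) =
        poly (near_poly U A J x) z"
      unfolding near_poly_def poly_root_prod near_set_def
      using J by (simp add: prod.inter_filter)
    ultimately show "((\<lambda>t. (\<Prod>j\<in>J. k j t) / a t * poly (smult (a t) (root_prod J (x t))) (up A t (w t)))
       \<longlongrightarrow> poly (near_poly U A J x) z) U" by simp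
  qed
qed

text \<open>For a family whose zeros have not been named: they are chosen separately for each t, and
  the constant degree provides an index set that does not depend on t.\<close>

lemma poly_family_scale:
  assumes U: "ultra U" and A: "scale A" and q: "\<And>t. q t \<noteq> 0 \<and> degree (q t) = n"
  obtains k Q where "\<And>t. k t \<noteq> 0" "Q \<noteq> 0" "\<And>z w. (w \<longlongrightarrow> z) U \<Longrightarrow>
    ((\<lambda>t. k t * poly (q t) (up A t (w t))) \<longlongrightarrow> poly Q z) U"
proof -
  have "\<forall>t. \<exists>x. q t = smult (lead_coeff (q t)) (root_prod {..<n} x)"
    using poly_root_prod_factorization q by metis
  then obtain x where x: "\<And>t. q t = smult (lead_coeff (q t)) (root_prod {..<n} (x t))" by metis
  have lc: "lead_coeff (q t) \<noteq> 0" for t using q leading_coeff_neq_0 by blast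
  obtain k where k: "\<And>t. k t \<noteq> 0" "\<And>z w. (w \<longlongrightarrow> z) U \<Longrightarrow>
    ((\<lambda>t. k t * poly (smult (lead_coeff (q t)) (root_prod {..<n} (x t))) (up A t (w t)))
      \<longlongrightarrow> poly (near_poly U A {..<n} x) z) U"
    by (rule root_prod_scale[where x = x and J = "{..<n}" and a = "\<lambda>t. lead_coeff (q t)", OF U A finite_lessThan lc]) blast
  have "near_poly U A {..<n} x \<noteq> 0"
    unfolding near_poly_def near_set_def by (rule root_prod_nonzero) simp
  moreover have "((\<lambda>t. k t * poly (q t) (up A t (w t))) \<longlongrightarrow> poly (near_poly U A {..<n} x) z) U"
    if "(w \<longlongrightarrow> z) U" for z w
    using k(2)[OF that] by (simp only: x[symmetric])
  ultimately show ?thesis using that k(1) by blast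
qed

text \<open>In the coordinate of \<open>A\<close> the Newton displacement is minus the inverse of
  this sum, so its limit decides what the next disc is. The term of a far root has a denominator
  that tends to infinity.\<close>

lemma logderiv_scale:
  assumes U: "ultra U" and A: "scale A" and J: "finite J"
    and z: "\<And>j. j \<in> near_set U A J x \<Longrightarrow> z \<noteq> nlim U A (\<lambda>t. x t j)" and w: "(w \<longlongrightarrow> z) U"
  shows "((\<lambda>t. \<Sum>j\<in>J. snd A t / (up A t (w t) - x t j)) \<longlongrightarrow>
            (\<Sum>j\<in>near_set U A J x. 1 / (z - nlim U A (\<lambda>t. x t j)))) U"
    and "eventually (\<lambda>t. \<forall>j\<in>J. up A t (w t) \<noteq> x t j) U"
proof -
  have sA: "snd A t \<noteq> 0" for t using A by (simp add: scale_def)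
  have e: "snd A t / (up A t (w t) - x t j) = 1 / (w t - down A t (x t j))" for t j
    using sA[of t] by (simp add: up_minus[OF A])
  have "((\<lambda>t. \<Sum>j\<in>J. snd A t / (up A t (w t) - x t j)) \<longlongrightarrow>
            (\<Sum>j\<in>J. if near U A (\<lambda>t. x t j) then 1 / (z - nlim U A (\<lambda>t. x t j)) else 0)) U"
  proof (rule tendsto_sum)
    fix j assume j: "j \<in> J"
    show "((\<lambda>t. snd A t / (up A t (w t) - x t j)) \<longlongrightarrow>
        (if near U A (\<lambda>t. x t j) then 1 / (z - nlim U A (\<lambda>t. x t j)) else 0)) U"
    proof (cases "near U A (\<lambda>t. x t j)")
      case True
      then have "z - nlim U A (\<lambda>t. x t j) \<noteq> 0" using z[of j] j by (simp add: near_set_def)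
      then have "((\<lambda>t. 1 / (w t - down A t (x t j))) \<longlongrightarrow> 1 / (z - nlim U A (\<lambda>t. x t j))) U"
        by (intro tendsto_divide tendsto_diff tendsto_const w nlim True)
      then show ?thesis using True e by simp
    next
      case False
      have "filterlim (\<lambda>t. down A t (x t j) + - w t) at_infinity U"
        by (rule tendsto_add_filterlim_at_infinity'[OF not_near[OF U False] tendsto_minus[OF w]])
      then have "((\<lambda>t. (- 1) / (down A t (x t j) + - w t)) \<longlongrightarrow> 0) U"
        by (rule tendsto_divide_0[OF tendsto_const])
      moreover have "(- 1) / (down A t (x t j) + - w t) = 1 / (w t - down A t (x t j))" for t
        using minus_divide_divide[of 1 "w t - down A t (x t j)"] by simp
      ultimately have "((\<lambda>t. 1 / (w t - down A t (x t j))) \<longlongrightarrow> 0) U" by simp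
      then show ?thesis using False e by simp
    qed
  qed
  moreover have "(\<Sum>j\<in>J. if near U A (\<lambda>t. x t j) then 1 / (z - nlim U A (\<lambda>t. x t j)) else 0) =
     (\<Sum>j\<in>near_set U A J x. 1 / (z - nlim U A (\<lambda>t. x t j)))"
    unfolding near_set_def using J by (simp add: sum.inter_filter)
  ultimately show "((\<lambda>t. \<Sum>j\<in>J. snd A t / (up A t (w t) - x t j)) \<longlongrightarrow>
            (\<Sum>j\<in>near_set U A J x. 1 / (z - nlim U A (\<lambda>t. x t j)))) U" by simp
  have "eventually (\<lambda>t. up A t (w t) \<noteq> x t j) U" if j: "j \<in> J" for j
  proof -
    obtain k where k: "\<And>t. k t \<noteq> 0" "\<And>z w. (w \<longlongrightarrow> z) U \<Longrightarrow>
      ((\<lambda>t. k t * (up A t (w t) - x t j)) \<longlongrightarrow>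
        (if near U A (\<lambda>t. x t j) then z - nlim U A (\<lambda>t. x t j) else 1)) U"
      by (rule linear_scale[OF U A, of "\<lambda>t. x t j"]) blast
    have "(if near U A (\<lambda>t. x t j) then z - nlim U A (\<lambda>t. x t j) else 1) \<noteq> 0"
      using z[of j] j by (simp add: near_set_def)
    from tendsto_imp_eventually_ne[OF k(2)[OF w] this]
    show ?thesis by eventually_elim auto
  qed
  then show "eventually (\<lambda>t. \<forall>j\<in>J. up A t (w t) \<noteq> x t j) U"
    using J by (simp add: eventually_ball_finite)
qed

lemma exists_pderiv:
  fixes V :: "complex poly"
  assumes "V \<noteq> 0"
  obtains g where "pderiv g = V" "poly g 0 = 0" "degree g = Suc (degree V)"
proof -
  define g where "g = (\<Sum>i\<le>degree V. monom (coeff V i / of_nat (Suc i)) (Suc i))"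
  have "pderiv g = (\<Sum>i\<le>degree V. monom (coeff V i) i)"
    unfolding g_def higher_pderiv_sum[of 1, simplified]
    by (intro sum.cong refl) (simp add: pderiv_monom field_simps del: of_nat_Suc)
  then have g: "pderiv g = V" by (simp add: poly_as_sum_of_monoms)
  moreover have "poly g 0 = 0" by (simp add: g_def poly_sum poly_monom)
  moreover have "degree g \<noteq> 0" using g assms by (metis pderiv_eq_0_iff)
  then have "degree g = Suc (degree V)" using degree_pderiv[of g] g by simp
  ultimately show ?thesis using that by blast
qed

section \<open>One step of a Newton map at a given scale\<close>

text \<open>Division by zero gives the junk value \<open>z\<close> at a zero of the derivative.
  \<open>poly_step\<close> and \<open>regular\<close> therefore record that such points are
  avoided.\<close>

definition newt :: "complex poly \<Rightarrow> complex \<Rightarrow> complex" where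
  "newt p z = z - poly p z / poly (pderiv p) z"

lemma logderiv_tendsto:
  fixes U :: "'a filter" and w :: "'a \<Rightarrow> complex"
  assumes U: "ultra U" and A: "scale A" and J: "finite J"
    and z: "\<And>j. j \<in> near_set U A J x \<Longrightarrow> z \<noteq> nlim U A (\<lambda>t. x t j)" and w: "(w \<longlongrightarrow> z) U"
  shows "((\<lambda>t. snd A t * poly (pderiv (root_prod J (x t))) (up A t (w t)) / poly (root_prod J (x t)) (up A t (w t)))
            \<longlongrightarrow> (\<Sum>j\<in>near_set U A J x. 1 / (z - nlim U A (\<lambda>t. x t j)))) U"
    and "eventually (\<lambda>t. poly (root_prod J (x t)) (up A t (w t)) \<noteq> 0) U"
proof -
  have ev: "eventually (\<lambda>t. \<forall>j\<in>J. up A t (w t) \<noteq> x t j) U"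
    by (rule logderiv_scale(2)[OF U A J z w])
  then show "eventually (\<lambda>t. poly (root_prod J (x t)) (up A t (w t)) \<noteq> 0) U"
    by eventually_elim (use J in \<open>auto simp: poly_root_prod\<close>)
  from ev have "eventually (\<lambda>t. (\<Sum>j\<in>J. snd A t / (up A t (w t) - x t j)) =
      snd A t * poly (pderiv (root_prod J (x t))) (up A t (w t)) / poly (root_prod J (x t)) (up A t (w t))) U"
  proof eventually_elim
    case (elim t)
    have "poly (root_prod J (x t)) (up A t (w t)) \<noteq> 0" using elim J by (auto simp: poly_root_prod)
    moreover have "(\<Sum>j\<in>J. snd A t / (up A t (w t) - x t j)) = snd A t * (\<Sum>j\<in>J. 1 / (up A t (w t) - x t j))"
      by (simp add: sum_distrib_left)
    ultimately show ?case unfolding logderiv_root_prod[OF J elim] by simp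
  qed
  then show "((\<lambda>t. snd A t * poly (pderiv (root_prod J (x t))) (up A t (w t)) / poly (root_prod J (x t)) (up A t (w t)))
            \<longlongrightarrow> (\<Sum>j\<in>near_set U A J x. 1 / (z - nlim U A (\<lambda>t. x t j)))) U"
    by (rule Lim_transform_eventually[rotated]) (rule logderiv_scale(1)[OF U A J z w])
qed

lemma exists_non_root:
  fixes Q :: "complex poly"
  assumes "Q \<noteq> 0"
  obtains z where "poly Q z \<noteq> 0"
  using assms poly_all_0_iff_0[of Q] by blast

text \<open>The zeros of P, P' and P'' are numbered independently for each t, without any
  continuity. This suffices because along an ultrafilter each numbered zero is either near a given
  disc or tends to infinity in its coordinate.\<close>

locale newton_limit =
  fixes U :: "'a filter" and d :: nat and P :: "'a \<Rightarrow> complex poly" and r p s :: "'a \<Rightarrow> nat \<Rightarrow> complex"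
  assumes U: "ultra U" and d: "2 \<le> d"
    and P: "\<And>t. P t = root_prod {..<d} (r t)"
    and P': "\<And>t. pderiv (P t) = smult (of_nat d) (root_prod {..<d - 1} (p t))"
    and P'': "\<And>t. pderiv (pderiv (P t)) = smult (of_nat (d * (d - 1))) (root_prod {..<d - 2} (s t))"
begin

lemma P_scale:
  assumes A: "scale A"
  obtains k where "\<And>t. k t \<noteq> 0" "\<And>z w. (w \<longlongrightarrow> z) U \<Longrightarrow>
    ((\<lambda>t. k t * poly (P t) (up A t (w t))) \<longlongrightarrow> poly (near_poly U A {..<d} r) z) U"
proof -
  obtain k where "\<And>t. k t \<noteq> 0" "\<And>z w. (w \<longlongrightarrow> z) U \<Longrightarrow>
    ((\<lambda>t. k t * poly (smult 1 (root_prod {..<d} (r t))) (up A t (w t))) \<longlongrightarrow> poly (near_poly U A {..<d} r) z) U"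
    by (rule root_prod_scale[where x = r and J = "{..<d}" and a = "\<lambda>t. 1", OF U A]) (auto simp del: smult_1_left)
  then show ?thesis using that[of k] by (simp add: P)
qed

lemma P'_scale:
  assumes A: "scale A"
  obtains k where "\<And>t. k t \<noteq> 0" "\<And>z w. (w \<longlongrightarrow> z) U \<Longrightarrow>
    ((\<lambda>t. k t * poly (pderiv (P t)) (up A t (w t))) \<longlongrightarrow> poly (near_poly U A {..<d - 1} p) z) U"
proof -
  have "of_nat d \<noteq> (0 :: complex)" using d by simp
  from root_prod_scale[where x = p and J = "{..<d - 1}" and a = "\<lambda>t. of_nat d", OF U A finite_lessThan this]
  obtain k where k: "\<And>t. k t \<noteq> 0" "\<And>z w. (w \<longlongrightarrow> z) U \<Longrightarrow>
    ((\<lambda>t. k t * poly (smult (of_nat d) (root_prod {..<d - 1} (p t))) (up A t (w t))) \<longlongrightarrow> poly (near_poly U A {..<d - 1} p) z) U"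
    by blast
  show ?thesis by (rule that[OF k(1) k(2)[folded P']])
qed

lemma P''_scale:
  assumes A: "scale A"
  obtains k where "\<And>t. k t \<noteq> 0" "\<And>z w. (w \<longlongrightarrow> z) U \<Longrightarrow>
    ((\<lambda>t. k t * poly (pderiv (pderiv (P t))) (up A t (w t))) \<longlongrightarrow> poly (near_poly U A {..<d - 2} s) z) U"
proof -
  have "of_nat (d * (d - 1)) \<noteq> (0 :: complex)" using d by (simp add: of_nat_diff)
  from root_prod_scale[where x = s and J = "{..<d - 2}" and a = "\<lambda>t. of_nat (d * (d - 1))", OF U A finite_lessThan this]
  obtain k where k: "\<And>t. k t \<noteq> 0" "\<And>z w. (w \<longlongrightarrow> z) U \<Longrightarrow>
    ((\<lambda>t. k t * poly (smult (of_nat (d * (d - 1))) (root_prod {..<d - 2} (s t))) (up A t (w t))) \<longlongrightarrow> poly (near_poly U A {..<d - 2} s) z) U"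
    by blast
  show ?thesis by (rule that[OF k(1) k(2)[folded P'']])
qed

lemma near_root_iff: "poly (near_poly U A J x) z = 0 \<longleftrightarrow>
  (finite (near_set U A J x) \<and> (\<exists>j\<in>near_set U A J x. z = nlim U A (\<lambda>t. x t j)))"
  by (cases "finite (near_set U A J x)") (auto simp: near_poly_def poly_root_prod)

text \<open>Newton's method commutes with affine changes of coordinate, so in the coordinate of
  \<open>A\<close> the map tends to the Newton map of the reduction \<open>Q\<close> of P. With two
  near roots \<open>Q\<close> has degree at least 2 and this limit is not constant; with one it
  would be the constant map to the root.\<close>

lemma step_two_near_roots:
  assumes A: "scale A" and Z: "2 \<le> card (near_set U A {..<d} r)"
  obtains h S where "lim_off U (\<lambda>t z. down A t (newt (P t) (up A t z))) h S"
proof -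
  let ?Z = "near_set U A {..<d} r"
  define Q where "Q = near_poly U A {..<d} r"
  have fZ: "finite ?Z" by (simp add: near_set_def)
  have Q0: "Q \<noteq> 0" and dQ: "degree Q = card ?Z" and lQ: "coeff Q (card ?Z) = 1"
    using root_prod_nonzero[OF fZ] degree_root_prod[OF fZ] root_prod_monic[OF fZ]
    by (auto simp: Q_def near_poly_def)
  have Q'0: "pderiv Q \<noteq> 0" using Z dQ by (simp add: pderiv_eq_0_iff)
  define S where "S = {z. poly Q z = 0} \<union> {z. poly (pderiv Q) z = 0}"
  have "lim_off U (\<lambda>t z. down A t (newt (P t) (up A t z))) (\<lambda>z. z - poly Q z / poly (pderiv Q) z) S"
  proof (rule lim_offI)
    show "finite S" using Q0 Q'0 by (simp add: S_def poly_roots_finite)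
    fix a
    \<comment> \<open>The top coefficient of (z - a) Q' - Q is the degree of \<open>Q\<close> minus
      1; its being nonzero makes the fibre over \<open>a\<close> finite.\<close>
    have "coeff ([:- a, 1:] * pderiv Q - Q) (card ?Z) = of_nat (card ?Z) - 1"
    proof -
      obtain n where n: "card ?Z = Suc n" using Z by (cases "card ?Z") auto
      have "coeff (pderiv Q) (card ?Z) = 0" by (rule coeff_eq_0) (use dQ n degree_pderiv[of Q] in simp)
      then have "coeff ([:- a, 1:] * pderiv Q) (card ?Z) = coeff (pderiv Q) n"
        using n by simp
      also have "\<dots> = of_nat (card ?Z)" using n lQ by (simp add: coeff_pderiv)
      finally show ?thesis using lQ by simp
    qed
    also have "\<dots> \<noteq> 0" using Z by (metis of_nat_1 of_nat_eq_iff right_minus_eq not_less_eq_eq numeral_2_eq_2 order_refl One_nat_def)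
    finally have "[:- a, 1:] * pderiv Q - Q \<noteq> 0" by (metis coeff_0)
    then have "finite {z. poly ([:- a, 1:] * pderiv Q - Q) z = 0}" by (rule poly_roots_finite)
    then show "finite {z. z \<notin> S \<and> z - poly Q z / poly (pderiv Q) z = a}"
    proof (rule finite_subset[rotated], safe)
      fix z assume "z \<notin> S"
      then show "poly ([:- (z - poly Q z / poly (pderiv Q) z), 1:] * pderiv Q - Q) z = 0"
        by (simp add: S_def field_simps)
    qed
  next
    fix z and w :: "'a \<Rightarrow> complex" assume z: "z \<notin> S" and w: "(w \<longlongrightarrow> z) U"
    have zn: "z \<noteq> nlim U A (\<lambda>t. r t j)" if "j \<in> ?Z" for j
      using z that fZ by (auto simp: S_def Q_def near_root_iff)
    define T where "T = (\<Sum>j\<in>?Z. 1 / (z - nlim U A (\<lambda>t. r t j)))"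
    have QT: "poly (pderiv Q) z = poly Q z * T"
      unfolding Q_def near_poly_def T_def by (rule logderiv_root_prod[OF fZ]) (use zn in blast)
    then have T0: "T \<noteq> 0" using z by (auto simp: S_def)
    have l: "((\<lambda>t. snd A t * poly (pderiv (P t)) (up A t (w t)) / poly (P t) (up A t (w t))) \<longlongrightarrow> T) U"
      unfolding P T_def by (rule logderiv_tendsto(1)[OF U A finite_lessThan zn w])
    have "((\<lambda>t. w t - 1 / (snd A t * poly (pderiv (P t)) (up A t (w t)) / poly (P t) (up A t (w t)))) \<longlongrightarrow> z - 1 / T) U"
      by (intro tendsto_diff tendsto_divide tendsto_const w l T0)
    moreover have "w t - 1 / (snd A t * poly (pderiv (P t)) (up A t (w t)) / poly (P t) (up A t (w t))) =
       down A t (newt (P t) (up A t (w t)))" for t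
      using scaleD[OF A, of t] by (simp add: newt_def down_def up_def diff_divide_distrib add_divide_distrib)
    moreover have "1 / T = poly Q z / poly (pderiv Q) z"
      unfolding QT using z by (simp add: S_def)
    ultimately show "((\<lambda>t. down A t (newt (P t) (up A t (w t)))) \<longlongrightarrow> z - poly Q z / poly (pderiv Q) z) U"
      by simp
  qed
  then show ?thesis by (rule that)
qed

text \<open>A single near root is superattracting at this scale: with P = (z - r) E the first order
  terms cancel, and N - r equals (z - r)^2 (E'/E) / (1 + (z - r) E'/E). As E has no near zero, the
  denominator tends to 1, and the image disc, centred at the root, shrinks relative to
  \<open>A\<close>.\<close>

lemma step_one_near_root:
  assumes A: "scale A" and Z: "near_set U A {..<d} r = {j0}"
  obtains A' h S where "scale A'" "lim_off U (\<lambda>t z. down A' t (newt (P t) (up A t z))) h S"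
    "near_set U A' {..<d} r = {j0}" "((\<lambda>t. snd A' t / snd A t) \<longlongrightarrow> 0) U"
proof -
  define J where "J = {..<d} - {j0}"
  define E where "E t = root_prod J (r t)" for t
  have j0: "j0 < d" and nj0: "near U A (\<lambda>t. r t j0)" using Z by (auto simp: near_set_def)
  have fJ: "finite J" and cJ: "card J = d - 1" using j0 by (auto simp: J_def)
  have ZJ: "near_set U A J r = {}" using Z by (auto simp: near_set_def J_def)
  have PE: "P t = [:- r t j0, 1:] * E t" for t
    unfolding P E_def root_prod_def J_def using j0 by (subst prod.remove[of _ j0]) auto
  have E0: "E t \<noteq> 0" and dE: "degree (E t) = d - 1" for t
    unfolding E_def using root_prod_nonzero[OF fJ] degree_root_prod[OF fJ] cJ by auto
  have dE': "pderiv (E t) \<noteq> 0 \<and> degree (pderiv (E t)) = d - 2" for t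
    using d dE[of t] degree_pderiv[of "E t"] by (auto simp: pderiv_eq_0_iff)
  obtain k V where k: "\<And>t. k t \<noteq> 0" and V0: "V \<noteq> 0" and kV: "\<And>z w. (w \<longlongrightarrow> z) U \<Longrightarrow>
    ((\<lambda>t. k t * poly (pderiv (E t)) (up A t (w t))) \<longlongrightarrow> poly V z) U"
    by (rule poly_family_scale[where q = "\<lambda>t. pderiv (E t)", OF U A dE']) blast
  have "\<And>t :: 'a. (1 :: complex) \<noteq> 0" by simp
  from root_prod_scale[where x = r and J = J and a = "\<lambda>t. 1", OF U A fJ this]
  obtain k1 where k1: "\<And>t. k1 t \<noteq> 0" and k1E: "\<And>z w. (w \<longlongrightarrow> z) U \<Longrightarrow>
    ((\<lambda>t. k1 t * poly (smult 1 (root_prod J (r t))) (up A t (w t))) \<longlongrightarrow> poly (near_poly U A J r) z) U"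
    by blast
  have kE: "((\<lambda>t. k1 t * poly (E t) (up A t (w t))) \<longlongrightarrow> 1) U" if "(w \<longlongrightarrow> z) U" for w z
    using k1E[OF that] by (simp add: E_def near_poly_def ZJ root_prod_def)
  have ld: "((\<lambda>t. snd A t * poly (pderiv (E t)) (up A t (w t)) / poly (E t) (up A t (w t))) \<longlongrightarrow> 0) U"
    and E0': "eventually (\<lambda>t. poly (E t) (up A t (w t)) \<noteq> 0) U" if "(w \<longlongrightarrow> z) U" for w z
    using logderiv_tendsto[where x = r, OF U A fJ _ that] by (simp_all add: ZJ E_def)
  \<comment> \<open>\<open>k1 t / k t\<close> is the size of E'/E on the disc: the scalars
    \<open>k\<close> and \<open>k1\<close> make E' and E converge, the latter to 1.\<close>
  define A' where "A' = ((\<lambda>t. r t j0), (\<lambda>t. snd A t ^ 2 * (k1 t / k t)))"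
  have sA': "scale A'" using k k1 scaleD[OF A] by (simp add: scale_def A'_def)
  define \<sigma> where "\<sigma> = nlim U A (\<lambda>t. r t j0)"
  have lim: "((\<lambda>t. down A' t (newt (P t) (up A t (w t)))) \<longlongrightarrow> poly ([:- \<sigma>, 1:] ^ 2 * V) z) U"
    if w: "(w \<longlongrightarrow> z) U" for w z
  proof -
    let ?u = "\<lambda>t. w t - down A t (r t j0)"
    let ?L = "\<lambda>t. snd A t * poly (pderiv (E t)) (up A t (w t)) / poly (E t) (up A t (w t))"
    have u: "(?u \<longlongrightarrow> z - \<sigma>) U" unfolding \<sigma>_def by (intro tendsto_diff w nlim nj0)
    have den: "((\<lambda>t. 1 + ?u t * ?L t) \<longlongrightarrow> 1 + (z - \<sigma>) * 0) U"
      by (intro tendsto_add tendsto_mult tendsto_const u ld[OF w])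
    have "((\<lambda>t. ?u t ^ 2 * ((k t * poly (pderiv (E t)) (up A t (w t))) / (k1 t * poly (E t) (up A t (w t)))) / (1 + ?u t * ?L t))
        \<longlongrightarrow> (z - \<sigma>) ^ 2 * (poly V z / 1) / (1 + (z - \<sigma>) * 0)) U"
      by (intro tendsto_divide tendsto_mult tendsto_power u kV[OF w] kE[OF w] den) auto
    moreover have "eventually (\<lambda>t. 1 + ?u t * ?L t \<noteq> 0) U"
      by (rule tendsto_imp_eventually_ne[OF den]) simp
    then have "eventually (\<lambda>t. ?u t ^ 2 * ((k t * poly (pderiv (E t)) (up A t (w t))) / (k1 t * poly (E t) (up A t (w t)))) / (1 + ?u t * ?L t)
       = down A' t (newt (P t) (up A t (w t)))) U"
      using E0'[OF w]
    proof eventually_elim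
      case (elim t)
      define e where "e = poly (E t) (up A t (w t))"
      define e' where "e' = poly (pderiv (E t)) (up A t (w t))"
      define u where "u = ?u t"
      define b where "b = snd A t"
      have nz: "e \<noteq> 0" "b \<noteq> 0" "k t \<noteq> 0" "k1 t \<noteq> 0" "1 + u * (b * e' / e) \<noteq> 0"
        using elim scaleD[OF A, of t] k[of t] k1[of t] by (simp_all add: e_def b_def u_def e'_def)
      have z: "up A t (w t) = r t j0 + b * u"
        using up_minus[OF A, of t "w t" "r t j0"] by (simp add: u_def b_def algebra_simps)
      have p: "poly (P t) (up A t (w t)) = b * u * e" unfolding PE poly_mult e_def[symmetric] by (simp add: z)
      have "poly (pderiv (P t)) (up A t (w t)) = b * u * e' + e"
        unfolding PE pderiv_mult poly_add poly_mult e_def[symmetric] e'_def[symmetric]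
        by (simp add: z pderiv_pCons)
      also have "\<dots> = e * (1 + u * (b * e' / e))" using nz by (simp add: field_simps)
      finally have p': "poly (pderiv (P t)) (up A t (w t)) = e * (1 + u * (b * e' / e))" .
      have "newt (P t) (up A t (w t)) - r t j0 = b * u - b * u / (1 + u * (b * e' / e))"
        unfolding newt_def p p' using nz by (simp add: z)
      also have "\<dots> = b ^ 2 * u ^ 2 * (e' / e) / (1 + u * (b * e' / e))"
        using nz by (simp add: field_simps power2_eq_square)
      finally have n: "newt (P t) (up A t (w t)) - r t j0 = b ^ 2 * u ^ 2 * (e' / e) / (1 + u * (b * e' / e))" .
      have "down A' t (newt (P t) (up A t (w t))) = b ^ 2 * u ^ 2 * (e' / e) / (1 + u * (b * e' / e)) / (b ^ 2 * (k1 t / k t))"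
        unfolding n[symmetric] by (simp add: down_def A'_def b_def)
      also have "\<dots> = u ^ 2 * ((k t * e') / (k1 t * e)) / (1 + u * (b * e' / e))"
        using nz(1-4) by (simp add: divide_simps)
      finally show ?case by (simp add: e_def e'_def u_def b_def)
    qed
    ultimately have "((\<lambda>t. down A' t (newt (P t) (up A t (w t)))) \<longlongrightarrow> (z - \<sigma>) ^ 2 * (poly V z / 1) / (1 + (z - \<sigma>) * 0)) U"
      by (rule Lim_transform_eventually)
    then show ?thesis by (simp add: poly_power)
  qed
  have fin: "finite {z. poly ([:- \<sigma>, 1:] ^ 2 * V) z = a}" for a
  proof -
    have "degree ([:- \<sigma>, 1:] ^ 2 * V) = 2 + degree V"
      using V0 by (subst degree_mult_eq) (auto simp: degree_power_eq)
    then have "[:- \<sigma>, 1:] ^ 2 * V - [:a:] \<noteq> 0"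
      by (metis add_is_0 degree_pCons_0 eq_iff_diff_eq_0 zero_neq_numeral)
    from poly_roots_finite[OF this] show ?thesis by simp
  qed
  have l: "lim_off U (\<lambda>t z. down A' t (newt (P t) (up A t z))) (poly ([:- \<sigma>, 1:] ^ 2 * V)) {}"
    by (rule lim_offI) (use fin lim in auto)
  \<comment> \<open>\<open>snd A' t / snd A t\<close> is the product of \<open>snd A t\<close> and
    E'/E, which tends to 0, divided by the normalised E'/E. It is read off at a point where the
    limit \<open>V\<close> of the latter does not vanish.\<close>
  obtain z where z: "poly V z \<noteq> 0" using exists_non_root[OF V0] .
  have "((\<lambda>t. (snd A t * poly (pderiv (E t)) (up A t z) / poly (E t) (up A t z)) * (k1 t * poly (E t) (up A t z)) / (k t * poly (pderiv (E t)) (up A t z)))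
      \<longlongrightarrow> 0 * 1 / poly V z) U"
    by (intro tendsto_divide tendsto_mult ld[OF tendsto_const] kE[OF tendsto_const] kV[OF tendsto_const] z)
  moreover have "eventually (\<lambda>t. k t * poly (pderiv (E t)) (up A t z) \<noteq> 0) U"
    by (rule tendsto_imp_eventually_ne[OF kV[OF tendsto_const] z])
  then have "eventually (\<lambda>t. (snd A t * poly (pderiv (E t)) (up A t z) / poly (E t) (up A t z)) * (k1 t * poly (E t) (up A t z)) / (k t * poly (pderiv (E t)) (up A t z)) = snd A' t / snd A t) U"
    using E0'[OF tendsto_const[of z]]
  proof eventually_elim
    case (elim t)
    then show ?case using scaleD[OF A, of t] by (simp add: A'_def power2_eq_square)
  qed
  ultimately have "((\<lambda>t. snd A' t / snd A t) \<longlongrightarrow> 0 * 1 / poly V z) U" by (rule Lim_transform_eventually)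
  then have sm: "((\<lambda>t. snd A' t / snd A t) \<longlongrightarrow> 0) U" by simp
  \<comment> \<open>\<open>A'\<close> lies strictly inside \<open>A\<close>, so a root near
    \<open>A'\<close> is near \<open>A\<close>, and only \<open>j0\<close> is.\<close>
  have rel: "rel_scale U A' A 0 \<sigma>"
    unfolding rel_scale_def \<sigma>_def using sm nlim[OF nj0] by (simp add: A'_def)
  have "near_set U A' {..<d} r = {j0}"
  proof
    show "near_set U A' {..<d} r \<subseteq> {j0}"
      using Z near_rel_scale[OF rel sA'] by (auto simp: near_set_def)
    have "down A' t (r t j0) = 0" for t by (simp add: down_def A'_def)
    then have "near U A' (\<lambda>t. r t j0)" by (auto simp: near_def)
    then show "{j0} \<subseteq> near_set U A' {..<d} r" using j0 by (simp add: near_set_def)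
  qed
  then show ?thesis using that[OF sA' l _ sm] by simp
qed

text \<open>On the disc P is constant in the limit and P' is a constant times \<open>Q\<close>, so
  the displacement -P/P' is a constant times -1/\<open>Q\<close>. It is much larger than the disc,
  because the radius times P'/P tends to 0. The image therefore has the size of P/P', and a disc of
  that size must see a root.\<close>

lemma step_no_near_root_near_critical:
  assumes A: "scale A" and Z: "near_set U A {..<d} r = {}" and W: "near_set U A {..<d - 1} p \<noteq> {}"
  obtains A' h S where "scale A'" "lim_off U (\<lambda>t z. down A' t (newt (P t) (up A t z))) h S"
    "near_set U A' {..<d} r \<noteq> {}"
proof -
  obtain k where k: "\<And>t. k t \<noteq> 0" and kP: "\<And>z w. (w \<longlongrightarrow> z) U \<Longrightarrow>
    ((\<lambda>t. k t * poly (P t) (up A t (w t))) \<longlongrightarrow> poly (near_poly U A {..<d} r) z) U"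
    by (rule P_scale[OF A]) blast
  have kP1: "((\<lambda>t. k t * poly (P t) (up A t (w t))) \<longlongrightarrow> 1) U" if "(w \<longlongrightarrow> z) U" for w z
    using kP[OF that] by (simp add: near_poly_def Z root_prod_def)
  obtain k' where k': "\<And>t. k' t \<noteq> 0" and kP': "\<And>z w. (w \<longlongrightarrow> z) U \<Longrightarrow>
    ((\<lambda>t. k' t * poly (pderiv (P t)) (up A t (w t))) \<longlongrightarrow> poly (near_poly U A {..<d - 1} p) z) U"
    by (rule P'_scale[OF A]) blast
  define Q where "Q = near_poly U A {..<d - 1} p"
  have fW: "finite (near_set U A {..<d - 1} p)" by (simp add: near_set_def)
  have Q0: "Q \<noteq> 0" and dQ: "degree Q = card (near_set U A {..<d - 1} p)"
    unfolding Q_def near_poly_def using root_prod_nonzero[OF fW] degree_root_prod[OF fW] by auto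
  have dQ0: "degree Q \<noteq> 0" using dQ fW W by simp
  \<comment> \<open>\<open>k' t / k t\<close> is the size of P/P' on this disc. The old centre may
    be kept since the disc is negligible at the new scale.\<close>
  define A' where "A' = (fst A, \<lambda>t. k' t / k t)"
  have sA': "scale A'" using k k' by (simp add: scale_def A'_def)
  have ld: "((\<lambda>t. snd A t * poly (pderiv (P t)) (up A t (w t)) / poly (P t) (up A t (w t))) \<longlongrightarrow> 0) U"
    and P0: "eventually (\<lambda>t. poly (P t) (up A t (w t)) \<noteq> 0) U" if "(w \<longlongrightarrow> z) U" for w z
    using logderiv_tendsto[where x = r and J = "{..<d}", OF U A finite_lessThan _ that] by (simp_all add: Z P)
  obtain z0 where z0: "poly Q z0 \<noteq> 0" using exists_non_root[OF Q0] .
  have P'0: "eventually (\<lambda>t. poly (pderiv (P t)) (up A t (w t)) \<noteq> 0) U"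
    if "(w \<longlongrightarrow> z) U" "poly Q z \<noteq> 0" for w z
    using tendsto_imp_eventually_ne[OF kP'[OF that(1)] that(2)[unfolded Q_def]]
    by (rule eventually_mono) auto
  have ratio: "((\<lambda>t. snd A t / snd A' t) \<longlongrightarrow> 0) U"
  proof -
    have "((\<lambda>t. (snd A t * poly (pderiv (P t)) (up A t z0) / poly (P t) (up A t z0)) * (k t * poly (P t) (up A t z0)) / (k' t * poly (pderiv (P t)) (up A t z0)))
      \<longlongrightarrow> 0 * 1 / poly Q z0) U"
      unfolding Q_def by (intro tendsto_divide tendsto_mult ld[OF tendsto_const] kP1[OF tendsto_const] kP'[OF tendsto_const])
        (use z0 in \<open>simp add: Q_def\<close>)
    moreover have "eventually (\<lambda>t. (snd A t * poly (pderiv (P t)) (up A t z0) / poly (P t) (up A t z0)) * (k t * poly (P t) (up A t z0)) / (k' t * poly (pderiv (P t)) (up A t z0)) = snd A t / snd A' t) U"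
      using P0[OF tendsto_const[of z0]] P'0[OF tendsto_const z0]
    proof eventually_elim
      case (elim t)
      then show ?case using k[of t] k'[of t] by (simp add: A'_def field_simps)
    qed
    ultimately have "((\<lambda>t. snd A t / snd A' t) \<longlongrightarrow> 0 * 1 / poly Q z0) U" by (rule Lim_transform_eventually)
    then show ?thesis by simp
  qed
  have fin: "finite {z. z \<notin> {z. poly Q z = 0} \<and> - 1 / poly Q z = a}" for a
  proof (rule finite_subset)
    have "degree (smult a Q + [:1:]) = degree Q" if "a \<noteq> 0"
      using that dQ0 by (subst degree_add_eq_left) auto
    then have "smult a Q + [:1:] \<noteq> 0" using dQ0 by (cases "a = 0") auto
    from poly_roots_finite[OF this] show "finite {z. poly (smult a Q + [:1:]) z = 0}" .
    show "{z. z \<notin> {z. poly Q z = 0} \<and> - 1 / poly Q z = a} \<subseteq> {z. poly (smult a Q + [:1:]) z = 0}"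
      by auto
  qed
  have lim: "((\<lambda>t. down A' t (newt (P t) (up A t (w t)))) \<longlongrightarrow> - 1 / poly Q z) U"
    if w: "(w \<longlongrightarrow> z) U" and z: "poly Q z \<noteq> 0" for w z
  proof -
    have "((\<lambda>t. snd A t / snd A' t * w t - (k t * poly (P t) (up A t (w t))) / (k' t * poly (pderiv (P t)) (up A t (w t))))
       \<longlongrightarrow> 0 * z - 1 / poly Q z) U"
      unfolding Q_def by (intro tendsto_diff tendsto_divide tendsto_mult ratio w kP1[OF w] kP'[OF w])
        (use z in \<open>simp add: Q_def\<close>)
    moreover have "eventually (\<lambda>t. snd A t / snd A' t * w t - (k t * poly (P t) (up A t (w t))) / (k' t * poly (pderiv (P t)) (up A t (w t)))
       = down A' t (newt (P t) (up A t (w t)))) U"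
      using P'0[OF w z]
    proof eventually_elim
      case (elim t)
      then show ?case using k[of t] k'[of t]
        by (simp add: A'_def down_def newt_def up_def field_simps)
    qed
    ultimately have "((\<lambda>t. down A' t (newt (P t) (up A t (w t)))) \<longlongrightarrow> 0 * z - 1 / poly Q z) U"
      by (rule Lim_transform_eventually)
    then show ?thesis by simp
  qed
  have l: "lim_off U (\<lambda>t z. down A' t (newt (P t) (up A t z))) (\<lambda>z. - 1 / poly Q z) {z. poly Q z = 0}"
    by (rule lim_offI[OF poly_roots_finite[OF Q0] fin lim]) auto
  have "near_set U A' {..<d} r \<noteq> {}"
  proof
    assume emp: "near_set U A' {..<d} r = {}"
    \<comment> \<open>\<open>v t\<close> is the point \<open>up A t z0\<close> seen from
      \<open>A'\<close>. With no root near \<open>A'\<close> the radius of \<open>A'\<close> times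
      P'/P would tend to 0 there, whereas it tends to \<open>poly Q z0\<close> by the choice of that
      radius.\<close>
    define v where "v t = (snd A t / snd A' t) * z0" for t
    have v: "(v \<longlongrightarrow> 0 * z0) U" unfolding v_def by (intro tendsto_mult ratio tendsto_const)
    have up: "up A' t (v t) = up A t z0" for t
      using scaleD[OF sA', of t] by (simp add: up_def v_def A'_def)
    have "((\<lambda>t. snd A' t * poly (pderiv (P t)) (up A' t (v t)) / poly (P t) (up A' t (v t))) \<longlongrightarrow> 0) U"
      using logderiv_tendsto(1)[where x = r and J = "{..<d}", OF U sA' finite_lessThan _ v] by (simp add: emp P)
    then have 0: "((\<lambda>t. snd A' t * poly (pderiv (P t)) (up A t z0) / poly (P t) (up A t z0)) \<longlongrightarrow> 0) U"
      unfolding up .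
    have "((\<lambda>t. (k' t * poly (pderiv (P t)) (up A t z0)) / (k t * poly (P t) (up A t z0))) \<longlongrightarrow> poly Q z0 / 1) U"
      unfolding Q_def by (intro tendsto_divide kP1[OF tendsto_const] kP'[OF tendsto_const]) simp
    then have "((\<lambda>t. snd A' t * poly (pderiv (P t)) (up A t z0) / poly (P t) (up A t z0)) \<longlongrightarrow> poly Q z0 / 1) U"
      by (simp add: A'_def)
    then have "poly Q z0 / 1 = 0" by (rule tendsto_unique[OF ultra_neq_bot[OF U] _ 0])
    then show False using z0 by simp
  qed
  then show ?thesis using that[OF sA' l] by simp
qed

lemma newt_deriv:
  assumes "poly (pderiv q) z \<noteq> 0"
  shows "(newt q has_field_derivative poly q z * poly (pderiv (pderiv q)) z / poly (pderiv q) z ^ 2) (at z)"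
proof -
  have "((\<lambda>z. z - poly q z / poly (pderiv q) z) has_field_derivative
     1 - (poly (pderiv q) z * poly (pderiv q) z - poly q z * poly (pderiv (pderiv q)) z) / (poly (pderiv q) z * poly (pderiv q) z)) (at z)"
    by (intro DERIV_diff DERIV_ident DERIV_divide poly_DERIV assms)
  then have "(newt q has_field_derivative
     1 - (poly (pderiv q) z * poly (pderiv q) z - poly q z * poly (pderiv (pderiv q)) z) / (poly (pderiv q) z * poly (pderiv q) z)) (at z)"
    by (simp add: newt_def[abs_def])
  then show ?thesis using assms by (simp add: diff_divide_distrib power2_eq_square)
qed

text \<open>Away from the roots and the critical points of \<open>P\<close> the map is determined by its
  derivative \<open>P P'' / P'\<^sup>2\<close>, whose only zeros at this scale come from \<open>P''\<close>.\<close>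

lemma step_no_near_root_no_near_critical:
  assumes A: "scale A" and Z: "near_set U A {..<d} r = {}" and W: "near_set U A {..<d - 1} p = {}"
  obtains A' g where "scale A'" "degree g = Suc (card (near_set U A {..<d - 2} s))"
    "\<And>w z. (w \<longlongrightarrow> z) U \<Longrightarrow> ((\<lambda>t. down A' t (newt (P t) (up A t (w t)))) \<longlongrightarrow> poly g z) U"
    "\<And>w z. (w \<longlongrightarrow> z) U \<Longrightarrow> eventually (\<lambda>t. poly (pderiv (P t)) (up A t (w t)) \<noteq> 0) U"
proof -
  obtain k where k: "\<And>t. k t \<noteq> 0" and kP: "\<And>z w. (w \<longlongrightarrow> z) U \<Longrightarrow>
    ((\<lambda>t. k t * poly (P t) (up A t (w t))) \<longlongrightarrow> poly (near_poly U A {..<d} r) z) U"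
    by (rule P_scale[OF A]) blast
  have kP1: "((\<lambda>t. k t * poly (P t) (up A t (w t))) \<longlongrightarrow> 1) U" if "(w \<longlongrightarrow> z) U" for w z
    using kP[OF that] by (simp add: near_poly_def Z root_prod_def)
  obtain k' where k': "\<And>t. k' t \<noteq> 0" and kP': "\<And>z w. (w \<longlongrightarrow> z) U \<Longrightarrow>
    ((\<lambda>t. k' t * poly (pderiv (P t)) (up A t (w t))) \<longlongrightarrow> poly (near_poly U A {..<d - 1} p) z) U"
    by (rule P'_scale[OF A]) blast
  have kP'1: "((\<lambda>t. k' t * poly (pderiv (P t)) (up A t (w t))) \<longlongrightarrow> 1) U" if "(w \<longlongrightarrow> z) U" for w z
    using kP'[OF that] unfolding near_poly_def W by (simp add: root_prod_def)
  obtain k'' where k'': "\<And>t. k'' t \<noteq> 0" and kP'': "\<And>z w. (w \<longlongrightarrow> z) U \<Longrightarrow>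
    ((\<lambda>t. k'' t * poly (pderiv (pderiv (P t))) (up A t (w t))) \<longlongrightarrow> poly (near_poly U A {..<d - 2} s) z) U"
    by (rule P''_scale[OF A]) blast
  define V where "V = near_poly U A {..<d - 2} s"
  have fV: "finite (near_set U A {..<d - 2} s)" by (simp add: near_set_def)
  have V0: "V \<noteq> 0" and dV: "degree V = card (near_set U A {..<d - 2} s)"
    unfolding V_def near_poly_def using root_prod_nonzero[OF fV] degree_root_prod[OF fV] by auto
  obtain g where g: "pderiv g = V" "poly g 0 = 0" "degree g = Suc (degree V)"
    by (rule exists_pderiv[OF V0])
  \<comment> \<open>Centre and radius are dictated by two normalisations: \<open>F t 0 = 0\<close>,
    and the derivative of \<open>F t\<close> is the quantity \<open>D t\<close> built from the
    normalised P, P' and P'', which tends to \<open>V\<close>.\<close>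
  define A' where "A' = ((\<lambda>t. newt (P t) (fst A t)), \<lambda>t. snd A t * k' t ^ 2 / (k t * k'' t))"
  have sA': "scale A'" using k k' k'' scaleD[OF A] by (simp add: scale_def A'_def)
  have P'0: "eventually (\<lambda>t. poly (pderiv (P t)) (up A t (w t)) \<noteq> 0) U" if "(w \<longlongrightarrow> z) U" for w z
    using tendsto_imp_eventually_ne[OF kP'1[OF that], of 0] by (rule eventually_mono) auto
  define F where "F t z = down A' t (newt (P t) (up A t z))" for t z
  define D where "D t z = (k t * poly (P t) (up A t z)) * (k'' t * poly (pderiv (pderiv (P t))) (up A t z)) /
     (k' t * poly (pderiv (P t)) (up A t z)) ^ 2" for t z
  have DV: "((\<lambda>t. D t (w t)) \<longlongrightarrow> poly V z) U" if w: "(w \<longlongrightarrow> z) U" for w z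
  proof -
    have "((\<lambda>t. D t (w t)) \<longlongrightarrow> 1 * poly V z / 1 ^ 2) U"
      unfolding D_def V_def by (intro tendsto_divide tendsto_mult tendsto_power kP1[OF w] kP'1[OF w] kP''[OF w]) simp
    then show ?thesis by simp
  qed
  have FD: "(F t has_field_derivative D t z) (at z)" if "poly (pderiv (P t)) (up A t z) \<noteq> 0" for t z
  proof -
    have "(newt (P t) has_field_derivative poly (P t) (up A t z) * poly (pderiv (pderiv (P t))) (up A t z) / poly (pderiv (P t)) (up A t z) ^ 2) (at (up A t z))"
      by (rule newt_deriv[OF that])
    moreover have "(up A t has_field_derivative snd A t) (at z)"
      unfolding up_def[abs_def] by (auto intro!: derivative_eq_intros)
    ultimately have "((\<lambda>z. newt (P t) (up A t z)) has_field_derivative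
      poly (P t) (up A t z) * poly (pderiv (pderiv (P t))) (up A t z) / poly (pderiv (P t)) (up A t z) ^ 2 * snd A t) (at z)"
      by (rule DERIV_chain2)
    then have "((\<lambda>z. (newt (P t) (up A t z) - fst A' t) / snd A' t) has_field_derivative
      (poly (P t) (up A t z) * poly (pderiv (pderiv (P t))) (up A t z) / poly (pderiv (P t)) (up A t z) ^ 2 * snd A t - 0) / snd A' t) (at z)"
      by (intro DERIV_cdivide DERIV_diff DERIV_const)
    moreover have "(poly (P t) (up A t z) * poly (pderiv (pderiv (P t))) (up A t z) / poly (pderiv (P t)) (up A t z) ^ 2 * snd A t - 0) / snd A' t = D t z"
      using k[of t] k'[of t] k''[of t] scaleD[OF A, of t] that by (simp add: A'_def D_def divide_simps power_mult_distrib)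
    ultimately show ?thesis by (simp add: F_def[abs_def] down_def)
  qed
  have F0: "F t 0 = 0" for t by (simp add: F_def down_def A'_def up_def)
  have lim: "((\<lambda>t. F t (w t)) \<longlongrightarrow> poly g z) U" if w: "(w \<longlongrightarrow> z) U" for w z
  proof -
    define R where "R = norm z + 1"
    have R: "R > 0" by (simp add: R_def add_nonneg_pos)
    have wR: "eventually (\<lambda>t. norm (w t) \<le> R) U"
    proof -
      have "eventually (\<lambda>t. norm (w t) < R) U"
        by (rule order_tendstoD(2)[OF tendsto_norm[OF w]]) (simp add: R_def)
      then show ?thesis by (rule eventually_mono) simp
    qed
    have "((\<lambda>t. F t (w t) - poly g (w t)) \<longlongrightarrow> 0) U"
    proof (rule tendstoI)
      fix e :: real assume e: "e > 0"
      define e1 where "e1 = e / (2 * R)"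
      have e1: "e1 > 0" using e R by (simp add: e1_def)
      have "eventually (\<lambda>t. \<forall>v\<in>cball 0 R. poly (pderiv (P t)) (up A t v) \<noteq> 0 \<and> norm (D t v - poly V v) < e1) U"
      proof (rule ultra_uniform[OF U compact_cball])
        fix v0 and v :: "'a \<Rightarrow> complex" assume v: "(v \<longlongrightarrow> v0) U"
        have "((\<lambda>t. D t (v t) - poly V (v t)) \<longlongrightarrow> poly V v0 - poly V v0) U"
          by (intro tendsto_diff DV[OF v] tendsto_poly v)
        then have "eventually (\<lambda>t. dist (D t (v t) - poly V (v t)) 0 < e1) U"
          using e1 by (simp add: tendsto_iff)
        with P'0[OF v] show "eventually (\<lambda>t. poly (pderiv (P t)) (up A t (v t)) \<noteq> 0 \<and> norm (D t (v t) - poly V (v t)) < e1) U"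
          by eventually_elim simp
      qed
      with wR show "eventually (\<lambda>t. dist (F t (w t) - poly g (w t)) 0 < e) U"
      proof eventually_elim
        case (elim t)
        \<comment> \<open>Both \<open>F t\<close> and \<open>g\<close> vanish at 0 and their
          derivatives differ by less than \<open>e1\<close> on the ball, so the mean value
          inequality bounds the difference by \<open>e1 * R\<close>, which is e/2.\<close>
        have "norm ((F t (w t) - poly g (w t)) - (F t 0 - poly g 0)) \<le> e1 * norm (w t - 0)"
        proof (rule field_differentiable_bound[of "cball 0 R" "\<lambda>v. F t v - poly g v" "\<lambda>v. D t v - poly V v"])
          fix v :: complex assume v: "v \<in> cball 0 R"
          have "(F t has_field_derivative D t v) (at v)" using FD elim(2) v by blast
          then have "((\<lambda>v. F t v - poly g v) has_field_derivative D t v - poly V v) (at v)"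
            unfolding g(1)[symmetric] by (intro DERIV_diff poly_DERIV)
          then show "((\<lambda>v. F t v - poly g v) has_field_derivative D t v - poly V v) (at v within cball 0 R)"
            by (rule has_field_derivative_at_within)
          show "norm (D t v - poly V v) \<le> e1" using elim(2) v by (simp add: less_imp_le)
        qed (use elim(1) R in auto)
        also have "\<dots> \<le> e1 * R" using elim(1) e1 by (intro mult_left_mono) auto
        also have "\<dots> < e" using e R by (simp add: e1_def)
        finally show ?case using F0 g(2) by simp
      qed
    qed
    from tendsto_add[OF this tendsto_poly[OF w, of g]] show ?thesis by simp
  qed
  show ?thesis
    by (rule that[OF sA' _ lim[unfolded F_def] P'0]) (use g(3) dV in auto)
qed

section \<open>The orbit of a periodic scale\<close>

abbreviation newt_iter :: "nat \<Rightarrow> 'a \<Rightarrow> complex \<Rightarrow> complex" where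
  "newt_iter n t \<equiv> newt (P t) ^^ n"

definition near_root :: "'a scale \<Rightarrow> bool" where
  "near_root A \<longleftrightarrow> near_set U A {..<d} r \<noteq> {}"

definition inflections :: "'a scale \<Rightarrow> nat set" where
  "inflections A = near_set U A {..<d - 2} s"

text \<open>Records a step of the kind produced at a disc near no root and no critical point. The
  last clause guarantees that poles are avoided, so that the values of \<open>newt\<close> are
  genuine.\<close>

definition poly_step :: "'a scale \<Rightarrow> 'a scale \<Rightarrow> complex poly \<Rightarrow> bool" where
  "poly_step A B g \<longleftrightarrow> scale A \<and> scale B \<and> degree g = Suc (card (inflections A)) \<and>
     (\<forall>w z. (w \<longlongrightarrow> z) U \<longrightarrow> ((\<lambda>t. down B t (newt (P t) (up A t (w t)))) \<longlongrightarrow> poly g z) U) \<and>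
     (\<forall>w z. (w \<longlongrightarrow> z) U \<longrightarrow> eventually (\<lambda>t. poly (pderiv (P t)) (up A t (w t)) \<noteq> 0) U)"

lemma poly_stepD:
  assumes "poly_step A B g"
  shows "scale A" "scale B" "degree g = Suc (card (inflections A))"
    "\<And>w z. (w \<longlongrightarrow> z) U \<Longrightarrow> ((\<lambda>t. down B t (newt (P t) (up A t (w t)))) \<longlongrightarrow> poly g z) U"
    "\<And>w z. (w \<longlongrightarrow> z) U \<Longrightarrow> eventually (\<lambda>t. poly (pderiv (P t)) (up A t (w t)) \<noteq> 0) U"
  using assms unfolding poly_step_def by blast+

lemma poly_fibre_finite:
  fixes g :: "complex poly"
  assumes "degree g \<noteq> 0"
  shows "finite {z. poly g z = a}"
proof -
  have "g - [:a:] \<noteq> 0" using assms by (metis degree_pCons_0 eq_iff_diff_eq_0)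
  from poly_roots_finite[OF this] show ?thesis by simp
qed

lemma poly_step_lim:
  assumes "poly_step A B g"
  shows "lim_off U (\<lambda>t z. down B t (newt (P t) (up A t z))) (poly g) {}"
proof (rule lim_offI)
  show "finite {z. z \<notin> {} \<and> poly g z = a}" for a
    using poly_fibre_finite[of g a] poly_stepD(3)[OF assms] by simp
qed (use poly_stepD(4)[OF assms] in simp_all)

text \<open>The orbit returns to a disc that is only equivalent to the initial one. Replacing it by
  the initial pair closes the cycle, at the price of an affine change of the limit.\<close>

lemma poly_step_rescale:
  assumes g: "poly_step A B g" and rel: "rel_scale U B C l m" and l: "l \<noteq> 0" and C: "scale C"
  obtains g' where "poly_step A C g'"
proof (rule that)
  have d: "degree g \<noteq> 0" using poly_stepD(3)[OF g] by simp
  have "degree (smult l g + [:m:]) = degree g" using d l by (subst degree_add_eq_left) auto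
  moreover have "((\<lambda>t. down C t (newt (P t) (up A t (w t)))) \<longlongrightarrow> poly (smult l g + [:m:]) z) U"
    if "(w \<longlongrightarrow> z) U" for w z
    using rel_scale_tendsto[OF rel poly_stepD(4)[OF g that]] poly_stepD(2)[OF g]
    by simp
  ultimately show "poly_step A C (smult l g + [:m:])"
    using poly_stepD(1,3,5)[OF g] C unfolding poly_step_def by simp
qed

lemma step_compose:
  assumes "lim_off U (\<lambda>t z. down A t (F t z)) h S" "scale A"
    "lim_off U (\<lambda>t z. down B t (newt (P t) (up A t z))) k T"
  obtains h' S' where "lim_off U (\<lambda>t z. down B t (newt (P t) (F t z))) h' S'"
  using that lim_off_comp[OF assms(1,3)] assms(2) by simp

text \<open>Nearness to a root is hereditary along the orbit: several near roots leave the disc in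
  place, a single one pulls it towards itself.\<close>

lemma near_root_step:
  assumes A: "scale A" and n: "near_root A"
  obtains B h S where "scale B" "near_root B" "lim_off U (\<lambda>t z. down B t (newt (P t) (up A t z))) h S"
proof (cases "2 \<le> card (near_set U A {..<d} r)")
  case True
  then show ?thesis using step_two_near_roots[OF A True] that[OF A n] by blast
next
  case False
  have "finite (near_set U A {..<d} r)" by (simp add: near_set_def)
  then have "card (near_set U A {..<d} r) = 1"
    using False n unfolding near_root_def
    by (metis One_nat_def Suc_1 card_gt_0_iff le_Suc_eq nle_le not_less_eq_eq not_one_le_zero Suc_leI)
  then obtain j0 where "near_set U A {..<d} r = {j0}" by (rule card_1_singletonE)
  from step_one_near_root[OF A this] obtain B h S where "scale B"
    "lim_off U (\<lambda>t z. down B t (newt (P t) (up A t z))) h S" "near_set U B {..<d} r = {j0}" by metis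
  then show ?thesis using that[of B h S] unfolding near_root_def by blast
qed

text \<open>Both image coordinates can be read at the same points of \<open>A\<close>, namely 0 and
  \<open>y\<close>, which from \<open>B\<close> appear in the limit as \<open>m\<close> and
  \<open>l * y + m\<close>. If \<open>l = 0\<close> these agree, and so do their images; otherwise
  \<open>y\<close> is chosen so that both limits separate the two. Hence relative position passes to
  the images.\<close>

lemma rel_scale_step:
  assumes A: "poly_step A A1 g" and B: "poly_step B B1 g'" and rel: "rel_scale U A B l m"
  obtains l1 m1 where "rel_scale U A1 B1 l1 m1" "l1 = 0 \<longleftrightarrow> l = 0"
proof -
  have dg: "degree g \<noteq> 0" "degree g' \<noteq> 0" using poly_stepD(3)[OF A] poly_stepD(3)[OF B] by auto
  have "finite {z. poly g z = poly g 0}" using poly_fibre_finite[OF dg(1)] .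
  moreover have "finite (if l = 0 then {} else {z. poly g' (l * z + m) = poly g' m})"
  proof (cases "l = 0")
    case False
    have "degree (pcompose g' [:m, l:]) \<noteq> 0" using dg False by (simp add: degree_pcompose)
    from poly_fibre_finite[OF this, of "poly g' m"] show ?thesis
      by (simp add: poly_pcompose algebra_simps)
  qed simp
  ultimately have "finite ({z. poly g z = poly g 0} \<union> (if l = 0 then {} else {z. poly g' (l * z + m) = poly g' m}))"
    by (rule finite_UnI)
  from ex_new_if_finite[OF infinite_UNIV_char_0 this] obtain y
    where y: "y \<notin> {z. poly g z = poly g 0} \<union> (if l = 0 then {} else {z. poly g' (l * z + m) = poly g' m})" ..
  have ne: "poly g y \<noteq> poly g 0" using y by simp
  have lim: "((\<lambda>t. down B1 t (newt (P t) (up A t x))) \<longlongrightarrow> poly g' (l * x + m)) U" for x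
    using poly_stepD(4)[OF B rel_scale_tendsto[OF rel tendsto_const[of x]]] poly_stepD(1)[OF B] by simp
  show ?thesis
  proof (rule that)
    show "rel_scale U A1 B1 ((poly g' (l * y + m) - poly g' (l * 0 + m)) / (poly g y - poly g 0))
      (poly g' (l * y + m) - (poly g' (l * y + m) - poly g' (l * 0 + m)) / (poly g y - poly g 0) * poly g y)"
      by (rule rel_scaleI_two_points[OF poly_stepD(2)[OF A] poly_stepD(2)[OF B] ne
            poly_stepD(4)[OF A tendsto_const] poly_stepD(4)[OF A tendsto_const] lim lim])
    show "(poly g' (l * y + m) - poly g' (l * 0 + m)) / (poly g y - poly g 0) = 0 \<longleftrightarrow> l = 0"
      using y ne by (auto split: if_splits)
  qed
qed

lemma rel_scale_orbit:
  assumes B: "\<And>i. poly_step (B i) (B (Suc i)) (g i)" and rel: "rel_scale U (B i) (B j) l m"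
  shows "\<exists>l' m'. rel_scale U (B (i + n)) (B (j + n)) l' m' \<and> (l' = 0 \<longleftrightarrow> l = 0)"
proof (induction n)
  case 0
  then show ?case using rel by auto
next
  case (Suc n)
  then obtain l' m' where *: "rel_scale U (B (i + n)) (B (j + n)) l' m'" "l' = 0 \<longleftrightarrow> l = 0" by blast
  from rel_scale_step[OF B B *(1)] show ?case using *(2) by (metis add_Suc_right)
qed

text \<open>The ultrametric dichotomy: discs with a common near point are nested. Radii are
  comparable along the ultrafilter, and the common point \<open>x\<close> then controls the position
  of the centres.\<close>

lemma near_scales_cases:
  assumes A: "scale A" "near U A x" and B: "scale B" "near U B x"
  obtains l m where "rel_scale U A B l m" | m where "rel_scale U B A 0 m"
proof -
  have gen: "((\<lambda>t. down B t (fst A t)) \<longlongrightarrow> nlim U B x - l * nlim U A x) U"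
    if "scale A" "near U A x" "scale B" "near U B x" "((\<lambda>t. snd A t / snd B t) \<longlongrightarrow> l) U" for A B l
  proof -
    have "((\<lambda>t. down B t (x t) - snd A t / snd B t * down A t (x t)) \<longlongrightarrow> nlim U B x - l * nlim U A x) U"
      by (intro tendsto_diff tendsto_mult nlim that)
    moreover have "down B t (x t) - snd A t / snd B t * down A t (x t) = down B t (fst A t)" for t
      using scaleD[OF that(1), of t] scaleD[OF that(3), of t] by (simp add: down_def field_simps)
    ultimately show ?thesis by simp
  qed
  consider l where "((\<lambda>t. snd A t / snd B t) \<longlongrightarrow> l) U" | "((\<lambda>t. snd B t / snd A t) \<longlongrightarrow> 0) U"
    using ultra_ratio_cases[OF U] by blast
  then show ?thesis
  proof cases
    case (1 l)
    then show ?thesis using that(1) gen[OF A B 1] by (auto simp: rel_scale_def)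
  next
    case 2
    then show ?thesis using that(2) gen[OF B A 2] by (auto simp: rel_scale_def)
  qed
qed

text \<open>A disc strictly nested in its successor would, going around the cycle, be nested in itself.\<close>

lemma no_cyclic_nesting:
  assumes a: "\<And>t. a t q = a t (0 :: nat)" "\<And>t n. a t n \<noteq> (0 :: complex)" and q: "q \<ge> 1"
    and lim: "\<And>n. ((\<lambda>t. a t n / a t (Suc n)) \<longlongrightarrow> 0) U"
  shows False
proof -
  have "((\<lambda>t. a t 0 / a t (Suc n)) \<longlongrightarrow> 0) U" for n
  proof (induction n)
    case (Suc n)
    have "((\<lambda>t. (a t 0 / a t (Suc n)) * (a t (Suc n) / a t (Suc (Suc n)))) \<longlongrightarrow> 0 * 0) U"
      by (rule tendsto_mult[OF Suc lim])
    then show ?case using a(2) by simp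
  qed (rule lim)
  from this[of "q - 1"] have "((\<lambda>t. 1 :: complex) \<longlongrightarrow> 0) U" using q a by simp
  then show False using tendsto_unique[OF ultra_neq_bot[OF U] _ tendsto_const[of 1 U]] by fastforce
qed

text \<open>By the inequality of arithmetic and geometric means,
  \<open>(2 * D i) * (2 * D (Suc i))\<close> is at most \<open>d ^ 2\<close>. In the product around
  the cycle each index occurs twice, which gives the square of the product of the
  \<open>2 * D i\<close>. The surplus of \<open>2 ^ q\<close> over 2 is dropped.\<close>

lemma product_of_degrees_bound:
  fixes D :: "nat \<Rightarrow> nat"
  assumes D: "\<And>i. D i + D (Suc i) \<le> d" and q: "1 \<le> q" and per: "D q = D 0"
  shows "2 * (\<Prod>i<q. D i) \<le> d ^ q"
proof -
  have am: "(2 * D i) * (2 * D (Suc i)) \<le> d ^ 2" for i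
  proof -
    have "int ((2 * D i) * (2 * D (Suc i))) \<le> (int (D i) + int (D (Suc i))) ^ 2"
      using zero_le_power2[of "int (D i) - int (D (Suc i))"] by (simp add: power2_eq_square algebra_simps)
    also have "\<dots> \<le> int d ^ 2" using D[of i] by (intro power_mono) auto
    finally show ?thesis by (metis of_nat_le_iff of_nat_power)
  qed
  have "(\<Prod>i<q. D (Suc i)) = (\<Prod>i<q. D i)"
  proof -
    obtain n where n: "q = Suc n" using q by (cases q) auto
    have "(\<Prod>i<Suc n. D (Suc i)) = (\<Prod>i<n. D (Suc i)) * D 0" using per n by simp
    also have "\<dots> = (\<Prod>i<Suc n. D i)" by (subst prod.lessThan_Suc_shift) simp
    finally show ?thesis using n by simp
  qed
  then have "(\<Prod>i<q. 2 * D (Suc i)) = (\<Prod>i<q. 2 * D i)" by (simp only: prod.distrib)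
  then have "(\<Prod>i<q. 2 * D i) ^ 2 = (\<Prod>i<q. (2 * D i) * (2 * D (Suc i)))"
    by (simp only: prod.distrib[of "\<lambda>i. 2 * D i" "\<lambda>i. 2 * D (Suc i)"] power2_eq_square)
  also have "\<dots> \<le> (\<Prod>i<q. d ^ 2)" by (intro prod_mono) (use am in auto)
  also have "\<dots> = (d ^ q) ^ 2" by (simp add: power_mult[symmetric] mult.commute)
  finally have "(\<Prod>i<q. 2 * D i) \<le> d ^ q" by (simp add: power2_nat_le_eq_le)
  moreover have "(\<Prod>i<q. 2 * D i) = 2 ^ q * (\<Prod>i<q. D i)" by (simp add: prod.distrib)
  moreover have "2 * (\<Prod>i<q. D i) \<le> 2 ^ q * (\<Prod>i<q. D i)"
    using q power_increasing[of 1 q "2::nat"] by (intro mult_right_mono) auto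
  ultimately show ?thesis by linarith
qed

text \<open>The family \<open>M\<close> only provides a nonconstant start at \<open>A0\<close>; by
  \<open>return\<close> its q-th image lives at \<open>A0\<close> again. Uniqueness of image discs
  then forces every chain of q steps from \<open>A0\<close> to come back to
  \<open>A0\<close>.\<close>

theorem periodic_orbit:
  assumes A0: "scale A0" and q: "1 \<le> q"
    and start: "lim_off U (\<lambda>t z. down A0 t (M t z)) k0 S0"
    and return: "lim_off U (\<lambda>t z. down A0 t (newt_iter q t (M t z))) k1 S1"
    and no_fixed: "\<And>h S. \<not> lim_off U (\<lambda>t z. down A0 t (newt (P t) (up A0 t z))) h S"
  obtains g where "2 * degree g \<le> d ^ q"
    "\<And>w z. (w \<longlongrightarrow> z) U \<Longrightarrow> ((\<lambda>t. down A0 t (newt_iter q t (up A0 t (w t)))) \<longlongrightarrow> poly g z) U"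
    "\<And>w z. (w \<longlongrightarrow> z) U \<Longrightarrow> eventually (\<lambda>t. \<forall>i<q. poly (pderiv (P t)) (newt_iter i t (up A0 t (w t))) \<noteq> 0) U"
proof -
  \<comment> \<open>\<open>X n B\<close>: the disc \<open>B\<close> is an n-th image of the initial
    one, witnessed by a nonconstant limit of the n-th iterate in its coordinate.\<close>
  define X where "X n B \<longleftrightarrow> scale B \<and> (\<exists>h S. lim_off U (\<lambda>t z. down B t (newt_iter n t (M t z))) h S)" for n B
  have X0: "X 0 A0" using A0 start by (auto simp: X_def)
  have Xstep: "X (Suc n) C" if XB: "X n B" and C: "scale C" and BC: "lim_off U (\<lambda>t z. down C t (newt (P t) (up B t z))) h S" for n B C h S
  proof -
    from XB obtain h' S' where "lim_off U (\<lambda>t z. down B t (newt_iter n t (M t z))) h' S'" "scale B"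
      by (auto simp: X_def)
    then obtain h2 S2 where "lim_off U (\<lambda>t z. down C t (newt (P t) (newt_iter n t (M t z)))) h2 S2"
      by (rule step_compose[OF _ _ BC])
    then show ?thesis using C unfolding X_def by auto
  qed
  have Xq: "\<exists>l m. l \<noteq> 0 \<and> rel_scale U B A0 l m" if "X q B" for B
  proof -
    from that obtain h S where "scale B" "lim_off U (\<lambda>t z. down B t (newt_iter q t (M t z))) h S"
      by (auto simp: X_def)
    then obtain l m where "l \<noteq> 0" "rel_scale U B A0 l m"
      by (rule rel_scale_of_lims[OF U _ A0 _ return]) (rule that; assumption)
    then show ?thesis by blast
  qed
  \<comment> \<open>Several near roots would give a limit from \<open>A0\<close> to itself, which
    \<open>no_fixed\<close> forbids. A single near root makes each image strictly smaller than
    \<open>A0\<close>, while the q-th image must be equivalent to it.\<close>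
  have far0: "\<not> near_root A0"
  proof
    assume n0: "near_root A0"
    have "\<not> 2 \<le> card (near_set U A0 {..<d} r)"
      using step_two_near_roots[OF A0] no_fixed by blast
    moreover have "finite (near_set U A0 {..<d} r)" by (simp add: near_set_def)
    then have "card (near_set U A0 {..<d} r) \<noteq> 0" using n0 by (simp add: near_root_def)
    ultimately have "card (near_set U A0 {..<d} r) = 1" by linarith
    then obtain j0 where j0: "near_set U A0 {..<d} r = {j0}" by (rule card_1_singletonE)
    have "\<exists>B. X (Suc n) B \<and> near_set U B {..<d} r = {j0} \<and> ((\<lambda>t. snd B t / snd A0 t) \<longlongrightarrow> 0) U" for n
    proof (induction n)
      case 0
      obtain C h S where C: "scale C"
        "lim_off U (\<lambda>t z. down C t (newt (P t) (up A0 t z))) h S"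
        "near_set U C {..<d} r = {j0}" "((\<lambda>t. snd C t / snd A0 t) \<longlongrightarrow> 0) U"
        by (rule step_one_near_root[OF A0 j0]) (rule that; assumption)
      then show ?case using Xstep[OF X0 C(1,2)] by blast
    next
      case (Suc n)
      then obtain B where B: "X (Suc n) B" "near_set U B {..<d} r = {j0}" "((\<lambda>t. snd B t / snd A0 t) \<longlongrightarrow> 0) U"
        by blast
      have sB: "scale B" using B(1) by (simp add: X_def)
      obtain C h S where C: "scale C"
        "lim_off U (\<lambda>t z. down C t (newt (P t) (up B t z))) h S"
        "near_set U C {..<d} r = {j0}" "((\<lambda>t. snd C t / snd B t) \<longlongrightarrow> 0) U"
        by (rule step_one_near_root[OF sB B(2)]) (rule that; assumption)
      have "((\<lambda>t. (snd C t / snd B t) * (snd B t / snd A0 t)) \<longlongrightarrow> 0 * 0) U"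
        by (rule tendsto_mult[OF C(4) B(3)])
      then have "((\<lambda>t. snd C t / snd A0 t) \<longlongrightarrow> 0) U" using scaleD[OF sB] by simp
      then show ?case using Xstep[OF B(1) C(1,2)] C(3) by blast
    qed
    from this[of "q - 1"] obtain B where B: "X q B" "((\<lambda>t. snd B t / snd A0 t) \<longlongrightarrow> 0) U" using q by auto
    from Xq[OF B(1)] obtain l where "l \<noteq> 0" "((\<lambda>t. snd B t / snd A0 t) \<longlongrightarrow> l) U"
      by (auto simp: rel_scale_def)
    then show False using tendsto_unique[OF ultra_neq_bot[OF U] _ B(2)] by blast
  qed
  \<comment> \<open>Nearness to a root would persist up to time \<open>q\<close>, where the disc is
    equivalent to \<open>A0\<close>.\<close>
  have far: "\<not> near_root B" if XB: "X n B" and nq: "n \<le> q" for n B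
  proof
    assume nB: "near_root B"
    have "\<exists>C. X (n + i) C \<and> near_root C" for i
    proof (induction i)
      case 0
      then show ?case using XB nB by (intro exI[of _ B]) simp
    next
      case (Suc i)
      then obtain C where C: "X (n + i) C" "near_root C" by blast
      then have "scale C" by (simp add: X_def)
      then obtain C' h S where C': "scale C'" "near_root C'" "lim_off U (\<lambda>t z. down C' t (newt (P t) (up C t z))) h S"
        by (rule near_root_step[OF _ C(2)]) (rule that; assumption)
      then show ?case using Xstep[OF C(1) C'(1,3)] by (intro exI[of _ C']) simp
    qed
    from this[of "q - n"] nq obtain C where C: "X q C" "near_root C" by (simp only: le_add_diff_inverse) blast
    from Xq[OF C(1)] obtain l m where "rel_scale U C A0 l m" by blast
    moreover have "scale C" using C(1) by (simp add: X_def)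
    ultimately have "near_root A0"
      using near_rel_scale[of U C A0 l m] C(2) by (auto simp: near_root_def near_set_def)
    then show False using far0 by blast
  qed
  have next_poly: "\<exists>C. X (Suc n) C \<and> (\<exists>g. poly_step B C g)" if XB: "X n B" and nq: "n < q" for n B
  proof -
    have sB: "scale B" using XB by (simp add: X_def)
    have Z: "near_set U B {..<d} r = {}" using far[OF XB] nq by (simp add: near_root_def)
    \<comment> \<open>Otherwise the next disc would be near a root, at a time not exceeding
      \<open>q\<close>.\<close>
    have W: "near_set U B {..<d - 1} p = {}"
    proof (rule ccontr)
      assume "near_set U B {..<d - 1} p \<noteq> {}"
      then obtain C h S where C: "scale C"
        "lim_off U (\<lambda>t z. down C t (newt (P t) (up B t z))) h S" "near_set U C {..<d} r \<noteq> {}"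
        by (rule step_no_near_root_near_critical[OF sB Z]) (rule that; assumption)
      from far[OF Xstep[OF XB C(1,2)]] nq C(3) show False by (simp add: near_root_def)
    qed
    obtain C g where "scale C" "degree g = Suc (card (near_set U B {..<d - 2} s))"
      "\<And>w z. (w \<longlongrightarrow> z) U \<Longrightarrow> ((\<lambda>t. down C t (newt (P t) (up B t (w t)))) \<longlongrightarrow> poly g z) U"
      "\<And>w z. (w \<longlongrightarrow> z) U \<Longrightarrow> eventually (\<lambda>t. poly (pderiv (P t)) (up B t (w t)) \<noteq> 0) U"
      by (rule step_no_near_root_no_near_critical[OF sB Z W]) blast
    then have ps: "poly_step B C g" using sB by (simp add: poly_step_def inflections_def)
    have "X (Suc n) C" by (rule Xstep[OF XB poly_stepD(2)[OF ps] poly_step_lim[OF ps]])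
    then show ?thesis using ps by blast
  qed
  have "\<exists>A. \<forall>n. ((n \<le> q \<longrightarrow> X n (A n)) \<and> (n = 0 \<longrightarrow> A n = A0)) \<and> (n < q \<longrightarrow> (\<exists>g. poly_step (A n) (A (Suc n)) g))"
  proof (rule dependent_nat_choice)
    show "\<exists>x. (0 \<le> q \<longrightarrow> X 0 x) \<and> ((0::nat) = 0 \<longrightarrow> x = A0)" using X0 by blast
    fix x n assume "(n \<le> q \<longrightarrow> X n x) \<and> (n = 0 \<longrightarrow> x = A0)"
    then show "\<exists>y. ((Suc n \<le> q \<longrightarrow> X (Suc n) y) \<and> (Suc n = 0 \<longrightarrow> y = A0)) \<and> (n < q \<longrightarrow> (\<exists>g. poly_step x y g))"
      using next_poly[of n x] by (cases "n < q") auto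
  qed
  then obtain A where A: "\<And>n. n \<le> q \<Longrightarrow> X n (A n)" "A 0 = A0" "\<And>n. n < q \<Longrightarrow> \<exists>g. poly_step (A n) (A (Suc n)) g"
    by blast
  \<comment> \<open>Extends the orbit periodically. The step from index q - 1 ends at
    \<open>A q\<close>, which is replaced by the equivalent \<open>A0\<close>.\<close>
  define B where "B n = A (n mod q)" for n
  have "\<exists>g. poly_step (B n) (B (Suc n)) g" for n
  proof (cases "Suc (n mod q) = q")
    case False
    then have "Suc n mod q = Suc (n mod q)" "n mod q < q" using q by (simp_all add: mod_Suc)
    then show ?thesis using A(3)[of "n mod q"] by (simp add: B_def)
  next
    case True
    then have e: "Suc n mod q = 0" by (simp add: mod_Suc)
    obtain g where g: "poly_step (A (n mod q)) (A q) g" using A(3)[of "n mod q"] True q by auto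
    obtain l m where "l \<noteq> 0" "rel_scale U (A q) A0 l m" using Xq[OF A(1)[OF order_refl]] by blast
    from poly_step_rescale[OF g this(2,1) A0] show ?thesis using e A(2) unfolding B_def by metis
  qed
  then obtain g where g: "\<And>n. poly_step (B n) (B (Suc n)) (g n)" by metis
  have B0: "B 0 = A0" and Bper: "\<And>n. B (n + q) = B n" using A(2) by (simp_all add: B_def)
  have sB: "scale (B n)" for n using poly_stepD(1)[OF g] .
  \<comment> \<open>A common near inflection makes consecutive discs nested or equivalent. Strict
    nesting in either direction would propagate around the cycle; equivalence propagates to a
    multiple of \<open>q\<close>, where it identifies \<open>A0\<close> with its image, against
    \<open>no_fixed\<close>.\<close>
  have disj: "inflections (B i) \<inter> inflections (B (Suc i)) = {}" for i
  proof (rule ccontr)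
    assume "inflections (B i) \<inter> inflections (B (Suc i)) \<noteq> {}"
    then obtain j where "near U (B i) (\<lambda>t. s t j)" "near U (B (Suc i)) (\<lambda>t. s t j)"
      by (auto simp: inflections_def near_set_def)
    then consider (1) l m where "rel_scale U (B i) (B (Suc i)) l m" "l \<noteq> 0"
      | (2) m where "rel_scale U (B i) (B (Suc i)) 0 m" | (3) m where "rel_scale U (B (Suc i)) (B i) 0 m"
      using near_scales_cases[OF sB _ sB] by metis
    then show False
    proof cases
      case 1
      \<comment> \<open>The shift by \<open>i * (q - 1)\<close> moves the index \<open>i\<close> to
        \<open>i * q\<close>, which is 0 modulo \<open>q\<close>.\<close>
      from rel_scale_orbit[OF g 1(1), of "i * (q - 1)"]
      obtain l' m' where "rel_scale U (B (i + i * (q - 1))) (B (Suc i + i * (q - 1))) l' m'" "l' \<noteq> 0"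
        using 1(2) by auto
      moreover have "i + i * (q - 1) = i * q" using q by (simp add: algebra_simps)
      ultimately have *: "rel_scale U (B (i * q)) (B (Suc (i * q))) l' m'" "l' \<noteq> 0" by auto
      have "B (i * q) = A0" "B (Suc (i * q)) = B 1" using A(2) by (simp_all add: B_def mod_Suc)
      then have "rel_scale U (B 1) A0 (1 / l') (- m' / l')"
        using rel_scale_sym[OF *(1) *(2) sB sB] by simp
      from lim_off_rescale[OF poly_step_lim[OF g[of 0]] _ _ sB, simplified, of A0 "1 / l'"] this *(2) no_fixed
      show False by (simp add: B0) blast
    next
      case 2
      show False
      proof (rule no_cyclic_nesting[of "\<lambda>t n. snd (B (i + n)) t" q])
        show "((\<lambda>t. snd (B (i + n)) t / snd (B (i + Suc n)) t) \<longlongrightarrow> 0) U" for n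
          using rel_scale_orbit[OF g 2, of n] by (auto simp: rel_scale_def)
      qed (use Bper q scaleD[OF sB] in auto)
    next
      case 3
      have lim: "((\<lambda>t. snd (B (i + Suc n)) t / snd (B (i + n)) t) \<longlongrightarrow> 0) U" for n
        using rel_scale_orbit[OF g 3, of n] by (auto simp: rel_scale_def)
      \<comment> \<open>The discs now shrink along the orbit, so the same argument is applied to the
        inverse radii.\<close>
      show False
      proof (rule no_cyclic_nesting[of "\<lambda>t n. inverse (snd (B (i + n)) t)" q])
        show "((\<lambda>t. inverse (snd (B (i + n)) t) / inverse (snd (B (i + Suc n)) t)) \<longlongrightarrow> 0) U" for n
          using lim[of n] by (simp add: field_simps)
      qed (use Bper q scaleD[OF sB] in auto)
    qed
  qed
  have deg: "degree (g i) + degree (g (Suc i)) \<le> d" for i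
  proof -
    have "card (inflections (B i)) + card (inflections (B (Suc i))) = card (inflections (B i) \<union> inflections (B (Suc i)))"
      by (rule card_Un_disjoint[symmetric]) (use disj in \<open>auto simp: inflections_def near_set_def\<close>)
    also have "\<dots> \<le> card {..<d - 2}"
      by (rule card_mono) (auto simp: inflections_def near_set_def)
    finally show ?thesis using d poly_stepD(3)[OF g] by simp
  qed
  define G where "G n = rec_nat [:0, 1:] (\<lambda>i H. pcompose (g i) H) n" for n
  have G: "G 0 = [:0, 1:]" "\<And>n. G (Suc n) = pcompose (g n) (G n)" by (simp_all add: G_def)
  have dG: "degree (G n) = (\<Prod>i<n. degree (g i))" for n
    by (induction n) (simp_all add: G degree_pcompose mult.commute)
  have lim: "((\<lambda>t. down (B n) t (newt_iter n t (up A0 t (w t)))) \<longlongrightarrow> poly (G n) z) U"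
    if w: "(w \<longlongrightarrow> z) U" for w z n
  proof (induction n)
    case 0
    then show ?case using w by (simp add: B0 A0 G)
  next
    case (Suc n)
    from poly_stepD(4)[OF g[of n] Suc] show ?case using sB by (simp add: G poly_pcompose)
  qed
  show ?thesis
  proof (rule that)
    have "degree (g q) = degree (g 0)" using poly_stepD(3)[OF g[of q]] poly_stepD(3)[OF g[of 0]] Bper[of 0] by simp
    then show "2 * degree (G q) \<le> d ^ q"
      unfolding dG by (intro product_of_degrees_bound deg q)
    fix w :: "'a \<Rightarrow> complex" and z assume w: "(w \<longlongrightarrow> z) U"
    show "((\<lambda>t. down A0 t (newt_iter q t (up A0 t (w t)))) \<longlongrightarrow> poly (G q) z) U"
      using lim[OF w, of q] Bper[of 0] B0 by simp
    have "eventually (\<lambda>t. poly (pderiv (P t)) (newt_iter i t (up A0 t (w t))) \<noteq> 0) U" for i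
      using poly_stepD(5)[OF g[of i] lim[OF w, of i]] sB by simp
    then have "eventually (\<lambda>t. \<forall>i\<in>{..<q}. poly (pderiv (P t)) (newt_iter i t (up A0 t (w t))) \<noteq> 0) U"
      by (intro eventually_ball_finite) simp_all
    then show "eventually (\<lambda>t. \<forall>i<q. poly (pderiv (P t)) (newt_iter i t (up A0 t (w t))) \<noteq> 0) U"
      by (rule eventually_mono) simp
  qed
qed

end

section \<open>Binary forms and instability\<close>

lemma form_pairsI: "degree (fst F) \<le> D \<Longrightarrow> degree (snd F) \<le> D \<Longrightarrow> F \<in> form_pairs D"
  by (cases F) (simp add: form_pairs_def)

lemma form_pairsD: "F \<in> form_pairs D \<Longrightarrow> degree (fst F) \<le> D \<and> degree (snd F) \<le> D"
  by (cases F) (simp add: form_pairs_def)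

lemma poly_eq_sum_le:
  fixes p :: "complex poly"
  assumes "degree p \<le> D"
  shows "poly p z = (\<Sum>i\<le>D. coeff p i * z ^ i)"
  unfolding poly_altdef
  by (rule sum.mono_neutral_left) (use assms in \<open>auto simp: coeff_eq_0\<close>)

lemma form_eval_poly: "degree F \<le> D \<Longrightarrow> form_eval D F x 1 = poly F x"
  by (simp add: form_eval_def poly_eq_sum_le)

lemma form_eval_homogeneous: "form_eval D F (c * x) (c * y) = c ^ D * form_eval D F x y"
proof -
  have "coeff F i * (c * x) ^ i * (c * y) ^ (D - i) = c ^ D * (coeff F i * x ^ i * y ^ (D - i))" if "i \<le> D" for i
  proof -
    have "c ^ D = c ^ i * c ^ (D - i)" using that by (simp add: power_add[symmetric])
    then show ?thesis by (simp add: power_mult_distrib)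
  qed
  then show ?thesis unfolding form_eval_def sum_distrib_left by (intro sum.cong) auto
qed

lemma form_eval_ratio: "degree F \<le> D \<Longrightarrow> y \<noteq> 0 \<Longrightarrow> form_eval D F x y = y ^ D * poly F (x / y)"
  using form_eval_homogeneous[of D F y "x / y" 1] by (simp add: form_eval_poly)

lemma form_eval_0: "form_eval D F x 0 = coeff F D * x ^ D"
proof -
  have "form_eval D F x 0 = (\<Sum>i\<in>{D}. coeff F i * x ^ i * 0 ^ (D - i))"
    unfolding form_eval_def by (rule sum.mono_neutral_right) auto
  then show ?thesis by simp
qed

lemma coeff_mult_top:
  fixes p q :: "complex poly"
  assumes "degree p \<le> m" "degree q \<le> n"
  shows "coeff (p * q) (m + n) = coeff p m * coeff q n"
proof -
  have "coeff (p * q) (m + n) = (\<Sum>i\<in>{m}. coeff p i * coeff q (m + n - i))"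
    unfolding coeff_mult
  proof (rule sum.mono_neutral_right)
    show "\<forall>i\<in>{..m + n} - {m}. coeff p i * coeff q (m + n - i) = 0"
    proof
      fix i assume "i \<in> {..m + n} - {m}"
      then have "m < i \<or> n < m + n - i" by auto
      then show "coeff p i * coeff q (m + n - i) = 0" using assms by (auto simp: coeff_eq_0)
    qed
  qed auto
  then show ?thesis by simp
qed

lemma form_eval_mult:
  assumes "degree p \<le> m" "degree q \<le> n"
  shows "form_eval (m + n) (p * q) x y = form_eval m p x y * form_eval n q x y"
proof (cases "y = 0")
  case True
  then show ?thesis by (simp add: form_eval_0 coeff_mult_top[OF assms] power_add)
next
  case False
  have "degree (p * q) \<le> m + n" using degree_mult_le[of p q] assms by linarith
  then show ?thesis using False assms by (simp add: form_eval_ratio power_add)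
qed

lemma form_eval_sum: "form_eval D (\<Sum>i\<in>I. f i) x y = (\<Sum>i\<in>I. form_eval D (f i) x y)"
  unfolding form_eval_def coeff_sum sum_distrib_right by (rule sum.swap)

lemma form_eval_smult: "form_eval D (smult c F) x y = c * form_eval D F x y"
  by (simp add: form_eval_def sum_distrib_left mult.assoc)

lemma degree_power_bound: "degree (p :: complex poly) \<le> k \<Longrightarrow> degree (p ^ i) \<le> i * k"
  using degree_power_le[of p i] by (metis mult.commute mult_le_mono1 order_trans)

lemma form_eval_power:
  assumes "degree p \<le> k"
  shows "form_eval (i * k) (p ^ i) x y = form_eval k p x y ^ i"
proof (induction i)
  case 0
  then show ?case by (simp add: form_eval_def)
next
  case (Suc i)
  then show ?case using form_eval_mult[OF assms degree_power_bound[OF assms, of i]] by simp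
qed

lemma form_subst_term_degree:
  assumes "G \<in> form_pairs k" "i \<le> D"
  shows "degree (fst G ^ i * snd G ^ (D - i)) \<le> D * k"
proof -
  have "degree (fst G ^ i * snd G ^ (D - i)) \<le> i * k + (D - i) * k"
    using degree_mult_le[of "fst G ^ i" "snd G ^ (D - i)"]
      degree_power_bound[of "fst G" k i] degree_power_bound[of "snd G" k "D - i"] form_pairsD[OF assms(1)]
    by linarith
  also have "\<dots> = D * k" using assms(2) by (simp add: add_mult_distrib[symmetric])
  finally show ?thesis .
qed

lemma degree_form_subst:
  assumes "G \<in> form_pairs k"
  shows "degree (form_subst D F G) \<le> D * k"
  unfolding form_subst_def
  by (rule degree_sum_le) (use form_subst_term_degree[OF assms] in \<open>auto intro: order_trans[OF degree_smult_le]\<close>)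

lemma form_eval_subst:
  assumes G: "G \<in> form_pairs k"
  shows "form_eval (D * k) (form_subst D F G) x y = form_eval D F (form_eval k (fst G) x y) (form_eval k (snd G) x y)"
proof -
  have "form_eval (D * k) (smult (coeff F i) (fst G ^ i * snd G ^ (D - i))) x y =
     coeff F i * form_eval k (fst G) x y ^ i * form_eval k (snd G) x y ^ (D - i)" if "i \<le> D" for i
  proof -
    have d: "degree (fst G) \<le> k" "degree (snd G) \<le> k" using form_pairsD[OF G] by auto
    have e: "D * k = i * k + (D - i) * k" using that by (simp add: add_mult_distrib[symmetric])
    show ?thesis unfolding form_eval_smult e
        form_eval_mult[OF degree_power_bound[OF d(1)] degree_power_bound[OF d(2)]]
        form_eval_power[OF d(1)] form_eval_power[OF d(2)] by simp
  qed
  then show ?thesis unfolding form_subst_def form_eval_sum by (simp add: form_eval_def)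
qed

text \<open>Maps of the sphere are computed on vectors, where composition is literal; membership in
  \<open>line_class\<close> then serves as equality of points.\<close>

definition pair_eval :: "nat \<Rightarrow> form_pair \<Rightarrow> complex \<times> complex \<Rightarrow> complex \<times> complex" where
  "pair_eval D F v = (form_eval D (fst F) (fst v) (snd v), form_eval D (snd F) (fst v) (snd v))"

lemma pair_comp_form_pairs: "G \<in> form_pairs k \<Longrightarrow> pair_comp D F G \<in> form_pairs (D * k)"
  by (rule form_pairsI) (simp_all add: pair_comp_def degree_form_subst)

lemma pair_eval_comp: "G \<in> form_pairs k \<Longrightarrow> pair_eval (D * k) (pair_comp D F G) v = pair_eval D F (pair_eval k G v)"
  by (simp add: pair_eval_def pair_comp_def form_eval_subst)

lemma line_class_iff: "v \<in> line_class w \<longleftrightarrow> (\<exists>c. c \<noteq> 0 \<and> fst v = c * fst w \<and> snd v = c * snd w)"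
  by (cases v) (auto simp: line_class_def)

lemma line_class_refl [simp]: "v \<in> line_class v"
  unfolding line_class_iff by (rule exI[of _ 1]) simp

lemma line_class_trans: "u \<in> line_class v \<Longrightarrow> v \<in> line_class w \<Longrightarrow> u \<in> line_class w"
  unfolding line_class_iff by (elim exE conjE) (rule_tac x = "c * ca" in exI, simp)

lemma line_class_sym: "u \<in> line_class v \<Longrightarrow> v \<in> line_class u"
  unfolding line_class_iff by (elim exE conjE) (rule_tac x = "1 / c" in exI, simp)

lemma line_class_eq: "u \<in> line_class v \<Longrightarrow> line_class u = line_class v"
  using line_class_trans line_class_sym by blast

lemma line_class_zero: "u \<in> line_class v \<Longrightarrow> u = (0, 0) \<longleftrightarrow> v = (0, 0)"
  unfolding line_class_iff by (cases u; cases v) auto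

lemma pair_eval_line: "v \<in> line_class w \<Longrightarrow> pair_eval D F v \<in> line_class (pair_eval D F w)"
  unfolding line_class_iff pair_eval_def
  by (elim exE conjE) (rule_tac x = "c ^ D" in exI, simp add: form_eval_homogeneous)

lemma proj_class_iff: "F \<in> proj_class G \<longleftrightarrow> (\<exists>c. c \<noteq> 0 \<and> fst F = smult c (fst G) \<and> snd F = smult c (snd G))"
  by (cases F) (auto simp: proj_class_def)

lemma proj_class_refl [simp]: "F \<in> proj_class F"
  unfolding proj_class_iff by (rule exI[of _ 1]) simp

lemma proj_class_sym: "F \<in> proj_class G \<Longrightarrow> G \<in> proj_class F"
  unfolding proj_class_iff by (elim exE conjE) (rule_tac x = "1 / c" in exI, simp)

lemma proj_class_trans: "F \<in> proj_class G \<Longrightarrow> G \<in> proj_class H \<Longrightarrow> F \<in> proj_class H"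
  unfolding proj_class_iff by (elim exE conjE) (rule_tac x = "c * ca" in exI, simp)

lemma pair_eval_proj: "F \<in> proj_class G \<Longrightarrow> pair_eval D F v \<in> line_class (pair_eval D G v)"
  unfolding proj_class_iff line_class_iff pair_eval_def
  by (elim exE conjE) (rule_tac x = c in exI, simp add: form_eval_smult)

lemma proj_class_form_pairs: "F \<in> proj_class G \<Longrightarrow> G \<in> form_pairs D \<Longrightarrow> F \<in> form_pairs D"
  unfolding proj_class_iff using form_pairsD[of G D] by (auto intro!: form_pairsI)

lemma rat_maps_rep:
  assumes "f \<in> rat_maps D" "F \<in> f"
  shows "F \<in> form_pairs D" "F \<noteq> (0, 0)" "f = proj_class F"
    and "\<And>k H A B. k \<le> D \<Longrightarrow> degree H \<le> k \<Longrightarrow> (A, B) \<in> form_pairs (D - k) \<Longrightarrow> F = (H * A, H * B) \<Longrightarrow> k = 0"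
proof -
  from assms(1) obtain F1 G1 where f: "f = proj_class (F1, G1)" "(F1, G1) \<in> form_pairs D - {(0, 0)}"
    "\<And>k H A B. k \<le> D \<Longrightarrow> degree H \<le> k \<Longrightarrow> (A, B) \<in> form_pairs (D - k) \<Longrightarrow> F1 = H * A \<Longrightarrow> G1 = H * B \<Longrightarrow> k = 0"
    unfolding rat_maps_def by blast
  have F: "F \<in> proj_class (F1, G1)" using assms(2) f(1) by simp
  then obtain c where c: "c \<noteq> 0" "fst F = smult c F1" "snd F = smult c G1" by (auto simp: proj_class_iff)
  show "F \<in> form_pairs D" using proj_class_form_pairs[OF F] f(2) by simp
  show "F \<noteq> (0, 0)" using c f(2) by (cases F) auto
  show "f = proj_class F" unfolding f(1) using F proj_class_sym proj_class_trans by blast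
  fix k H A B assume k: "k \<le> D" "degree H \<le> k" "(A, B) \<in> form_pairs (D - k)" "F = (H * A, H * B)"
  have "F1 = smult (1 / c) (fst F)" "G1 = smult (1 / c) (snd F)" using c by simp_all
  then have "F1 = smult (1 / c) H * A" "G1 = smult (1 / c) H * B" using k(4) by simp_all
  with f(3)[of k "smult (1 / c) H" A B] k show "k = 0" by simp
qed

lemma linear_factor_degree: "A \<noteq> 0 \<Longrightarrow> degree ([:- a, 1:] * A) = Suc (degree (A :: complex poly))"
  by (subst degree_mult_eq) simp_all

text \<open>At a common zero both forms share a linear factor, which coprimality forbids.\<close>

lemma rat_maps_nonvanishing:
  assumes f: "f \<in> rat_maps D" "F \<in> f" and v: "v \<noteq> (0, 0)"
  shows "pair_eval D F v \<noteq> (0, 0)"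
proof
  assume z: "pair_eval D F v = (0, 0)"
  note F = rat_maps_rep[OF f]
  have dF: "degree (fst F) \<le> D" "degree (snd F) \<le> D" using form_pairsD[OF F(1)] by auto
  have D: "D \<ge> 1"
  proof (rule ccontr)
    assume "\<not> D \<ge> 1"
    then have "D = 0" by simp
    then have "coeff (fst F) 0 = 0" "coeff (snd F) 0 = 0" "degree (fst F) = 0" "degree (snd F) = 0"
      using dF z by (simp_all add: pair_eval_def form_eval_def)
    then have "fst F = 0" "snd F = 0" by (metis leading_coeff_0_iff)+
    then show False using F(2) by (cases F) simp
  qed
  show False
  proof (cases "snd v = 0")
    case True
    then have "coeff (fst F) D = 0" "coeff (snd F) D = 0"
      using z v by (cases v; auto simp: pair_eval_def form_eval_0)+
    moreover have "degree h \<le> D - 1" if "degree h \<le> D" "coeff h D = 0" for h :: "complex poly"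
      using that by (cases "degree h = D") auto
    ultimately have "degree (fst F) \<le> D - 1" "degree (snd F) \<le> D - 1" using dF by auto
    then have "(fst F, snd F) \<in> form_pairs (D - 1)" by (intro form_pairsI) simp_all
    \<comment> \<open>The common factor is the form Y, whose dehomogenization is 1: hence
      \<open>H = 1\<close> with \<open>k = 1\<close>.\<close>
    from F(4)[of 1 1, OF D _ this] show False by simp
  next
    case False
    define a where "a = fst v / snd v"
    have "poly (fst F) a = 0" "poly (snd F) a = 0"
      using z False dF by (simp_all add: pair_eval_def form_eval_ratio a_def)
    then obtain A B where AB: "fst F = [:- a, 1:] * A" "snd F = [:- a, 1:] * B"
      unfolding poly_eq_0_iff_dvd by (elim dvdE)
    have "degree A \<le> D - 1"
      using dF(1) linear_factor_degree[of A a] unfolding AB(1) by (cases "A = 0") simp_all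
    moreover have "degree B \<le> D - 1"
      using dF(2) linear_factor_degree[of B a] unfolding AB(2) by (cases "B = 0") simp_all
    ultimately have "(A, B) \<in> form_pairs (D - 1)" by (simp add: form_pairs_def)
    moreover have "F = ([:- a, 1:] * A, [:- a, 1:] * B)" using AB by (metis prod.collapse)
    moreover have "degree [:- a, 1:] \<le> 1" by simp
    ultimately have "(1 :: nat) = 0" by (intro F(4)[OF D])
    then show False by simp
  qed
qed

lemma pair_eval_1: "pair_eval 1 m v =
   (coeff (fst m) 1 * fst v + coeff (fst m) 0 * snd v, coeff (snd m) 1 * fst v + coeff (snd m) 0 * snd v)"
  by (simp add: pair_eval_def form_eval_def)

lemma pair_adj_form_pairs [simp]: "pair_adj m \<in> form_pairs 1"
  by (rule form_pairsI) (auto simp: pair_adj_def)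

lemma pair_eval_adj: "pair_eval 1 (pair_adj m) v =
   (coeff (snd m) 0 * fst v - coeff (fst m) 0 * snd v, coeff (fst m) 1 * snd v - coeff (snd m) 1 * fst v)"
  unfolding pair_eval_1 by (simp add: pair_adj_def)

lemma pair_eval_linear_eq_0:
  assumes "pair_det m \<noteq> 0" "pair_eval 1 m v = (0, 0)"
  shows "v = (0, 0)"
proof -
  have "pair_det m * fst v = 0" "pair_det m * snd v = 0"
    using assms(2) unfolding pair_eval_1 pair_det_def by (simp_all, algebra+)
  then show ?thesis using assms(1) by (cases v) simp
qed

lemma pair_det_adj: "pair_det (pair_adj m) = pair_det m"
  by (simp add: pair_det_def pair_adj_def algebra_simps)

lemma rat_maps_1_det:
  assumes "m \<in> rat_maps 1" "A \<in> m"
  shows "pair_det A \<noteq> 0"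
proof
  assume 0: "pair_det A = 0"
  \<comment> \<open>Each of these vectors is annihilated by one row, and by the other one as well
    since the determinant is 0; so both vectors must be zero.\<close>
  have "pair_eval 1 A (coeff (fst A) 0, - coeff (fst A) 1) = (0, 0)"
    "pair_eval 1 A (coeff (snd A) 0, - coeff (snd A) 1) = (0, 0)"
    using 0 unfolding pair_eval_1 by (simp_all add: pair_det_def algebra_simps)
  then have c: "coeff (fst A) 0 = 0" "coeff (fst A) 1 = 0" "coeff (snd A) 0 = 0" "coeff (snd A) 1 = 0"
    using rat_maps_nonvanishing[OF assms] by (metis Pair_inject neg_equal_0_iff_equal)+
  have "pair_eval 1 A (1, 0) = (0, 0)" using c unfolding pair_eval_1 by simp
  then show False using rat_maps_nonvanishing[OF assms, of "(1, 0)"] by simp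
qed

lemma pair_eval_conj:
  assumes "m1 \<in> form_pairs 1" "m2 \<in> form_pairs 1"
  shows "pair_comp 1 (pair_adj m1) (pair_comp D F m2) \<in> form_pairs D"
    and "pair_eval D (pair_comp 1 (pair_adj m1) (pair_comp D F m2)) v =
      pair_eval 1 (pair_adj m1) (pair_eval D F (pair_eval 1 m2 v))"
  using pair_comp_form_pairs[OF pair_comp_form_pairs[OF assms(2), of D F], of 1 "pair_adj m1"]
    pair_eval_comp[OF pair_comp_form_pairs[OF assms(2), of D F], of 1 "pair_adj m1" v]
    pair_eval_comp[OF assms(2), of D F v]
  by simp_all

text \<open>The fixed point \<open>\<infinity>\<close> of a Newton map absorbs its poles, so an iterate with a finite value has
  met no critical point of \<open>P\<close>; this is what makes the junk value of division harmless.\<close>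

lemma newton_iterate_eval:
  assumes P: "degree P = d" and N: "proj_class ([:0, 1:] * pderiv P - P, pderiv P) \<in> rat_maps d"
    and F: "F \<in> rat_iter d (proj_class ([:0, 1:] * pderiv P - P, pderiv P)) n"
  shows "F \<in> form_pairs (d ^ n)"
    and "v \<noteq> (0, 0) \<Longrightarrow> pair_eval (d ^ n) F v \<noteq> (0, 0)"
    and "v \<in> line_class (z, 1) \<Longrightarrow> (\<forall>i<n. poly (pderiv P) ((newt P ^^ i) z) \<noteq> 0) \<Longrightarrow>
      pair_eval (d ^ n) F v \<in> line_class ((newt P ^^ n) z, 1)"
    and "v \<in> line_class (z, 1) \<Longrightarrow> snd (pair_eval (d ^ n) F v) \<noteq> 0 \<Longrightarrow>
      (\<forall>i<n. poly (pderiv P) ((newt P ^^ i) z) \<noteq> 0)"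
proof -
  let ?n = "([:0, 1:] * pderiv P - P, pderiv P)"
  have nf: "?n \<in> form_pairs d" and nv: "v \<noteq> (0, 0) \<Longrightarrow> pair_eval d ?n v \<noteq> (0, 0)" for v
    using rat_maps_rep[OF N proj_class_refl] rat_maps_nonvanishing[OF N proj_class_refl] by auto
  have dn: "degree ([:0, 1:] * pderiv P - P) \<le> d" "degree (pderiv P) \<le> d" using form_pairsD[OF nf] by auto
  \<comment> \<open>P' has degree less than \<open>d\<close>, so as a form of degree
    \<open>d\<close> it vanishes at infinity: the Newton map fixes that point.\<close>
  have d0: "coeff (pderiv P) d = 0"
    using P by (simp add: coeff_pderiv coeff_eq_0)
  have fin: "pair_eval d ?n (z, 1) \<in> line_class (newt P z, 1)" if "poly (pderiv P) z \<noteq> 0" for z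
    unfolding line_class_iff pair_eval_def
    by (rule exI[of _ "poly (pderiv P) z"])
       (use that dn in \<open>simp add: form_eval_poly newt_def field_simps\<close>)
  have *: "F \<in> form_pairs (d ^ n) \<and> (\<forall>v. v \<noteq> (0, 0) \<longrightarrow> pair_eval (d ^ n) F v \<noteq> (0, 0)) \<and>
    (\<forall>v z. v \<in> line_class (z, 1) \<longrightarrow> (\<forall>i<n. poly (pderiv P) ((newt P ^^ i) z) \<noteq> 0) \<longrightarrow>
      pair_eval (d ^ n) F v \<in> line_class ((newt P ^^ n) z, 1)) \<and>
    (\<forall>v z. v \<in> line_class (z, 1) \<longrightarrow> snd (pair_eval (d ^ n) F v) \<noteq> 0 \<longrightarrow>
      (\<forall>i<n. poly (pderiv P) ((newt P ^^ i) z) \<noteq> 0))"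
    using F
  proof (induction n arbitrary: F)
    case 0
    then obtain c where c: "c \<noteq> 0" "fst F = [:0, c:]" "snd F = [:c:]" by (auto simp: proj_class_iff)
    have ev: "pair_eval 1 F v = (c * fst v, c * snd v)" for v
      using c unfolding pair_eval_1 by simp
    have l: "pair_eval 1 F v \<in> line_class v" for v unfolding ev line_class_iff using c by auto
    have "F \<in> form_pairs 1" using c by (intro form_pairsI) auto
    moreover have "\<forall>v. v \<noteq> (0, 0) \<longrightarrow> pair_eval 1 F v \<noteq> (0, 0)" using l line_class_zero by blast
    moreover have "\<forall>v z. v \<in> line_class (z, 1) \<longrightarrow> pair_eval 1 F v \<in> line_class (z, 1)"
      using l line_class_trans by blast
    ultimately show ?case by simp
  next
    case (Suc n)
    then obtain N' H where F: "F = pair_comp d N' H" "N' \<in> proj_class ?n" "H \<in> rat_iter d (proj_class ?n) n"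
      by (auto simp: rat_comp_def)
    note IH = Suc.IH[OF F(3)]
    have H: "H \<in> form_pairs (d ^ n)" using IH by blast
    have ev: "pair_eval (d ^ Suc n) F v \<in> line_class (pair_eval d ?n (pair_eval (d ^ n) H v))" for v
      using pair_eval_comp[OF H, of d N' v] pair_eval_proj[OF F(2)] F(1) by simp
    have "F \<in> form_pairs (d ^ Suc n)" using pair_comp_form_pairs[OF H] F(1) by simp
    moreover have "pair_eval (d ^ Suc n) F v \<noteq> (0, 0)" if "v \<noteq> (0, 0)" for v
      using line_class_zero[OF ev] nv IH that by blast
    moreover have "pair_eval (d ^ Suc n) F v \<in> line_class ((newt P ^^ Suc n) z, 1)"
      if v: "v \<in> line_class (z, 1)" and reg: "\<forall>i<Suc n. poly (pderiv P) ((newt P ^^ i) z) \<noteq> 0" for v z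
    proof -
      have "\<forall>i<n. poly (pderiv P) ((newt P ^^ i) z) \<noteq> 0" using reg by simp
      then have "pair_eval (d ^ n) H v \<in> line_class ((newt P ^^ n) z, 1)" using IH v by blast
      from line_class_trans[OF ev line_class_trans[OF pair_eval_line[OF this] fin]] reg
      show ?thesis by simp
    qed
    moreover have "\<forall>i<Suc n. poly (pderiv P) ((newt P ^^ i) z) \<noteq> 0"
      if v: "v \<in> line_class (z, 1)" and s: "snd (pair_eval (d ^ Suc n) F v) \<noteq> 0" for v z
    proof -
      let ?w = "pair_eval (d ^ n) H v"
      have s': "snd (pair_eval d ?n ?w) \<noteq> 0" using s ev[of v] by (auto simp: line_class_iff)
      then have w: "snd ?w \<noteq> 0" using d0 by (auto simp: pair_eval_def form_eval_0)
      then have reg: "\<forall>i<n. poly (pderiv P) ((newt P ^^ i) z) \<noteq> 0" using IH v by blast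
      then have "?w \<in> line_class ((newt P ^^ n) z, 1)" using IH v by blast
      then obtain c where c: "c \<noteq> 0" "fst ?w = c * (newt P ^^ n) z" "snd ?w = c" by (auto simp: line_class_iff)
      have "snd (pair_eval d ?n ?w) = c ^ d * poly (pderiv P) ((newt P ^^ n) z)"
        using c(1) dn by (simp add: pair_eval_def[of d] c(2,3) form_eval_ratio)
      then have "poly (pderiv P) ((newt P ^^ n) z) \<noteq> 0" using s' by auto
      then show ?thesis using reg by (simp add: less_Suc_eq)
    qed
    ultimately show ?case by blast
  qed
  show "F \<in> form_pairs (d ^ n)" using * by blast
  show "v \<noteq> (0, 0) \<Longrightarrow> pair_eval (d ^ n) F v \<noteq> (0, 0)" using * by blast
  show "v \<in> line_class (z, 1) \<Longrightarrow> (\<forall>i<n. poly (pderiv P) ((newt P ^^ i) z) \<noteq> 0) \<Longrightarrow>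
      pair_eval (d ^ n) F v \<in> line_class ((newt P ^^ n) z, 1)" using * by blast
  show "v \<in> line_class (z, 1) \<Longrightarrow> snd (pair_eval (d ^ n) F v) \<noteq> 0 \<Longrightarrow>
      (\<forall>i<n. poly (pderiv P) ((newt P ^^ i) z) \<noteq> 0)" using * by blast
qed

text \<open>The one-parameter subgroup \<open>diag(1/\<mu>, \<mu>)\<close> drives these coefficients to zero as
  \<open>\<mu> \<rightarrow> 0\<close>: this is the easy half of the numerical criterion, for a hole at infinity.\<close>

lemma unstable_of_small_degree:
  assumes F: "2 * degree F \<le> D" and G: "degree G = 0" and D: "2 \<le> D"
    and n: "1 \<le> n" and Q: "homogeneous_mpoly D n Q" and inv: "SL2_invariant D Q"
  shows "mpoly_eval Q (F, G) = 0"
proof -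
  define A :: "complex \<Rightarrow> form_pair" where "A \<mu> = ([:0, 1 / \<mu>:], [:\<mu>:])" for \<mu>
  define v where "v \<mu> = pair_conj D (A \<mu>) (F, G)" for \<mu>
  have sub: "coeff (form_subst D H (A \<mu>)) i = (if i \<le> D then coeff H i * (1 / \<mu>) ^ i * \<mu> ^ (D - i) else 0)"
    for H \<mu> i
  proof -
    have p1: "[:0, 1 / \<mu>:] ^ j = monom ((1 / \<mu>) ^ j) j" for j
      by (metis monom_0 monom_Suc monom_power mult_1_left One_nat_def)
    have p2: "[:\<mu>:] ^ j = [:\<mu> ^ j:]" for j by (induction j) simp_all
    have "form_subst D H (A \<mu>) = (\<Sum>i\<le>D. monom (coeff H i * (1 / \<mu>) ^ i * \<mu> ^ (D - i)) i)"
      unfolding form_subst_def A_def fst_conv snd_conv p1 p2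
      by (intro sum.cong refl) (simp add: smult_monom mult_ac)
    then show ?thesis by (simp add: coeff_sum)
  qed
  have fs1: "form_subst 1 H W = smult (coeff H 0) (snd W) + smult (coeff H 1) (fst W)" for H W
    by (simp add: form_subst_def)
  have vF: "fst (v \<mu>) = smult \<mu> (form_subst D F (A \<mu>))"
    and vG: "snd (v \<mu>) = smult (1 / \<mu>) (form_subst D G (A \<mu>))" for \<mu>
    unfolding v_def pair_conj_def pair_comp_def fst_conv snd_conv fs1
    by (simp_all add: pair_adj_def A_def)
  \<comment> \<open>The weight D + 1 - 2i is positive as long as 2i is at most \<open>D\<close>.
    Beyond the degree of \<open>F\<close>, where the natural number subtraction may be cut off, the
    coefficient is 0.\<close>
  have cF: "coeff (fst (v \<mu>)) i = coeff F i * \<mu> ^ (D + 1 - 2 * i)" if mu: "\<mu> \<noteq> 0" for \<mu> i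
  proof (cases "i \<le> degree F")
    case True
    then have le: "i \<le> D" "2 * i \<le> D" using F by auto
    have e: "D - i + 1 = i + (D + 1 - 2 * i)" using le by simp
    have "coeff (fst (v \<mu>)) i = \<mu> * (coeff F i * (1 / \<mu>) ^ i * \<mu> ^ (D - i))"
      using le(1) by (simp add: vF vG sub)
    also have "\<dots> = coeff F i * (1 / \<mu>) ^ i * \<mu> ^ (D - i + 1)" by simp
    also have "\<dots> = coeff F i * \<mu> ^ (D + 1 - 2 * i)"
      unfolding e power_add using mu by (simp add: power_divide)
    finally show ?thesis .
  next
    case False
    then have "coeff F i = 0" by (simp add: coeff_eq_0)
    then show ?thesis
      by (simp add: vF vG sub)
  qed
  \<comment> \<open>Here the weight would be D - 1 - 2i, but only \<open>i = 0\<close> can carry a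
    nonzero coefficient, and D - 1 is positive because \<open>D\<close> is at least 2.\<close>
  have cG: "coeff (snd (v \<mu>)) i = coeff G i * \<mu> ^ (D - 1)" if mu: "\<mu> \<noteq> 0" for \<mu> i
  proof (cases "i = 0")
    case True
    have "coeff (snd (v \<mu>)) i = (1 / \<mu>) * (coeff G i * \<mu> ^ D)"
      using True by (simp add: vF vG sub)
    also have "\<dots> = coeff G i * \<mu> ^ (D - 1)" using D mu by (cases D) simp_all
    finally show ?thesis .
  next
    case False
    then have "coeff G i = 0" using G by (simp add: coeff_eq_0)
    then show ?thesis
      by (simp add: vF vG sub)
  qed
  have power_lim: "((\<lambda>\<mu> :: complex. c * \<mu> ^ j) \<longlongrightarrow> 0) (at 0)" if "j \<noteq> 0" for c :: complex and j
  proof -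
    have "((\<lambda>\<mu> :: complex. c * \<mu> ^ j) \<longlongrightarrow> c * 0 ^ j) (at 0)" by (intro tendsto_intros)
    moreover have "(0 :: complex) ^ j = 0" using that by simp
    ultimately show ?thesis by (simp only: mult_zero_right)
  qed
  have nz: "eventually (\<lambda>\<mu> :: complex. \<mu> \<noteq> 0) (at 0)" by (simp add: eventually_at_filter)
  have lF: "((\<lambda>\<mu>. coeff (fst (v \<mu>)) i) \<longlongrightarrow> 0) (at 0)" for i
  proof (cases "i \<le> degree F")
    case True
    have "((\<lambda>\<mu>. coeff F i * \<mu> ^ (D + 1 - 2 * i)) \<longlongrightarrow> 0) (at 0)" by (rule power_lim) (use True F in simp)
    moreover have "eventually (\<lambda>\<mu>. coeff F i * \<mu> ^ (D + 1 - 2 * i) = coeff (fst (v \<mu>)) i) (at 0)"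
      using nz by (rule eventually_mono) (rule cF[symmetric])
    ultimately show ?thesis by (rule Lim_transform_eventually)
  next
    case False
    have "eventually (\<lambda>\<mu>. 0 = coeff (fst (v \<mu>)) i) (at 0)"
      using nz by (rule eventually_mono) (use False in \<open>simp add: cF coeff_eq_0\<close>)
    then show ?thesis by (rule Lim_transform_eventually[OF tendsto_const])
  qed
  have lG: "((\<lambda>\<mu>. coeff (snd (v \<mu>)) i) \<longlongrightarrow> 0) (at 0)" for i
  proof -
    have "((\<lambda>\<mu>. coeff G i * \<mu> ^ (D - 1)) \<longlongrightarrow> 0) (at 0)" by (rule power_lim) (use D in simp)
    moreover have "eventually (\<lambda>\<mu>. coeff G i * \<mu> ^ (D - 1) = coeff (snd (v \<mu>)) i) (at 0)"
      using nz by (rule eventually_mono) (rule cG[symmetric])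
    ultimately show ?thesis by (rule Lim_transform_eventually)
  qed
  have lim: "((\<lambda>\<mu>. mpoly_eval Q (v \<mu>)) \<longlongrightarrow> 0) (at 0)"
  proof -
    have "((\<lambda>\<mu>. mpoly_eval Q (v \<mu>)) \<longlongrightarrow> (\<Sum>m\<in>Poly_Mapping.keys Q. Poly_Mapping.lookup Q m *
       (\<Prod>x\<in>Poly_Mapping.keys m. 0 ^ Poly_Mapping.lookup m x))) (at 0)"
      unfolding mpoly_eval_def
    proof (intro tendsto_sum tendsto_mult tendsto_const tendsto_prod tendsto_power)
      show "((\<lambda>\<mu>. case_sum (coeff (fst (v \<mu>))) (coeff (snd (v \<mu>))) x) \<longlongrightarrow> 0) (at 0)" for x
        using lF lG by (cases x) simp_all
    qed
    \<comment> \<open>Each monomial has positive degree \<open>n\<close>, so it contains a variable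
      with positive exponent and vanishes at the origin.\<close>
    moreover have "(\<Prod>x\<in>Poly_Mapping.keys m. (0 :: complex) ^ Poly_Mapping.lookup m x) = 0" if m: "m \<in> Poly_Mapping.keys Q" for m
    proof -
      have "(\<Sum>x\<in>Poly_Mapping.keys m. Poly_Mapping.lookup m x) = n" using Q m by (auto simp: homogeneous_mpoly_def)
      then have "Poly_Mapping.keys m \<noteq> {}" using n by auto
      then obtain x where x: "x \<in> Poly_Mapping.keys m" by blast
      then have "(0 :: complex) ^ Poly_Mapping.lookup m x = 0" by (simp add: in_keys_iff)
      then show ?thesis using x by (intro prod_zero) auto
    qed
    ultimately show ?thesis by simp
  qed
  have "mpoly_eval Q (v \<mu>) = mpoly_eval Q (F, G)" if "\<mu> \<noteq> 0" for \<mu>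
  proof -
    have "A \<mu> \<in> form_pairs 1" by (rule form_pairsI) (auto simp: A_def)
    moreover have "pair_det (A \<mu>) = 1" using that by (simp add: pair_det_def A_def)
    moreover have "(F, G) \<in> form_pairs D" using F G by (simp add: form_pairs_def)
    ultimately show ?thesis using inv unfolding SL2_invariant_def v_def by blast
  qed
  then have "eventually (\<lambda>\<mu>. mpoly_eval Q (v \<mu>) = mpoly_eval Q (F, G)) (at 0)"
    using nz by (auto elim: eventually_mono)
  then have "((\<lambda>\<mu> :: complex. mpoly_eval Q (F, G)) \<longlongrightarrow> 0) (at 0)"
    by (rule Lim_transform_eventually[OF lim])
  then show ?thesis using tendsto_unique[OF trivial_limit_at tendsto_const] by blast
qed

section \<open>Convergence on the sphere\<close>

lemma norm_scaled_pair: "norm (c * a, c * b) = cmod c * norm (a, b :: complex)" for c a b :: complex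
proof -
  have "norm (c * a, c * b) = sqrt ((cmod c)\<^sup>2 * ((cmod a)\<^sup>2 + (cmod b)\<^sup>2))"
    by (simp add: norm_Pair norm_mult power_mult_distrib distrib_left)
  then show ?thesis by (simp add: norm_Pair real_sqrt_mult)
qed

lemma chordal_eq:
  assumes p: "p \<noteq> (0, 0)" and q: "q \<noteq> (0, 0)"
    and Z: "Z \<noteq> {}" "Z \<subseteq> line_class p" and W: "W \<noteq> {}" "W \<subseteq> line_class q"
  shows "chordal Z W = cmod (fst p * snd q - snd p * fst q) / (norm p * norm q)"
proof -
  let ?v = "cmod (fst p * snd q - snd p * fst q) / (norm p * norm q)"
  have val: "cmod (x * v - y * u) / (norm (x, y) * norm (u, v)) = ?v" if "(x, y) \<in> Z" "(u, v) \<in> W" for x y u v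
  proof -
    have "(x, y) \<in> line_class p" "(u, v) \<in> line_class q" using that Z W by auto
    then obtain c k where c: "c \<noteq> 0" "x = c * fst p" "y = c * snd p" and k: "k \<noteq> 0" "u = k * fst q" "v = k * snd q"
      unfolding line_class_iff by auto
    have "x * v - y * u = (c * k) * (fst p * snd q - snd p * fst q)" using c k by (simp add: algebra_simps)
    then have "cmod (x * v - y * u) = cmod c * cmod k * cmod (fst p * snd q - snd p * fst q)" by (simp add: norm_mult)
    moreover have "norm (x, y) = cmod c * norm p" "norm (u, v) = cmod k * norm q"
      using norm_scaled_pair[of c "fst p" "snd p"] norm_scaled_pair[of k "fst q" "snd q"] c k by simp_all
    ultimately show ?thesis using c(1) k(1) by simp
  qed
  obtain x0 y0 u0 v0 where ne: "(x0, y0) \<in> Z" "(u0, v0) \<in> W"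
    using Z(1) W(1) by (metis ex_in_conv surj_pair)
  have "{cmod (x * v - y * u) / (norm (x, y) * norm (u, v)) | x y u v. (x, y) \<in> Z \<and> (u, v) \<in> W} = {?v}"
  proof
    show "{cmod (x * v - y * u) / (norm (x, y) * norm (u, v)) | x y u v. (x, y) \<in> Z \<and> (u, v) \<in> W} \<subseteq> {?v}"
      using val by blast
    show "{?v} \<subseteq> {cmod (x * v - y * u) / (norm (x, y) * norm (u, v)) | x y u v. (x, y) \<in> Z \<and> (u, v) \<in> W}"
    proof
      fix a assume "a \<in> {?v}"
      then have "a = cmod (x0 * v0 - y0 * u0) / (norm (x0, y0) * norm (u0, v0))" using val[OF ne] by simp
      then show "a \<in> {cmod (x * v - y * u) / (norm (x, y) * norm (u, v)) | x y u v. (x, y) \<in> Z \<and> (u, v) \<in> W}"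
        using ne by blast
    qed
  qed
  then show ?thesis by (simp add: chordal_def)
qed

lemma rat_eval_line:
  assumes "f \<noteq> {}" "\<And>F. F \<in> f \<Longrightarrow> pair_eval D F v \<in> line_class e"
  shows "rat_eval D f (line_class v) \<noteq> {}" "rat_eval D f (line_class v) \<subseteq> line_class e"
proof -
  have r: "rat_eval D f z = {pair_eval D F w | F w. F \<in> f \<and> w \<in> z}" for z
    unfolding rat_eval_def pair_eval_def by force
  show "rat_eval D f (line_class v) \<noteq> {}"
    unfolding r using assms(1) line_class_refl[of v] by blast
  show "rat_eval D f (line_class v) \<subseteq> line_class e"
    unfolding r using assms(2) pair_eval_line line_class_trans by blast
qed

lemma proj_line_cases:
  assumes "z \<in> proj_line"
  obtains "z = line_class (1, 0)" | x where "z = line_class (x, 1)"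
proof -
  from assms obtain v where v: "z = line_class v" "v \<noteq> (0, 0)" by (auto simp: proj_line_def)
  show ?thesis
  proof (cases "snd v = 0")
    case True
    then have "v \<in> line_class (1, 0)" using v(2) by (cases v) (auto simp: line_class_iff)
    then show ?thesis using that(1) v(1) line_class_eq by blast
  next
    case False
    then have "v \<in> line_class (fst v / snd v, 1)" by (auto simp: line_class_iff)
    then show ?thesis using that(2) v(1) line_class_eq by blast
  qed
qed

lemma line_class_in_proj_line: "v \<noteq> (0, 0) \<Longrightarrow> line_class v \<in> proj_line"
  by (auto simp: proj_line_def)

lemma line_class_inj: "line_class (x, 1) = line_class (y, 1) \<Longrightarrow> x = y"
proof -
  assume "line_class (x, 1 :: complex) = line_class (y, 1)"
  then have "(x, 1) \<in> line_class (y, 1)" by (metis line_class_refl)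
  then show "x = y" by (auto simp: line_class_iff)
qed

text \<open>With a = 1 + |x0| and b = |x - x0| the chordal distance is at least b / (a (a + b)), an
  increasing function of b; the threshold is its value at \<delta>.\<close>

lemma chordal_small_imp_close:
  assumes "\<delta> > 0" and c: "chordal (line_class (x0, 1)) (line_class (x, 1)) < \<delta> / ((1 + cmod x0) * (1 + cmod x0 + \<delta>))"
  shows "cmod (x - x0) < \<delta>"
proof (rule ccontr)
  assume "\<not> ?thesis"
  then have far: "\<delta> \<le> cmod (x - x0)" by simp
  define a where "a = 1 + cmod x0"
  define b where "b = cmod (x - x0)"
  have a: "a \<ge> 1" by (simp add: a_def)
  have n: "norm (y, 1 :: complex) \<le> 1 + cmod y" for y :: complex
    using norm_Pair_le[of y "1::complex"] by simp
  have npos: "norm (y, 1 :: complex) > 0" for y :: complex by (simp add: zero_prod_def)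
  have "cmod x \<le> cmod x0 + b" unfolding b_def using norm_triangle_sub[of x x0] by simp
  then have nx: "norm (x, 1 :: complex) \<le> a + b" using n[of x] by (simp add: a_def)
  have nx0: "norm (x0, 1 :: complex) \<le> a" using n[of x0] by (simp add: a_def)
  have "chordal (line_class (x0, 1)) (line_class (x, 1)) = cmod (x0 - x) / (norm (x0, 1 :: complex) * norm (x, 1 :: complex))"
    by (subst chordal_eq[of "(x0, 1)" "(x, 1)"]) (auto intro: line_class_refl)
  then have "chordal (line_class (x0, 1)) (line_class (x, 1)) = b / (norm (x0, 1 :: complex) * norm (x, 1 :: complex))"
    by (simp add: b_def norm_minus_commute)
  moreover have "b / (a * (a + b)) \<le> b / (norm (x0, 1 :: complex) * norm (x, 1 :: complex))"
  proof (rule divide_left_mono)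
    show "norm (x0, 1 :: complex) * norm (x, 1 :: complex) \<le> a * (a + b)"
      by (rule mult_mono[OF nx0 nx]) (use a in auto)
    show "0 \<le> b" by (simp add: b_def)
    show "0 < a * (a + b) * (norm (x0, 1 :: complex) * norm (x, 1 :: complex))"
      using a npos[of x] npos[of x0] by (intro mult_pos_pos) (auto simp: b_def intro: add_pos_nonneg)
  qed
  moreover have "\<delta> / (a * (a + \<delta>)) \<le> b / (a * (a + b))"
  proof -
    have "\<delta> * (a * (a + b)) \<le> b * (a * (a + \<delta>))"
    proof -
      have "a * a * \<delta> \<le> a * a * b" using far a by (intro mult_left_mono) (auto simp: b_def)
      then show ?thesis by (simp add: algebra_simps)
    qed
    moreover have "0 < a * (a + b)" "0 < a * (a + \<delta>)" using a assms(1) far by (auto simp: b_def intro!: mult_pos_pos)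
    ultimately show ?thesis by (subst frac_le_eq) (auto simp: divide_le_0_iff)
  qed
  ultimately show False using c by (simp add: a_def)
qed

lemma poly_pair_perturbation:
  fixes p p0 :: "complex poly"
  assumes "degree p \<le> D" "degree p0 \<le> D" "cmod x \<le> R"
  shows "cmod (poly p x - poly p0 x) \<le> (\<Sum>i\<le>D. cmod (coeff p i - coeff p0 i) * R ^ i)"
proof -
  have "poly p x - poly p0 x = (\<Sum>i\<le>D. (coeff p i - coeff p0 i) * x ^ i)"
    using assms by (simp add: poly_eq_sum_le sum_subtractf left_diff_distrib)
  also have "cmod \<dots> \<le> (\<Sum>i\<le>D. cmod (coeff p i - coeff p0 i) * R ^ i)"
  proof (rule sum_norm_le)
    fix i
    show "cmod ((coeff p i - coeff p0 i) * x ^ i) \<le> cmod (coeff p i - coeff p0 i) * R ^ i"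
      using assms(3) by (simp add: norm_mult norm_power mult_left_mono power_mono)
  qed
  finally show ?thesis .
qed

text \<open>Where the limit pair does not vanish, convergence of coefficients controls directions as
  well as vectors. In the affine chart \<open>(H * A, H * B)\<close> vanishes exactly at the zeros
  of \<open>H\<close>, and elsewhere it represents the same point as \<open>(A, B)\<close>.\<close>

lemma locally_uniform_limit_of_coeffs:
  assumes w0: "w0 \<in> form_pairs D" "w0 = (H * A, H * B)" "H \<noteq> 0"
    and AB: "g \<in> rat_maps e" "(A, B) \<in> g"
    and w: "eventually (\<lambda>t. w t \<in> form_pairs D) (at 0)"
    and lim: "\<And>i. ((\<lambda>t. coeff (fst (w t)) i) \<longlongrightarrow> coeff (fst w0) i) (at 0)"
      "\<And>i. ((\<lambda>t. coeff (snd (w t)) i) \<longlongrightarrow> coeff (snd w0) i) (at 0)"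
    and f: "eventually (\<lambda>t. f t \<noteq> {} \<and> (\<forall>F v. F \<in> f t \<longrightarrow> pair_eval D F v \<in> line_class (pair_eval D (w t) v)) \<and>
      (\<forall>v. v \<noteq> (0, 0) \<longrightarrow> pair_eval D (w t) v \<noteq> (0, 0))) (at 0)"
  shows "\<exists>S. finite S \<and> S \<subseteq> proj_line \<and> locally_uniform_limit_off S (\<lambda>t. rat_eval D (f t)) (rat_eval e g)"
proof (intro exI conjI)
  \<comment> \<open>Infinity is put into the exceptional set so that everything takes place in the
    affine chart; the other points are the holes.\<close>
  let ?S = "insert (line_class (1, 0)) ((\<lambda>z. line_class (z, 1)) ` {z. poly H z = 0})"
  show "finite ?S" using poly_roots_finite[OF w0(3)] by simp
  show "?S \<subseteq> proj_line" using line_class_in_proj_line by auto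
  note gAB = rat_maps_rep[OF AB]
  have dAB: "degree A \<le> e" "degree B \<le> e" using gAB(1) by (auto simp: form_pairs_def)
  have dw0: "degree (fst w0) \<le> D" "degree (snd w0) \<le> D" using form_pairsD[OF w0(1)] by auto
  have evg: "pair_eval e (A, B) (x, 1) = (poly A x, poly B x)" for x
    using dAB by (simp add: pair_eval_def form_eval_poly)
  have ABnz: "(poly A x, poly B x) \<noteq> (0, 0)" for x
    using rat_maps_nonvanishing[OF AB, of "(x, 1)"] evg by simp
  have gline: "rat_eval e g (line_class (x, 1)) \<noteq> {}" "rat_eval e g (line_class (x, 1)) \<subseteq> line_class (poly A x, poly B x)" for x
  proof -
    have "g \<noteq> {}" using AB(2) by blast
    moreover have "pair_eval e F (x, 1) \<in> line_class (poly A x, poly B x)" if "F \<in> g" for F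
      using pair_eval_proj[of F "(A, B)" e "(x, 1)"] that gAB(3) evg by simp
    note * = calculation this
    show "rat_eval e g (line_class (x, 1)) \<noteq> {}" by (rule rat_eval_line(1)[OF *])
    show "rat_eval e g (line_class (x, 1)) \<subseteq> line_class (poly A x, poly B x)" by (rule rat_eval_line(2)[OF *])
  qed
  show "locally_uniform_limit_off ?S (\<lambda>t. rat_eval D (f t)) (rat_eval e g)"
    unfolding locally_uniform_limit_off_def
  proof
    fix z assume z: "z \<in> proj_line - ?S"
    then obtain x0 where x0: "z = line_class (x0, 1)" by (auto elim: proj_line_cases)
    then have Hx0: "poly H x0 \<noteq> 0" using z by auto
    have "open {x. poly H x \<noteq> 0}" by (intro open_Collect_neq continuous_intros)
    then obtain \<delta> where \<delta>: "\<delta> > 0" "cball x0 \<delta> \<subseteq> {x. poly H x \<noteq> 0}"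
      using Hx0 open_contains_cball[of "{x. poly H x \<noteq> 0}"] by blast
    define R where "R = cmod x0 + \<delta>"
    have R: "cmod x \<le> R" if "x \<in> cball x0 \<delta>" for x
      using that norm_triangle_sub[of x x0] by (simp add: R_def dist_norm norm_minus_commute)
    have "continuous_on (cball x0 \<delta>) (\<lambda>x. norm (poly (fst w0) x, poly (snd w0) x))"
      by (intro continuous_intros)
    from continuous_attains_inf[OF compact_cball _ this] \<delta>(1) obtain x1 where
      x1: "x1 \<in> cball x0 \<delta>" "\<And>x. x \<in> cball x0 \<delta> \<Longrightarrow> norm (poly (fst w0) x1, poly (snd w0) x1) \<le> norm (poly (fst w0) x, poly (snd w0) x)"
      by auto
    define b where "b = norm (poly (fst w0) x1, poly (snd w0) x1)"
    have b: "b > 0"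
    proof -
      have "poly H x1 \<noteq> 0" using x1(1) \<delta>(2) by auto
      then have "(poly (fst w0) x1, poly (snd w0) x1) \<noteq> (0, 0)" using ABnz[of x1] by (auto simp: w0(2))
      then show ?thesis by (simp add: b_def zero_prod_def[symmetric])
    qed
    define \<eta> where "\<eta> t = (\<Sum>i\<le>D. cmod (coeff (fst (w t)) i - coeff (fst w0) i) * R ^ i) +
       (\<Sum>i\<le>D. cmod (coeff (snd (w t)) i - coeff (snd w0) i) * R ^ i)" for t
    have "(\<eta> \<longlongrightarrow> (\<Sum>i\<le>D. cmod (coeff (fst w0) i - coeff (fst w0) i) * R ^ i) +
       (\<Sum>i\<le>D. cmod (coeff (snd w0) i - coeff (snd w0) i) * R ^ i)) (at 0)"
      unfolding \<eta>_def by (intro tendsto_add tendsto_sum tendsto_mult tendsto_norm tendsto_diff lim tendsto_const)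
    then have \<eta>0: "(\<eta> \<longlongrightarrow> 0) (at 0)" by simp
    let ?r = "\<delta> / ((1 + cmod x0) * (1 + cmod x0 + \<delta>))"
    show "\<exists>r>0. \<forall>\<epsilon>>0. \<forall>\<^sub>F t in at 0. \<forall>w \<in> proj_line - ?S. chordal z w < r \<longrightarrow>
        chordal (rat_eval D (f t) w) (rat_eval e g w) < \<epsilon>"
    proof (intro exI[of _ ?r] conjI allI impI)
      show "?r > 0" using \<delta>(1) norm_ge_zero[of x0] by (intro divide_pos_pos mult_pos_pos; linarith)
      fix \<epsilon> :: real assume \<epsilon>: "\<epsilon> > 0"
      \<comment> \<open>The bound b/2 keeps \<open>norm p\<close> above b/2; given this, the other
        bound makes twice \<eta> smaller than \<epsilon> times \<open>norm p\<close>.\<close>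
      have "eventually (\<lambda>t. \<eta> t < min (b / 2) (\<epsilon> * b / 4)) (at 0)"
        by (rule order_tendstoD(2)[OF \<eta>0]) (use b \<epsilon> in auto)
      with w f show "\<forall>\<^sub>F t in at 0. \<forall>w \<in> proj_line - ?S. chordal z w < ?r \<longrightarrow>
        chordal (rat_eval D (f t) w) (rat_eval e g w) < \<epsilon>"
      proof eventually_elim
        case (elim t)
        show ?case
        proof (intro ballI impI)
          fix y assume y: "y \<in> proj_line - ?S" and c: "chordal z y < ?r"
          from y obtain x where x: "y = line_class (x, 1)" by (auto elim: proj_line_cases)
          have "cmod (x - x0) < \<delta>" by (rule chordal_small_imp_close[OF \<delta>(1)]) (use c x x0 in simp)
          then have xc: "x \<in> cball x0 \<delta>" by (simp add: dist_norm norm_minus_commute)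
          define p where "p = (poly (fst (w t)) x, poly (snd (w t)) x)"
          define p0 where "p0 = (poly (fst w0) x, poly (snd w0) x)"
          have dw: "degree (fst (w t)) \<le> D" "degree (snd (w t)) \<le> D" using form_pairsD elim(1) by blast+
          have ev: "pair_eval D (w t) (x, 1) = p" using dw by (simp add: pair_eval_def form_eval_poly p_def)
          have pnz: "p \<noteq> (0, 0)" using elim(2) ev by (metis Pair_inject zero_neq_one)
          have fl: "rat_eval D (f t) y \<noteq> {}" "rat_eval D (f t) y \<subseteq> line_class p"
            using rat_eval_line[of "f t" D "(x, 1)" p] elim(2) unfolding x ev[symmetric] by auto
          have Rx: "cmod x \<le> R" using R xc by blast
          have \<eta>nn: "0 \<le> (\<Sum>i\<le>D. cmod (coeff (fst (w t)) i - coeff (fst w0) i) * R ^ i)"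
            "0 \<le> (\<Sum>i\<le>D. cmod (coeff (snd (w t)) i - coeff (snd w0) i) * R ^ i)"
            using order_trans[OF norm_ge_zero Rx] by (auto intro!: sum_nonneg mult_nonneg_nonneg zero_le_power)
          have d1: "cmod (fst p - fst p0) \<le> \<eta> t" and d2: "cmod (snd p - snd p0) \<le> \<eta> t"
            using poly_pair_perturbation[OF dw(1) dw0(1) Rx] poly_pair_perturbation[OF dw(2) dw0(2) Rx] \<eta>nn
            by (auto simp: \<eta>_def p_def p0_def)
          have dd: "cmod (fst p - fst p0) + cmod (snd p - snd p0) \<le> \<eta> t"
            using poly_pair_perturbation[OF dw(1) dw0(1) Rx] poly_pair_perturbation[OF dw(2) dw0(2) Rx]
            by (auto simp: \<eta>_def p_def p0_def)
          have "norm (p - p0) \<le> \<eta> t"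
            using norm_Pair_le[of "fst p - fst p0" "snd p - snd p0"] dd by (simp add: minus_prod_def)
          moreover have "b \<le> norm p0" using x1(2)[OF xc] by (simp add: b_def p0_def)
          moreover have "norm p0 \<le> norm p + norm (p - p0)" using norm_triangle_sub[of p0 p] by (simp add: norm_minus_commute)
          ultimately have np: "norm p \<ge> b / 2" using elim(3) by simp
          define a where "a = (poly A x, poly B x)"
          have a: "a \<noteq> (0, 0)" using ABnz by (simp add: a_def)
          have na: "norm a > 0" using a by (simp add: zero_prod_def)
          \<comment> \<open>\<open>p0\<close> and \<open>a\<close> are proportional, so only the
            perturbation \<open>p - p0\<close> contributes to the cross product.\<close>
          have "fst p0 * snd a - snd p0 * fst a = 0" by (simp add: p0_def a_def w0(2))
          then have "fst p * snd a - snd p * fst a = (fst p - fst p0) * snd a - (snd p - snd p0) * fst a"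
            by (simp add: algebra_simps)
          then have "cmod (fst p * snd a - snd p * fst a) \<le> cmod (fst p - fst p0) * cmod (snd a) + cmod (snd p - snd p0) * cmod (fst a)"
            by (metis norm_mult norm_triangle_ineq4)
          also have "\<dots> \<le> \<eta> t * norm a + \<eta> t * norm a"
            using d1 d2 norm_fst_le[of "fst a" "snd a"] norm_snd_le[of "snd a" "fst a"]
            by (intro add_mono mult_mono) (auto intro: order_trans[OF norm_ge_zero])
          finally have cr: "cmod (fst p * snd a - snd p * fst a) \<le> 2 * \<eta> t * norm a" by (simp add: mult_ac)
          have "chordal (rat_eval D (f t) y) (rat_eval e g y) = cmod (fst p * snd a - snd p * fst a) / (norm p * norm a)"
            by (rule chordal_eq[OF pnz a fl]) (use gline x in \<open>auto simp: a_def\<close>)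
          also have "\<dots> < \<epsilon>"
          proof -
            have "2 * \<eta> t < \<epsilon> * (b / 2)" using elim(3) by simp
            also have "\<dots> \<le> \<epsilon> * norm p" using np \<epsilon> by (intro mult_left_mono) auto
            finally have "2 * \<eta> t * norm a < \<epsilon> * norm p * norm a" using na by (intro mult_strict_right_mono)
            then have "cmod (fst p * snd a - snd p * fst a) < \<epsilon> * (norm p * norm a)" using cr by simp
            moreover have "0 < norm p * norm a" using na np b by (intro mult_pos_pos) auto
            ultimately show ?thesis by (simp add: divide_less_eq)
          qed
          finally show "chordal (rat_eval D (f t) y) (rat_eval e g y) < \<epsilon>" .
        qed
      qed
    qed
  qed
qed

section \<open>Holomorphic coefficients and their normalisation by a power of the parameter\<close>

lemma holomorphic_leading_term:
  assumes "open X" "0 \<in> X" "h holomorphic_on X" "\<not> eventually (\<lambda>s. h s = 0) (at (0 :: complex))"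
  obtains n c where "c \<noteq> 0" "((\<lambda>s. h s / s ^ n) \<longlongrightarrow> c) (at 0)"
proof -
  obtain e where e: "e > 0" "ball 0 e \<subseteq> X" using assms(1,2) open_contains_ball by blast
  have hol: "h holomorphic_on ball 0 e" using assms(3) e(2) holomorphic_on_subset by blast
  have ex: "\<exists>w\<in>ball 0 e. h w \<noteq> 0"
  proof (rule ccontr)
    assume "\<not> ?thesis"
    then have "eventually (\<lambda>s. h s = 0) (at 0)"
      unfolding eventually_at using e(1) by (intro exI[of _ e]) (auto simp: dist_commute)
    then show False using assms(4) by simp
  qed
  define n where "n = nat (zorder h 0)"
  obtain \<rho> where \<rho>: "\<rho> > 0" "zor_poly h 0 holomorphic_on cball 0 \<rho>"
    "\<forall>w\<in>cball 0 \<rho>. h w = zor_poly h 0 w * (w - 0) ^ n \<and> zor_poly h 0 w \<noteq> 0"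
    using zorder_exist_zero[OF hol open_ball connected_ball centre_in_ball[THEN iffD2, OF e(1)] ex]
    unfolding n_def by blast
  have "isCont (zor_poly h 0) 0"
    using \<rho>(1,2) holomorphic_on_imp_continuous_on[of "zor_poly h 0" "ball 0 \<rho>"]
      holomorphic_on_subset[of "zor_poly h 0" "cball 0 \<rho>" "ball 0 \<rho>"]
    by (auto simp: continuous_on_eq_continuous_at)
  then have "(zor_poly h 0 \<longlongrightarrow> zor_poly h 0 0) (at 0)" by (simp add: isCont_def)
  moreover have "eventually (\<lambda>s. zor_poly h 0 s = h s / s ^ n) (at 0)"
    unfolding eventually_at using \<rho>(1,3) by (intro exI[of _ \<rho>]) auto
  ultimately have "((\<lambda>s. h s / s ^ n) \<longlongrightarrow> zor_poly h 0 0) (at 0)" by (rule Lim_transform_eventually)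
  moreover have "zor_poly h 0 0 \<noteq> 0" using \<rho>(1,3) by auto
  ultimately show ?thesis using that by blast
qed

text \<open>Dividing by the lowest order of vanishing among the functions that are not identically
  zero near 0 makes all of them converge, and those of lowest order have a nonzero limit.\<close>

lemma holomorphic_normalise:
  assumes X: "open X" "0 \<in> X" and I: "finite I" and h: "\<And>i. i \<in> I \<Longrightarrow> h i holomorphic_on X"
    and nz: "eventually (\<lambda>s. \<exists>i\<in>I. h i s \<noteq> 0) (at (0 :: complex))"
  obtains k l where "\<And>i. i \<in> I \<Longrightarrow> ((\<lambda>s. h i s / s ^ k) \<longlongrightarrow> l i) (at 0)" "\<exists>i\<in>I. l i \<noteq> 0"
proof -
  define J where "J = {i \<in> I. \<not> eventually (\<lambda>s. h i s = 0) (at 0)}"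
  have J: "finite J" using I by (simp add: J_def)
  have "J \<noteq> {}"
  proof
    assume "J = {}"
    then have "\<forall>i\<in>I. eventually (\<lambda>s. h i s = 0) (at 0)" by (auto simp: J_def)
    then have "eventually (\<lambda>s. \<forall>i\<in>I. h i s = 0) (at 0)" using I by (simp add: eventually_ball_finite)
    with nz have "eventually (\<lambda>s :: complex. False) (at 0)" by eventually_elim auto
    then show False by simp
  qed
  have "\<forall>i\<in>J. \<exists>n c. c \<noteq> 0 \<and> ((\<lambda>s. h i s / s ^ n) \<longlongrightarrow> c) (at 0)"
  proof
    fix i assume i: "i \<in> J"
    obtain n c where "c \<noteq> 0" "((\<lambda>s. h i s / s ^ n) \<longlongrightarrow> c) (at 0)"
      by (rule holomorphic_leading_term[OF X h, of i]) (use i in \<open>auto simp: J_def\<close>)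
    then show "\<exists>n c. c \<noteq> 0 \<and> ((\<lambda>s. h i s / s ^ n) \<longlongrightarrow> c) (at 0)" by blast
  qed
  then obtain n c where nc: "\<And>i. i \<in> J \<Longrightarrow> c i \<noteq> 0 \<and> ((\<lambda>s. h i s / s ^ n i) \<longlongrightarrow> c i) (at 0)" by metis
  define k where "k = Min (n ` J)"
  have kle: "k \<le> n i" if "i \<in> J" for i using that J by (simp add: k_def)
  obtain i0 where i0: "i0 \<in> J" "n i0 = k"
  proof -
    have "k \<in> n ` J" unfolding k_def by (rule Min_in) (use J \<open>J \<noteq> {}\<close> in auto)
    then show ?thesis using that by blast
  qed
  define l where "l i = (if i \<in> J then c i * 0 ^ (n i - k) else 0)" for i
  show ?thesis
  proof (rule that)
    show "\<exists>i\<in>I. l i \<noteq> 0" using i0 nc by (intro bexI[of _ i0]) (auto simp: l_def J_def)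
    fix i assume i: "i \<in> I"
    show "((\<lambda>s. h i s / s ^ k) \<longlongrightarrow> l i) (at 0)"
    proof (cases "i \<in> J")
      case True
      have "((\<lambda>s. (h i s / s ^ n i) * s ^ (n i - k)) \<longlongrightarrow> c i * 0 ^ (n i - k)) (at 0)"
        using nc[OF True] by (intro tendsto_mult tendsto_power tendsto_ident_at) auto
      moreover have "eventually (\<lambda>s. (h i s / s ^ n i) * s ^ (n i - k) = h i s / s ^ k) (at 0)"
        unfolding eventually_at_filter
      proof (rule always_eventually, intro allI impI)
        fix s :: complex assume s: "s \<noteq> 0"
        have "s ^ n i = s ^ (n i - k) * s ^ k" using kle[OF True] by (simp add: power_add[symmetric])
        then show "(h i s / s ^ n i) * s ^ (n i - k) = h i s / s ^ k" using s by simp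
      qed
      ultimately show ?thesis using True by (simp add: l_def Lim_transform_eventually)
    next
      case False
      then have "eventually (\<lambda>s. h i s = 0) (at 0)" using i by (simp add: J_def)
      then have "eventually (\<lambda>s. 0 = h i s / s ^ k) (at 0)" by eventually_elim simp
      then show ?thesis using False by (simp add: l_def Lim_transform_eventually[OF tendsto_const])
    qed
  qed
qed

definition holomorphic_poly :: "complex set \<Rightarrow> (complex \<Rightarrow> complex poly) \<Rightarrow> bool" where
  "holomorphic_poly X p \<longleftrightarrow> (\<forall>i. (\<lambda>s. coeff (p s) i) holomorphic_on X)"

lemma holomorphic_poly_mult:
  "holomorphic_poly X p \<Longrightarrow> holomorphic_poly X q \<Longrightarrow> holomorphic_poly X (\<lambda>s. p s * q s)"
  unfolding holomorphic_poly_def coeff_mult by (auto intro!: holomorphic_intros)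

lemma holomorphic_poly_sum:
  "(\<And>i. i \<in> I \<Longrightarrow> holomorphic_poly X (p i)) \<Longrightarrow> holomorphic_poly X (\<lambda>s. \<Sum>i\<in>I. p i s)"
  unfolding holomorphic_poly_def coeff_sum by (auto intro!: holomorphic_intros)

lemma holomorphic_poly_smult:
  "c holomorphic_on X \<Longrightarrow> holomorphic_poly X p \<Longrightarrow> holomorphic_poly X (\<lambda>s. smult (c s) (p s))"
  unfolding holomorphic_poly_def coeff_smult by (auto intro!: holomorphic_intros)

lemma holomorphic_poly_power: "holomorphic_poly X p \<Longrightarrow> holomorphic_poly X (\<lambda>s. p s ^ n)"
proof (induction n)
  case 0
  then show ?case by (simp add: holomorphic_poly_def)
next
  case (Suc n)
  then show ?case by (simp add: holomorphic_poly_mult)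
qed

lemma holomorphic_form_subst:
  assumes "holomorphic_poly X F" "holomorphic_poly X (\<lambda>s. fst (G s))" "holomorphic_poly X (\<lambda>s. snd (G s))"
  shows "holomorphic_poly X (\<lambda>s. form_subst D (F s) (G s))"
  unfolding form_subst_def
  using assms(1) by (intro holomorphic_poly_sum holomorphic_poly_smult holomorphic_poly_mult holomorphic_poly_power assms(2,3))
    (simp add: holomorphic_poly_def)

lemma holomorphic_pair_conj:
  assumes "holomorphic_poly X (\<lambda>s. fst (m s))" "holomorphic_poly X (\<lambda>s. snd (m s))"
    and "holomorphic_poly X (\<lambda>s. fst (F s))" "holomorphic_poly X (\<lambda>s. snd (F s))"
  shows "holomorphic_poly X (\<lambda>s. fst (pair_conj D (m s) (F s)))" "holomorphic_poly X (\<lambda>s. snd (pair_conj D (m s) (F s)))"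
proof -
  have lin: "holomorphic_poly X (\<lambda>s. [:a s, b s:])" if "a holomorphic_on X" "b holomorphic_on X" for a b
    unfolding holomorphic_poly_def
  proof
    fix i
    show "(\<lambda>s. coeff [:a s, b s:] i) holomorphic_on X"
    proof (cases i)
      case (Suc j)
      then show ?thesis using that by (cases j) (simp_all add: coeff_pCons)
    qed (use that in simp)
  qed
  have "holomorphic_poly X (\<lambda>s. fst (pair_adj (m s)))" "holomorphic_poly X (\<lambda>s. snd (pair_adj (m s)))"
    unfolding pair_adj_def fst_conv snd_conv
    by (intro lin holomorphic_on_minus; use assms(1,2) in \<open>simp add: holomorphic_poly_def\<close>)+
  then show "holomorphic_poly X (\<lambda>s. fst (pair_conj D (m s) (F s)))" "holomorphic_poly X (\<lambda>s. snd (pair_conj D (m s) (F s)))"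
    unfolding pair_conj_def pair_comp_def fst_conv snd_conv
    by (auto intro!: holomorphic_form_subst assms)
qed

section \<open>Linear frames\<close>

text \<open>The equation is cross multiplied and required only off a finite set, because
  \<open>k\<close> is a total function on the plane whose values at a pole or at exceptional points
  carry no information.\<close>

definition moebius_off :: "(complex \<Rightarrow> complex) \<Rightarrow> bool" where
  "moebius_off k \<longleftrightarrow> (\<exists>a b c d. a * d - b * c \<noteq> 0 \<and> finite {z. k z * (c * z + d) \<noteq> a * z + b})"

lemma moebius_offI:
  assumes "a * d - b * c \<noteq> 0" "finite T" "\<And>z. z \<notin> T \<Longrightarrow> k z * (c * z + d) = a * z + b"
  shows "moebius_off k"
proof -
  have "finite {z. k z * (c * z + d) \<noteq> a * z + b}"
    by (rule finite_subset[OF _ assms(2)]) (use assms(3) in blast)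
  then show ?thesis using assms(1) unfolding moebius_off_def by blast
qed

lemma finite_linear_roots:
  fixes a b :: complex
  assumes "a \<noteq> 0 \<or> b \<noteq> 0"
  shows "finite {z. a * z + b = 0}"
proof -
  have "[:b, a:] \<noteq> 0" using assms by auto
  from poly_roots_finite[OF this] show ?thesis by (simp add: algebra_simps)
qed

lemma moebius_off_comp:
  assumes k: "moebius_off k" and h: "moebius_off h"
  shows "moebius_off (\<lambda>z. h (k z))"
proof -
  from k obtain a b c d where k: "a * d - b * c \<noteq> 0" "finite {z. k z * (c * z + d) \<noteq> a * z + b}"
    unfolding moebius_off_def by blast
  from h obtain a' b' c' d' where h: "a' * d' - b' * c' \<noteq> 0" "finite {z. h z * (c' * z + d') \<noteq> a' * z + b'}"
    unfolding moebius_off_def by blast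
  let ?B = "{z. k z * (c * z + d) \<noteq> a * z + b}" and ?B' = "{z. h z * (c' * z + d') \<noteq> a' * z + b'}"
  have fib: "finite {z. z \<notin> ?B \<and> k z = y}" for y
  proof (rule finite_subset)
    show "finite {z. (y * c - a) * z + (y * d - b) = 0}"
      by (rule finite_linear_roots) (use k(1) in \<open>auto simp: algebra_simps\<close>)
    show "{z. z \<notin> ?B \<and> k z = y} \<subseteq> {z. (y * c - a) * z + (y * d - b) = 0}"
      by (auto simp: algebra_simps)
  qed
  have "{z. z \<notin> ?B \<and> k z \<in> ?B'} = (\<Union>y\<in>?B'. {z. z \<notin> ?B \<and> k z = y})" by auto
  then have fin: "finite {z. z \<notin> ?B \<and> k z \<in> ?B'}" using h(2) fib by simp
  show ?thesis
  proof (rule moebius_offI)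
    have "(a' * a + b' * c) * (c' * b + d' * d) - (a' * b + b' * d) * (c' * a + d' * c) = (a' * d' - b' * c') * (a * d - b * c)"
      by (simp add: algebra_simps)
    then show "(a' * a + b' * c) * (c' * b + d' * d) - (a' * b + b' * d) * (c' * a + d' * c) \<noteq> 0"
      using k(1) h(1) by simp
    show "finite (?B \<union> {z. z \<notin> ?B \<and> k z \<in> ?B'})" using k(2) fin by simp
    fix z assume "z \<notin> ?B \<union> {z. z \<notin> ?B \<and> k z \<in> ?B'}"
    then have 1: "k z * (c * z + d) = a * z + b" and 2: "h (k z) * (c' * k z + d') = a' * k z + b'" by auto
    have "h (k z) * (c' * (k z * (c * z + d)) + d' * (c * z + d)) = a' * (k z * (c * z + d)) + b' * (c * z + d)"
      using arg_cong[OF 2, of "\<lambda>x. x * (c * z + d)"] by (simp add: algebra_simps)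
    then show "h (k z) * ((c' * a + d' * c) * z + (c' * b + d' * d)) = (a' * a + b' * c) * z + (a' * b + b' * d)"
      unfolding 1 by (simp add: algebra_simps)
  qed
qed

lemma moebius_off_pow: "moebius_off h \<Longrightarrow> moebius_off (h ^^ n)"
proof (induction n)
  case 0
  show ?case by (rule moebius_offI[of 1 1 0 0 "{}"]) simp_all
next
  case (Suc n)
  then show ?case using moebius_off_comp[of "h ^^ n" h] by (simp add: comp_def)
qed

lemma moebius_off_cong:
  assumes "moebius_off k" "finite T" "\<And>z. z \<notin> T \<Longrightarrow> h z = k z"
  shows "moebius_off h"
proof -
  from assms(1) obtain a b c d where k: "a * d - b * c \<noteq> 0" "finite {z. k z * (c * z + d) \<noteq> a * z + b}"
    unfolding moebius_off_def by blast
  show ?thesis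
    by (rule moebius_offI[OF k(1), of "{z. k z * (c * z + d) \<noteq> a * z + b} \<union> T"]) (use k(2) assms(2,3) in auto)
qed

lemma tendsto_pair_eval:
  assumes "\<And>i. ((\<lambda>t. coeff (fst (F t)) i) \<longlongrightarrow> coeff (fst F0) i) U"
    "\<And>i. ((\<lambda>t. coeff (snd (F t)) i) \<longlongrightarrow> coeff (snd F0) i) U" "(v \<longlongrightarrow> v0) U"
  shows "((\<lambda>t. pair_eval D (F t) (v t)) \<longlongrightarrow> pair_eval D F0 v0) U"
  unfolding pair_eval_def form_eval_def
  by (intro tendsto_Pair tendsto_sum tendsto_mult tendsto_power tendsto_fst tendsto_snd assms)

text \<open>The representatives of the frame on the two sides of an element of
  \<open>rat_conj\<close> may differ. They are proportional, and so are their adjugates, so one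
  fixed \<open>m\<close> computes all values up to scalars.\<close>

lemma rat_conj_elem:
  assumes "V \<in> rat_conj D (proj_class m) f" "m \<in> form_pairs 1"
  obtains H where "H \<in> f" "V \<in> form_pairs D"
    "\<And>v. pair_eval D V v \<in> line_class (pair_eval 1 (pair_adj m) (pair_eval D H (pair_eval 1 m v)))"
proof -
  from assms(1) obtain m1 m2 H where *: "m1 \<in> proj_class m" "m2 \<in> proj_class m" "H \<in> f"
    "V = pair_comp 1 (pair_adj m1) (pair_comp D H m2)"
    unfolding rat_conj_def rat_comp_def by blast
  have m12: "m1 \<in> form_pairs 1" "m2 \<in> form_pairs 1" using * proj_class_form_pairs[OF _ assms(2)] by auto
  have adj: "pair_adj m1 \<in> proj_class (pair_adj m)"
    using *(1) unfolding proj_class_iff by (auto simp: pair_adj_def)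
  have "pair_eval D V v \<in> line_class (pair_eval 1 (pair_adj m) (pair_eval D H (pair_eval 1 m v)))" for v
  proof -
    have "pair_eval D V v = pair_eval 1 (pair_adj m1) (pair_eval D H (pair_eval 1 m2 v))"
      unfolding *(4) by (rule pair_eval_conj(2)[OF m12])
    also have "\<dots> \<in> line_class (pair_eval 1 (pair_adj m1) (pair_eval D H (pair_eval 1 m v)))"
      by (intro pair_eval_line pair_eval_proj *(2))
    also have "\<dots> = line_class (pair_eval 1 (pair_adj m) (pair_eval D H (pair_eval 1 m v)))"
      by (rule line_class_eq[OF pair_eval_proj[OF adj]])
    finally show ?thesis .
  qed
  then show ?thesis using that *(3) pair_eval_conj(1)[OF m12, of D H] unfolding *(4) by blast
qed

text \<open>The moving frame \<open>m\<close> has its bottom row normalised, and is written as \<open>A0 \<circ> K\<close> with an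
  affine frame \<open>A0\<close> and linear maps \<open>K t\<close> that converge to the unitary \<open>K0\<close>.\<close>

locale newton_frame = newton_limit U d P r p s
  for U :: "'a filter" and d P r p s +
  fixes m :: "'a \<Rightarrow> form_pair" and \<gamma> \<delta> :: complex
  assumes m: "\<And>t. m t \<in> form_pairs 1" "\<And>t. pair_det (m t) \<noteq> 0"
    and newton: "\<And>t. newton_point (P t) \<in> rat_maps d"
    and row: "((\<lambda>t. coeff (snd (m t)) 1) \<longlongrightarrow> \<gamma>) U" "((\<lambda>t. coeff (snd (m t)) 0) \<longlongrightarrow> \<delta>) U"
    and unit: "\<gamma> * cnj \<gamma> + \<delta> * cnj \<delta> = 1"
begin

text \<open>Sharing the bottom row with \<open>m t\<close> makes the quotient of the two maps fix
  infinity, so that it is affine. The top row is orthogonal to the limit row, which makes the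
  determinant tend to 1.\<close>

definition K :: "'a \<Rightarrow> form_pair" where
  "K t = ([:- cnj \<gamma>, cnj \<delta>:], snd (m t))"

definition K0 :: form_pair where
  "K0 = ([:- cnj \<gamma>, cnj \<delta>:], [:\<delta>, \<gamma>:])"

definition \<kappa> :: "'a \<Rightarrow> complex" where
  "\<kappa> t = pair_det (K t)"

text \<open>The solution of \<open>m t\<close> = affine map after \<open>K t\<close>; the multiplier
  of the affine map is the quotient of the determinants. The value 1 where
  \<open>\<kappa> t = 0\<close> keeps this a \<open>scale\<close> for every t.\<close>

definition A0 :: "'a scale" where
  "A0 = ((\<lambda>t. (coeff (fst (m t)) 1 * cnj \<gamma> + coeff (fst (m t)) 0 * cnj \<delta>) / \<kappa> t),
    \<lambda>t. if \<kappa> t = 0 then 1 else pair_det (m t) / \<kappa> t)"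

lemma scale_A0: "scale A0"
  using m(2) by (simp add: scale_def A0_def)

lemma kappa_eq: "\<kappa> t = cnj \<delta> * coeff (snd (m t)) 0 + cnj \<gamma> * coeff (snd (m t)) 1"
  by (simp add: \<kappa>_def K_def pair_det_def)

lemma kappa_lim: "(\<kappa> \<longlongrightarrow> 1) U"
proof -
  have "((\<lambda>t. cnj \<delta> * coeff (snd (m t)) 0 + cnj \<gamma> * coeff (snd (m t)) 1) \<longlongrightarrow> cnj \<delta> * \<delta> + cnj \<gamma> * \<gamma>) U"
    by (intro tendsto_add tendsto_mult tendsto_const row)
  moreover have "cnj \<delta> * \<delta> + cnj \<gamma> * \<gamma> = 1" using unit by (simp add: mult.commute add.commute)
  ultimately show ?thesis unfolding kappa_eq[abs_def] by simp
qed

lemma kappa_nonzero: "eventually (\<lambda>t. \<kappa> t \<noteq> 0) U"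
  by (rule tendsto_imp_eventually_ne[OF kappa_lim]) simp

lemma K_eval: "pair_eval 1 (K t) v = (cnj \<delta> * fst v - cnj \<gamma> * snd v, coeff (snd (m t)) 1 * fst v + coeff (snd (m t)) 0 * snd v)"
  unfolding pair_eval_1 by (simp add: K_def)

lemma K0_eval: "pair_eval 1 K0 v = (cnj \<delta> * fst v - cnj \<gamma> * snd v, \<gamma> * fst v + \<delta> * snd v)"
  unfolding pair_eval_1 by (simp add: K0_def)

lemma det_K0: "pair_det K0 = 1"
  using unit by (simp add: pair_det_def K0_def algebra_simps)

lemma m_eval:
  assumes "\<kappa> t \<noteq> 0" "pair_eval 1 (K t) v = (X, Y)"
  shows "pair_eval 1 (m t) v = (fst A0 t * Y + snd A0 t * X, Y)"
proof -
  have X: "X = cnj \<delta> * fst v - cnj \<gamma> * snd v" and Y: "Y = coeff (snd (m t)) 1 * fst v + coeff (snd (m t)) 0 * snd v"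
    using assms(2) unfolding K_eval by auto
  have "\<kappa> t * (coeff (fst (m t)) 1 * fst v + coeff (fst (m t)) 0 * snd v) =
      (coeff (fst (m t)) 1 * cnj \<gamma> + coeff (fst (m t)) 0 * cnj \<delta>) * Y + pair_det (m t) * X"
    unfolding kappa_eq X Y pair_det_def by (simp add: algebra_simps)
  then have "coeff (fst (m t)) 1 * fst v + coeff (fst (m t)) 0 * snd v = fst A0 t * Y + snd A0 t * X"
    using assms(1) by (simp add: A0_def divide_simps mult.commute)
  then show ?thesis unfolding pair_eval_1 Y by simp
qed

lemma K_adj_eval:
  assumes "\<kappa> t \<noteq> 0"
  shows "pair_eval 1 (K t) (pair_eval 1 (pair_adj (m t)) (a, b)) =
    (\<kappa> t * (a - fst A0 t * b), \<kappa> t * snd A0 t * b)"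
proof -
  have "pair_eval 1 (K t) (pair_eval 1 (pair_adj (m t)) (a, b)) =
    (\<kappa> t * a - (coeff (fst (m t)) 1 * cnj \<gamma> + coeff (fst (m t)) 0 * cnj \<delta>) * b, pair_det (m t) * b)"
    unfolding pair_eval_adj K_eval kappa_eq pair_det_def by (simp add: algebra_simps)
  then show ?thesis using assms by (simp add: A0_def right_diff_distrib)
qed

definition frame_coord :: "'a \<Rightarrow> complex \<Rightarrow> complex" where
  "frame_coord t z = (cnj \<delta> * z - cnj \<gamma>) / (coeff (snd (m t)) 1 * z + coeff (snd (m t)) 0)"

definition frame_coord0 :: "complex \<Rightarrow> complex" where
  "frame_coord0 z = (cnj \<delta> * z - cnj \<gamma>) / (\<gamma> * z + \<delta>)"

lemma gamma_delta_nonzero: "\<gamma> \<noteq> 0 \<or> \<delta> \<noteq> 0"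
  using unit by auto

lemma finite_frame_poles: "finite {z. \<gamma> * z + \<delta> = 0}"
  by (rule finite_linear_roots) (rule gamma_delta_nonzero)

lemma frame_coord_lim:
  assumes "\<gamma> * z + \<delta> \<noteq> 0" "(w \<longlongrightarrow> z) U"
  shows "((\<lambda>t. frame_coord t (w t)) \<longlongrightarrow> frame_coord0 z) U"
    and "eventually (\<lambda>t. coeff (snd (m t)) 1 * w t + coeff (snd (m t)) 0 \<noteq> 0) U"
proof -
  show "((\<lambda>t. frame_coord t (w t)) \<longlongrightarrow> frame_coord0 z) U"
    unfolding frame_coord_def frame_coord0_def
    by (intro tendsto_divide tendsto_diff tendsto_add tendsto_mult tendsto_const row assms)
  have "((\<lambda>t. coeff (snd (m t)) 1 * w t + coeff (snd (m t)) 0) \<longlongrightarrow> \<gamma> * z + \<delta>) U"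
    by (intro tendsto_add tendsto_mult row assms)
  then show "eventually (\<lambda>t. coeff (snd (m t)) 1 * w t + coeff (snd (m t)) 0 \<noteq> 0) U"
    using assms(1) by (rule tendsto_imp_eventually_ne)
qed

lemma moebius_frame_coord0: "moebius_off frame_coord0"
proof (rule moebius_offI[of "cnj \<delta>" \<delta> "- cnj \<gamma>" \<gamma>, OF _ finite_frame_poles])
  show "cnj \<delta> * \<delta> - - cnj \<gamma> * \<gamma> \<noteq> 0" using unit by (simp add: algebra_simps)
  fix z assume "z \<notin> {z. \<gamma> * z + \<delta> = 0}"
  then show "frame_coord0 z * (\<gamma> * z + \<delta>) = cnj \<delta> * z + - cnj \<gamma>"
    unfolding frame_coord0_def by simp
qed

text \<open>Where \<open>\<kappa> t\<close> is nonzero, \<open>m t\<close> is \<open>up A0 t\<close>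
  after \<open>frame_coord t\<close> in the affine coordinate. The coordinate of \<open>A0\<close>
  undoes the first of these, and what is left converges with \<open>K t\<close>.\<close>

lemma start_lim: "lim_off U (\<lambda>t z. down A0 t (up A0 t (frame_coord t z))) frame_coord0 {z. \<gamma> * z + \<delta> = 0}"
proof (rule lim_offI[OF finite_frame_poles])
  fix a
  show "finite {z. z \<notin> {z. \<gamma> * z + \<delta> = 0} \<and> frame_coord0 z = a}"
  proof (rule finite_subset)
    have "cnj \<delta> - a * \<gamma> \<noteq> 0 \<or> - cnj \<gamma> - a * \<delta> \<noteq> 0"
    proof (rule ccontr)
      assume "\<not> ?thesis"
      then have "cnj \<delta> - a * \<gamma> = 0" "- cnj \<gamma> - a * \<delta> = 0" by auto
      then have "cnj \<delta> = a * \<gamma>" "cnj \<gamma> = - (a * \<delta>)" by algebra+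
      then show False using unit by (simp add: algebra_simps)
    qed
    then show "finite {z. (cnj \<delta> - a * \<gamma>) * z + (- cnj \<gamma> - a * \<delta>) = 0}" by (rule finite_linear_roots)
    show "{z. z \<notin> {z. \<gamma> * z + \<delta> = 0} \<and> frame_coord0 z = a} \<subseteq> {z. (cnj \<delta> - a * \<gamma>) * z + (- cnj \<gamma> - a * \<delta>) = 0}"
    proof
      fix z assume "z \<in> {z. z \<notin> {z. \<gamma> * z + \<delta> = 0} \<and> frame_coord0 z = a}"
      then have "cnj \<delta> * z - cnj \<gamma> = a * (\<gamma> * z + \<delta>)" by (auto simp: frame_coord0_def)
      then show "z \<in> {z. (cnj \<delta> - a * \<gamma>) * z + (- cnj \<gamma> - a * \<delta>) = 0}"
        by (simp add: algebra_simps)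
    qed
  qed
next
  fix z and w :: "'a \<Rightarrow> complex" assume "z \<notin> {z. \<gamma> * z + \<delta> = 0}" "(w \<longlongrightarrow> z) U"
  then show "((\<lambda>t. down A0 t (up A0 t (frame_coord t (w t)))) \<longlongrightarrow> frame_coord0 z) U"
    using frame_coord_lim(1) scale_A0 by simp
qed

definition regular :: "nat \<Rightarrow> 'a \<Rightarrow> complex \<Rightarrow> bool" where
  "regular n t z \<longleftrightarrow> (\<forall>i<n. poly (pderiv (P t)) (newt_iter i t z) \<noteq> 0)"

text \<open>Since \<open>m t\<close> is \<open>A0\<close> after \<open>K t\<close>, conjugation by
  \<open>m t\<close>, seen in the coordinate given by \<open>K t\<close>, is conjugation by the
  affine \<open>A0\<close>. A finite value in this coordinate is a finite value of the iterate,
  whence regularity.\<close>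

lemma conj_elem_eval:
  assumes V: "V \<in> rat_conj (d ^ n) (proj_class (m t)) (rat_iter d (newton_point (P t)) n)" and \<kappa>: "\<kappa> t \<noteq> 0"
  shows "V \<in> form_pairs (d ^ n)"
    and "v \<noteq> (0, 0) \<Longrightarrow> pair_eval (d ^ n) V v \<noteq> (0, 0)"
    and "pair_eval 1 (K t) v = (X, Y) \<Longrightarrow> Y \<noteq> 0 \<Longrightarrow> regular n t (up A0 t (X / Y)) \<Longrightarrow>
      pair_eval 1 (K t) (pair_eval (d ^ n) V v) \<in> line_class (down A0 t (newt_iter n t (up A0 t (X / Y))), 1)"
    and "pair_eval 1 (K t) v = (X, Y) \<Longrightarrow> Y \<noteq> 0 \<Longrightarrow> snd (pair_eval 1 (K t) (pair_eval (d ^ n) V v)) \<noteq> 0 \<Longrightarrow>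
      regular n t (up A0 t (X / Y))"
proof -
  from V m(1) obtain H where H: "H \<in> rat_iter d (newton_point (P t)) n" "V \<in> form_pairs (d ^ n)" and
    ev: "\<And>v. pair_eval (d ^ n) V v \<in> line_class (pair_eval 1 (pair_adj (m t)) (pair_eval (d ^ n) H (pair_eval 1 (m t) v)))"
    by (rule rat_conj_elem) blast
  have dP: "degree (P t) = d" unfolding P by (simp add: degree_root_prod)
  note it = newton_iterate_eval[OF dP newton[of t, unfolded newton_point_def] H(1)[unfolded newton_point_def]]
  show "V \<in> form_pairs (d ^ n)" by fact
  show "pair_eval (d ^ n) V v \<noteq> (0, 0)" if v: "v \<noteq> (0, 0)"
  proof -
    have "pair_eval 1 (m t) v \<noteq> (0, 0)" using pair_eval_linear_eq_0[OF m(2)] v by blast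
    then have "pair_eval (d ^ n) H (pair_eval 1 (m t) v) \<noteq> (0, 0)" by (rule it(2))
    moreover have "pair_det (pair_adj (m t)) \<noteq> 0" using m(2) by (simp add: pair_det_adj)
    ultimately have "pair_eval 1 (pair_adj (m t)) (pair_eval (d ^ n) H (pair_eval 1 (m t) v)) \<noteq> (0, 0)"
      using pair_eval_linear_eq_0 by blast
    then show ?thesis using line_class_zero[OF ev] by blast
  qed
  define w where "w = pair_eval (d ^ n) H (pair_eval 1 (m t) v)"
  have Kw: "pair_eval 1 (K t) (pair_eval (d ^ n) V v) \<in> line_class (\<kappa> t * (fst w - fst A0 t * snd w), \<kappa> t * snd A0 t * snd w)"
    using pair_eval_line[OF ev[of v], of 1 "K t"] K_adj_eval[OF \<kappa>, of "fst w" "snd w"] by (simp add: w_def)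
  have mz: "pair_eval 1 (m t) v \<in> line_class (up A0 t (X / Y), 1)" if "pair_eval 1 (K t) v = (X, Y)" "Y \<noteq> 0"
    unfolding m_eval[OF \<kappa> that(1)] line_class_iff
    by (rule exI[of _ Y]) (use that(2) in \<open>simp add: up_def field_simps\<close>)
  show "pair_eval 1 (K t) (pair_eval (d ^ n) V v) \<in> line_class (down A0 t (newt_iter n t (up A0 t (X / Y))), 1)"
    if K: "pair_eval 1 (K t) v = (X, Y)" "Y \<noteq> 0" and reg: "regular n t (up A0 t (X / Y))"
  proof -
    have "w \<in> line_class (newt_iter n t (up A0 t (X / Y)), 1)"
      unfolding w_def by (rule it(3)[OF mz[OF K]]) (use reg in \<open>simp add: regular_def\<close>)
    then obtain c where c: "c \<noteq> 0" "fst w = c * newt_iter n t (up A0 t (X / Y))" "snd w = c" by (auto simp: line_class_iff)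
    have "(\<kappa> t * (fst w - fst A0 t * snd w), \<kappa> t * snd A0 t * snd w) \<in> line_class (down A0 t (newt_iter n t (up A0 t (X / Y))), 1)"
      unfolding line_class_iff
      by (rule exI[of _ "\<kappa> t * snd A0 t * c"])
         (use c \<kappa> scaleD[OF scale_A0, of t] in \<open>simp add: down_def field_simps\<close>)
    then show ?thesis using Kw line_class_trans by blast
  qed
  show "regular n t (up A0 t (X / Y))"
    if K: "pair_eval 1 (K t) v = (X, Y)" "Y \<noteq> 0" and s: "snd (pair_eval 1 (K t) (pair_eval (d ^ n) V v)) \<noteq> 0"
  proof -
    have "snd w \<noteq> 0" using s Kw by (auto simp: line_class_iff)
    then show ?thesis using it(4)[OF mz[OF K]] unfolding w_def regular_def by blast
  qed
qed

definition limit_value :: "nat \<Rightarrow> form_pair \<Rightarrow> complex \<Rightarrow> complex \<times> complex" where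
  "limit_value D V z = pair_eval 1 K0 (pair_eval D V (z, 1))"

lemma tendsto_limit_value:
  assumes "\<And>i. ((\<lambda>t. coeff (fst (V t)) i) \<longlongrightarrow> coeff (fst V0) i) U"
    "\<And>i. ((\<lambda>t. coeff (snd (V t)) i) \<longlongrightarrow> coeff (snd V0) i) U" "(w \<longlongrightarrow> z) U"
  shows "((\<lambda>t. pair_eval 1 (K t) (pair_eval D (V t) (w t, 1))) \<longlongrightarrow> limit_value D V0 z) U"
proof -
  have l: "((\<lambda>t. pair_eval D (V t) (w t, 1)) \<longlongrightarrow> pair_eval D V0 (z, 1)) U"
    by (intro tendsto_pair_eval assms tendsto_Pair tendsto_const)
  show ?thesis unfolding limit_value_def K_eval K0_eval
    by (intro tendsto_Pair tendsto_add tendsto_diff tendsto_mult tendsto_const tendsto_fst[OF l] tendsto_snd[OF l] row)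
qed

text \<open>Both alternatives give a regular orbit: the second outright, the first because an orbit
  with a finite value has met no critical point. The first serves where the limit value is known to
  be finite, the second where the orbit itself is controlled.\<close>

lemma conj_family_lim:
  assumes V: "eventually (\<lambda>t. V t \<in> rat_conj (d ^ n) (proj_class (m t)) (rat_iter d (newton_point (P t)) n)) U"
    and lim: "\<And>i. ((\<lambda>t. coeff (fst (V t)) i) \<longlongrightarrow> coeff (fst V0) i) U"
      "\<And>i. ((\<lambda>t. coeff (snd (V t)) i) \<longlongrightarrow> coeff (snd V0) i) U"
    and z: "\<gamma> * z + \<delta> \<noteq> 0" and w: "(w \<longlongrightarrow> z) U"
  shows "eventually (\<lambda>t. snd (pair_eval 1 (K t) (pair_eval (d ^ n) (V t) (w t, 1))) \<noteq> 0 \<or>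
      regular n t (up A0 t (frame_coord t (w t))) \<longrightarrow>
      fst (pair_eval 1 (K t) (pair_eval (d ^ n) (V t) (w t, 1))) =
      down A0 t (newt_iter n t (up A0 t (frame_coord t (w t)))) * snd (pair_eval 1 (K t) (pair_eval (d ^ n) (V t) (w t, 1)))) U"
  using V kappa_nonzero frame_coord_lim(2)[OF z w]
proof eventually_elim
  case (elim t)
  define X Y where "X = cnj \<delta> * w t - cnj \<gamma>" and "Y = coeff (snd (m t)) 1 * w t + coeff (snd (m t)) 0"
  have XY: "pair_eval 1 (K t) (w t, 1) = (X, Y)" by (simp add: K_eval[unfolded One_nat_def] X_def Y_def)
  have Y: "Y \<noteq> 0" using elim(3) by (simp add: Y_def)
  have fc: "frame_coord t (w t) = X / Y" by (simp add: frame_coord_def X_def Y_def)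
  show ?case
  proof
    assume *: "snd (pair_eval 1 (K t) (pair_eval (d ^ n) (V t) (w t, 1))) \<noteq> 0 \<or> regular n t (up A0 t (frame_coord t (w t)))"
    have "regular n t (up A0 t (X / Y))"
      using * conj_elem_eval(4)[OF elim(1,2) XY Y] unfolding fc by blast
    from conj_elem_eval(3)[OF elim(1,2) XY Y this]
    show "fst (pair_eval 1 (K t) (pair_eval (d ^ n) (V t) (w t, 1))) =
      down A0 t (newt_iter n t (up A0 t (frame_coord t (w t)))) * snd (pair_eval 1 (K t) (pair_eval (d ^ n) (V t) (w t, 1)))"
      unfolding fc line_class_iff by auto
  qed
qed

text \<open>In the coordinate of \<open>K0\<close> the limit is the quotient of two independent
  combinations \<open>R1\<close>, \<open>R2\<close> of the limit forms. If it were a constant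
  \<open>a\<close>, then \<open>R1 = smult a R2\<close> would be a relation between the forms of
  \<open>V0\<close>, which \<open>indep\<close> forbids.\<close>

lemma return_lim:
  assumes V: "eventually (\<lambda>t. V t \<in> rat_conj (d ^ n) (proj_class (m t)) (rat_iter d (newton_point (P t)) n)) U"
    and lim: "\<And>i. ((\<lambda>t. coeff (fst (V t)) i) \<longlongrightarrow> coeff (fst V0) i) U"
      "\<And>i. ((\<lambda>t. coeff (snd (V t)) i) \<longlongrightarrow> coeff (snd V0) i) U"
    and V0: "V0 \<in> form_pairs (d ^ n)"
    and indep: "\<And>a b. smult a (fst V0) + smult b (snd V0) = 0 \<Longrightarrow> a = 0 \<and> b = 0"
  shows "\<exists>S. lim_off U (\<lambda>t z. down A0 t (newt_iter n t (up A0 t (frame_coord t z))))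
     (\<lambda>z. fst (limit_value (d ^ n) V0 z) / snd (limit_value (d ^ n) V0 z)) S \<and>
     (\<forall>z. z \<notin> S \<longrightarrow> snd (limit_value (d ^ n) V0 z) \<noteq> 0)"
proof -
  have ev: "pair_eval (d ^ n) V0 (z, 1) = (poly (fst V0) z, poly (snd V0) z)" for z
    using form_pairsD[OF V0] by (simp add: pair_eval_def form_eval_poly)
  define R1 where "R1 = smult (cnj \<delta>) (fst V0) + smult (- cnj \<gamma>) (snd V0)"
  define R2 where "R2 = smult \<gamma> (fst V0) + smult \<delta> (snd V0)"
  have lv: "limit_value (d ^ n) V0 z = (poly R1 z, poly R2 z)" for z
    unfolding limit_value_def K0_eval ev by (simp add: R1_def R2_def)
  have R2: "R2 \<noteq> 0" unfolding R2_def using indep[of \<gamma> \<delta>] gamma_delta_nonzero by blast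
  have R12: "R1 - smult a R2 \<noteq> 0" for a
  proof
    assume "R1 - smult a R2 = 0"
    then have "smult (cnj \<delta> - a * \<gamma>) (fst V0) + smult (- cnj \<gamma> - a * \<delta>) (snd V0) = 0"
      by (simp add: R1_def R2_def smult_add_right smult_diff_left algebra_simps)
    from indep[OF this] have "cnj \<delta> - a * \<gamma> = 0" "- cnj \<gamma> - a * \<delta> = 0" by auto
    then have "cnj \<delta> = a * \<gamma>" "cnj \<gamma> = - (a * \<delta>)" by algebra+
    then show False using unit by (simp add: algebra_simps)
  qed
  define S where "S = {z. \<gamma> * z + \<delta> = 0} \<union> {z. poly R2 z = 0}"
  have "lim_off U (\<lambda>t z. down A0 t (newt_iter n t (up A0 t (frame_coord t z)))) (\<lambda>z. poly R1 z / poly R2 z) S"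
  proof (rule lim_offI)
    show "finite S" using finite_frame_poles poly_roots_finite[OF R2] by (simp add: S_def)
    show "finite {z. z \<notin> S \<and> poly R1 z / poly R2 z = a}" for a
      by (rule finite_subset[OF _ poly_roots_finite[OF R12[of a]]]) (auto simp: S_def field_simps)
    fix z and w :: "'a \<Rightarrow> complex" assume z: "z \<notin> S" and w: "(w \<longlongrightarrow> z) U"
    let ?E = "\<lambda>t. pair_eval 1 (K t) (pair_eval (d ^ n) (V t) (w t, 1))"
    have E: "(?E \<longlongrightarrow> (poly R1 z, poly R2 z)) U" using tendsto_limit_value[OF lim w, of "d ^ n"] unfolding lv .
    have z': "poly R2 z \<noteq> 0" "\<gamma> * z + \<delta> \<noteq> 0" using z by (auto simp: S_def)
    have "((\<lambda>t. fst (?E t) / snd (?E t)) \<longlongrightarrow> poly R1 z / poly R2 z) U"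
      using tendsto_divide[OF tendsto_fst[OF E] tendsto_snd[OF E]] z' by simp
    moreover have "eventually (\<lambda>t. snd (?E t) \<noteq> 0) U"
      by (rule tendsto_imp_eventually_ne[OF tendsto_snd[OF E]]) (use z' in simp)
    then have "eventually (\<lambda>t. fst (?E t) / snd (?E t) = down A0 t (newt_iter n t (up A0 t (frame_coord t (w t))))) U"
      using conj_family_lim[OF V lim z'(2) w]
      by eventually_elim (simp add: field_simps)
    ultimately show "((\<lambda>t. down A0 t (newt_iter n t (up A0 t (frame_coord t (w t))))) \<longlongrightarrow> poly R1 z / poly R2 z) U"
      by (rule Lim_transform_eventually)
  qed
  moreover have "\<forall>z. z \<notin> S \<longrightarrow> poly R2 z \<noteq> 0" by (simp add: S_def)
  ultimately show ?thesis unfolding lv by auto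
qed

lemma regular_off_finite:
  assumes "scale A"
  shows "\<exists>T. finite T \<and> (\<forall>z w. z \<notin> T \<longrightarrow> (w \<longlongrightarrow> z) U \<longrightarrow> eventually (\<lambda>t. poly (pderiv (P t)) (up A t (w t)) \<noteq> 0) U)"
proof -
  define T where "T = (\<lambda>j. nlim U A (\<lambda>t. p t j)) ` near_set U A {..<d - 1} p"
  have "finite T" by (simp add: T_def near_set_def)
  moreover have "eventually (\<lambda>t. poly (pderiv (P t)) (up A t (w t)) \<noteq> 0) U" if "z \<notin> T" "(w \<longlongrightarrow> z) U" for z w
  proof -
    have "eventually (\<lambda>t. poly (root_prod {..<d - 1} (p t)) (up A t (w t)) \<noteq> 0) U"
      by (rule logderiv_tendsto(2)[OF U assms finite_lessThan _ that(2)]) (use that(1) in \<open>auto simp: T_def\<close>)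
    then show ?thesis unfolding P' using d by (auto elim!: eventually_mono)
  qed
  ultimately show ?thesis by blast
qed

text \<open>After removal of \<open>H\<close> the coefficient limit of the first conjugate is
  linear, so off a finite set \<open>h\<close> is a quotient of linear forms in suitable
  coordinates. As \<open>h\<close> has finite fibres, these forms are independent; hence
  \<open>h\<close> is Moebius, and so are its iterates.\<close>

lemma moebius_iterate_limits:
  assumes h: "lim_off U (\<lambda>t z. down A0 t (newt (P t) (up A0 t z))) h S"
    and V: "eventually (\<lambda>t. V t \<in> rat_conj (d ^ 1) (proj_class (m t)) (rat_iter d (newton_point (P t)) 1)) U"
    and lim: "\<And>i. ((\<lambda>t. coeff (fst (V t)) i) \<longlongrightarrow> coeff (fst V0) i) U"
      "\<And>i. ((\<lambda>t. coeff (snd (V t)) i) \<longlongrightarrow> coeff (snd V0) i) U"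
    and V0: "V0 \<in> form_pairs (d ^ 1)" "V0 = (H * A, H * B)" "V0 \<noteq> (0, 0)" "degree A \<le> 1" "degree B \<le> 1"
  obtains k T where "lim_off U (\<lambda>t z. down A0 t (newt_iter n t (up A0 t (frame_coord t z)))) k T" "moebius_off k"
proof -
  have H0: "H \<noteq> 0" using V0(2,3) by auto
  define L1 where "L1 = smult (cnj \<delta>) A + smult (- cnj \<gamma>) B"
  define L2 where "L2 = smult \<gamma> A + smult \<delta> B"
  have lv: "limit_value (d ^ 1) V0 z = (poly H z * poly L1 z, poly H z * poly L2 z)" for z
  proof -
    have "pair_eval (d ^ 1) V0 (z, 1) = (poly (fst V0) z, poly (snd V0) z)"
      using form_pairsD[OF V0(1)] by (simp add: pair_eval_def form_eval_poly)
    then show ?thesis unfolding limit_value_def K0_eval using V0(2)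
      by (simp add: L1_def L2_def algebra_simps)
  qed
  have AB: "A = smult \<delta> L1 + smult (cnj \<gamma>) L2" "B = smult (- \<gamma>) L1 + smult (cnj \<delta>) L2"
  proof -
    have "smult \<delta> L1 + smult (cnj \<gamma>) L2 = smult (\<gamma> * cnj \<gamma> + \<delta> * cnj \<delta>) A"
      by (simp add: L1_def L2_def smult_add_right smult_diff_right smult_add_left algebra_simps)
    then show "A = smult \<delta> L1 + smult (cnj \<gamma>) L2" using unit by simp
    have "smult (- \<gamma>) L1 + smult (cnj \<delta>) L2 = smult (\<gamma> * cnj \<gamma> + \<delta> * cnj \<delta>) B"
      by (simp add: L1_def L2_def smult_add_right smult_diff_right smult_add_left algebra_simps)
    then show "B = smult (- \<gamma>) L1 + smult (cnj \<delta>) L2" using unit by simp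
  qed
  have hk: "lim_off U (\<lambda>t z. down A0 t (newt (P t) (up A0 t (frame_coord t z)))) (h \<circ> frame_coord0)
     ({z. \<gamma> * z + \<delta> = 0} \<union> {z. z \<notin> {z. \<gamma> * z + \<delta> = 0} \<and> frame_coord0 z \<in> S})"
    using lim_off_comp[OF start_lim h] scale_A0 by simp
  define S1 where "S1 = {z. \<gamma> * z + \<delta> = 0} \<union> {z. z \<notin> {z. \<gamma> * z + \<delta> = 0} \<and> frame_coord0 z \<in> S}"
  obtain T where T: "finite T" "\<And>z w. z \<notin> T \<Longrightarrow> (w \<longlongrightarrow> z) U \<Longrightarrow> eventually (\<lambda>t. poly (pderiv (P t)) (up A0 t (w t)) \<noteq> 0) U"
    using regular_off_finite[OF scale_A0] by blast
  define S2 where "S2 = S1 \<union> {z. z \<notin> {z. \<gamma> * z + \<delta> = 0} \<and> frame_coord0 z \<in> T} \<union> {z. poly H z = 0}"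
  have "finite {z. z \<notin> {z. \<gamma> * z + \<delta> = 0} \<and> frame_coord0 z \<in> T}"
  proof -
    have "{z. z \<notin> {z. \<gamma> * z + \<delta> = 0} \<and> frame_coord0 z \<in> T} = (\<Union>a\<in>T. {z. z \<notin> {z. \<gamma> * z + \<delta> = 0} \<and> frame_coord0 z = a})" by auto
    then show ?thesis using T(1) lim_off_fibre[OF start_lim] by simp
  qed
  then have fS2: "finite S2"
    using lim_off_finite[OF hk] poly_roots_finite[OF H0] by (simp add: S2_def S1_def)
  have eq: "poly L1 z = h (frame_coord0 z) * poly L2 z" if z: "z \<notin> S2" for z
  proof -
    have z': "\<gamma> * z + \<delta> \<noteq> 0" "frame_coord0 z \<notin> T" "poly H z \<noteq> 0" "z \<notin> S1"
      using z by (auto simp: S2_def S1_def)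
    let ?E = "\<lambda>t. pair_eval 1 (K t) (pair_eval (d ^ 1) (V t) (z, 1))"
    have E: "(?E \<longlongrightarrow> (poly H z * poly L1 z, poly H z * poly L2 z)) U"
      using tendsto_limit_value[OF lim tendsto_const[of z], of "d ^ 1"] unfolding lv .
    have phi: "((\<lambda>t. down A0 t (newt (P t) (up A0 t (frame_coord t z)))) \<longlongrightarrow> h (frame_coord0 z)) U"
      using lim_offD[OF hk z'(4)[unfolded S1_def] tendsto_const] by simp
    have "eventually (\<lambda>t. poly (pderiv (P t)) (up A0 t (frame_coord t z)) \<noteq> 0) U"
      by (rule T(2)[OF z'(2) frame_coord_lim(1)[OF z'(1) tendsto_const]])
    then have "eventually (\<lambda>t. down A0 t (newt (P t) (up A0 t (frame_coord t z))) * snd (?E t) = fst (?E t)) U"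
      using conj_family_lim[OF V lim z'(1) tendsto_const[of z]]
      by eventually_elim (simp add: regular_def)
    from Lim_transform_eventually[OF tendsto_mult[OF phi tendsto_snd[OF E]] this]
    have "h (frame_coord0 z) * (poly H z * poly L2 z) = poly H z * poly L1 z"
      using tendsto_unique[OF ultra_neq_bot[OF U] _ tendsto_fst[OF E]] by simp
    then show ?thesis using z'(3) by simp
  qed
  have lin: "poly L z = coeff L 1 * z + coeff L 0" if "degree L \<le> 1" for L :: "complex poly" and z
    using poly_eq_sum_le[OF that, of z] by simp
  have dL: "degree L1 \<le> 1" "degree L2 \<le> 1"
    unfolding L1_def L2_def
    by (intro degree_add_le order_trans[OF degree_smult_le] V0(4,5))+
  \<comment> \<open>\<open>L2 = 0\<close> would force \<open>V0\<close> to vanish; any other linear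
    relation would make \<open>h\<close> after \<open>frame_coord0\<close> constant off a finite
    set, against its finite fibres.\<close>
  have indep: "x = 0 \<and> y = 0" if xy: "smult x L1 + smult y L2 = 0" for x y
  proof -
    have L2: "L2 \<noteq> 0"
    proof
      assume "L2 = 0"
      then have "poly L1 z = 0" if "z \<notin> S2" for z using eq[OF that] by simp
      then have "{z. poly L1 z \<noteq> 0} \<subseteq> S2" by blast
      then have "finite {z. poly L1 z \<noteq> 0}" using fS2 by (rule finite_subset)
      moreover have "finite {z. poly L1 z = 0}" if "L1 \<noteq> 0" using that by (rule poly_roots_finite)
      moreover have "(UNIV :: complex set) = {z. poly L1 z \<noteq> 0} \<union> {z. poly L1 z = 0}" by blast
      ultimately have "L1 = 0" by (metis finite_UnI infinite_UNIV_char_0)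
      then show False using AB \<open>L2 = 0\<close> V0(2,3) by simp
    qed
    have inf: "infinite (- (S2 \<union> {z. poly L2 z = 0}))"
      using fS2 poly_roots_finite[OF L2] by (simp add: infinite_UNIV_char_0 Compl_eq_Diff_UNIV)
    have c: "x * h (frame_coord0 z) + y = 0" if "z \<in> - (S2 \<union> {z. poly L2 z = 0})" for z
    proof -
      have "poly (smult x L1 + smult y L2) z = 0" using xy by simp
      then have "(x * h (frame_coord0 z) + y) * poly L2 z = 0" using eq[of z] that by (simp add: algebra_simps)
      then show ?thesis using that by simp
    qed
    have "x = 0"
    proof (rule ccontr)
      assume x: "x \<noteq> 0"
      have "- (S2 \<union> {z. poly L2 z = 0}) \<subseteq> {z. z \<notin> S1 \<and> (h \<circ> frame_coord0) z = - y / x}"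
      proof
        fix z assume z: "z \<in> - (S2 \<union> {z. poly L2 z = 0})"
        then have "z \<notin> S1" by (simp add: S2_def)
        moreover have "h (frame_coord0 z) = - y / x" using c[OF z] x by (simp add: field_simps eq_neg_iff_add_eq_0)
        ultimately show "z \<in> {z. z \<notin> S1 \<and> (h \<circ> frame_coord0) z = - y / x}" by simp
      qed
      then show False using lim_off_fibre[OF hk] inf finite_subset unfolding S1_def by blast
    qed
    moreover from inf obtain z where "z \<in> - (S2 \<union> {z. poly L2 z = 0})" by (metis ex_in_conv finite.emptyI)
    ultimately show ?thesis using c[of z] by simp
  qed
  have det: "coeff L1 1 * coeff L2 0 - coeff L1 0 * coeff L2 1 \<noteq> 0"
  proof
    assume 0: "coeff L1 1 * coeff L2 0 - coeff L1 0 * coeff L2 1 = 0"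
    have z: "smult (coeff L2 i) L1 + smult (- coeff L1 i) L2 = 0" if "i \<le> 1" for i
    proof (rule poly_eqI)
      fix j
      show "coeff (smult (coeff L2 i) L1 + smult (- coeff L1 i) L2) j = coeff 0 j"
      proof (cases "j \<le> 1")
        case True
        then show ?thesis using 0 that by (cases i; cases j) (auto simp: algebra_simps)
      next
        case False
        then show ?thesis using dL by (simp add: coeff_eq_0)
      qed
    qed
    have "coeff L2 i = 0 \<and> coeff L1 i = 0" if "i \<le> 1" for i using indep[OF z[OF that]] by simp
    then have "lead_coeff L2 = 0" using dL(2) by blast
    then have "L2 = 0" by simp
    then show False using indep[of 0 1] by simp
  qed
  have hk_moebius: "moebius_off (\<lambda>z. h (frame_coord0 z))"
    by (rule moebius_offI[OF det fS2]) (use eq lin dL in metis)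
  \<comment> \<open>The inverse of \<open>frame_coord0\<close>, by which \<open>h\<close> itself is
    recovered from its composite with \<open>frame_coord0\<close>.\<close>
  have inv_moebius: "moebius_off (\<lambda>z. (\<delta> * z + cnj \<gamma>) / (- \<gamma> * z + cnj \<delta>))"
  proof (rule moebius_offI[of \<delta> "cnj \<delta>" "cnj \<gamma>" "- \<gamma>" "{z. - \<gamma> * z + cnj \<delta> = 0}"])
    show "\<delta> * cnj \<delta> - cnj \<gamma> * - \<gamma> \<noteq> 0" using unit by (simp add: algebra_simps)
    show "finite {z. - \<gamma> * z + cnj \<delta> = 0}"
      by (rule finite_linear_roots) (use gamma_delta_nonzero in auto)
    fix z assume "z \<notin> {z. - \<gamma> * z + cnj \<delta> = 0}"
    then have "- \<gamma> * z + cnj \<delta> \<noteq> 0" by blast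
    then show "(\<delta> * z + cnj \<gamma>) / (- \<gamma> * z + cnj \<delta>) * (- \<gamma> * z + cnj \<delta>) = \<delta> * z + cnj \<gamma>"
      by (rule nonzero_eq_divide_eq[THEN iffD1]) (rule refl)
  qed
  have inv: "frame_coord0 ((\<delta> * z + cnj \<gamma>) / (- \<gamma> * z + cnj \<delta>)) = z" if z: "- \<gamma> * z + cnj \<delta> \<noteq> 0" for z
  proof -
    let ?q = "- \<gamma> * z + cnj \<delta>"
    have gen: "a * (x / q) + b = (a * x + b * q) / q" "a * (x / q) - b = (a * x - b * q) / q"
      if "q \<noteq> 0" for a b x q :: complex
      using that by (simp_all add: field_simps)
    have "\<gamma> * ((\<delta> * z + cnj \<gamma>) / ?q) + \<delta> = (\<gamma> * (\<delta> * z + cnj \<gamma>) + \<delta> * ?q) / ?q"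
      by (rule gen(1)[OF z])
    also have "\<gamma> * (\<delta> * z + cnj \<gamma>) + \<delta> * ?q = 1" using unit by (simp add: algebra_simps)
    finally have 1: "\<gamma> * ((\<delta> * z + cnj \<gamma>) / ?q) + \<delta> = 1 / ?q" .
    have "cnj \<delta> * ((\<delta> * z + cnj \<gamma>) / ?q) - cnj \<gamma> = (cnj \<delta> * (\<delta> * z + cnj \<gamma>) - cnj \<gamma> * ?q) / ?q"
      by (rule gen(2)[OF z])
    also have "cnj \<delta> * (\<delta> * z + cnj \<gamma>) - cnj \<gamma> * ?q = z * (\<gamma> * cnj \<gamma> + \<delta> * cnj \<delta>)" by (simp add: algebra_simps)
    finally have 2: "cnj \<delta> * ((\<delta> * z + cnj \<gamma>) / ?q) - cnj \<gamma> = z / ?q" using unit by simp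
    show ?thesis unfolding frame_coord0_def 1 2 using z by simp
  qed
  have "moebius_off h"
  proof (rule moebius_off_cong[OF moebius_off_comp[OF inv_moebius hk_moebius]])
    show "finite {z. - \<gamma> * z + cnj \<delta> = 0}"
      by (rule finite_linear_roots) (use gamma_delta_nonzero in auto)
    fix z assume "z \<notin> {z. - \<gamma> * z + cnj \<delta> = 0}"
    then show "h z = h (frame_coord0 ((\<delta> * z + cnj \<gamma>) / (- \<gamma> * z + cnj \<delta>)))" using inv[of z] by simp
  qed
  have "\<exists>T. lim_off U (\<lambda>t z. down A0 t (newt_iter n t (up A0 t (frame_coord t z)))) ((h ^^ n) \<circ> frame_coord0) T"
  proof (induction n)
    case 0
    then show ?case using start_lim by auto
  next
    case (Suc n)
    then obtain T where "lim_off U (\<lambda>t z. down A0 t (newt_iter n t (up A0 t (frame_coord t z)))) ((h ^^ n) \<circ> frame_coord0) T" ..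
    from lim_off_comp[OF this h] scale_A0 show ?case by (auto simp: comp_def)
  qed
  moreover have "moebius_off ((h ^^ n) \<circ> frame_coord0)"
    using moebius_off_comp[OF moebius_frame_coord0 moebius_off_pow[OF \<open>moebius_off h\<close>]] by (simp add: comp_def)
  ultimately show ?thesis using that by blast
qed

end

text \<open>Eliminating \<open>F0\<close> and \<open>G0\<close> gives
  \<open>G * L1 = F * L2\<close>. As \<open>L1\<close> and \<open>L2\<close> have no common zero,
  they divide \<open>F\<close> and \<open>G\<close> with the same cofactor, of degree at most e - 1:
  a common factor of positive formal degree, which coprimality excludes.\<close>

lemma no_moebius_ratio:
  assumes g: "g \<in> rat_maps e" "(F, G) \<in> g" and e: "2 \<le> e"
    and nz: "F0 \<noteq> 0 \<or> G0 \<noteq> 0" and eq: "F0 * G = G0 * F" and mo: "F0 * L2 = G0 * L1"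
    and dL: "degree L1 \<le> 1" "degree L2 \<le> 1"
    and det: "coeff L1 1 * coeff L2 0 - coeff L1 0 * coeff L2 1 \<noteq> 0"
  shows False
proof -
  note gFG = rat_maps_rep[OF g]
  have dFG: "degree F \<le> e" "degree G \<le> e" using gFG(1) by (auto simp: form_pairs_def)
  have "F0 * (G * L1) = F0 * (F * L2)" "G0 * (G * L1) = G0 * (F * L2)" using eq mo by algebra+
  then have GF: "G * L1 = F * L2" using nz by (metis mult_left_cancel)
  have lin: "L = [:coeff L 0, coeff L 1:]" if "degree L \<le> 1" for L :: "complex poly"
  proof (rule poly_eqI)
    fix n
    show "coeff L n = coeff [:coeff L 0, coeff L 1:] n"
    proof (cases "n \<le> 1")
      case True
      then show ?thesis by (cases n) auto
    next
      case False
      then have "coeff L n = 0" "n \<noteq> 0" "n \<noteq> 1" using that by (simp_all add: coeff_eq_0)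
      then show ?thesis by (cases n) (auto simp: coeff_pCons split: nat.split)
    qed
  qed
  have "\<exists>C. degree C \<le> e - 1 \<and> F = C * L1 \<and> G = C * L2"
  \<comment> \<open>The zero of \<open>L2\<close> is infinity in the first case and finite in the
    second. The degree bound on the cofactor comes from \<open>F\<close> in the first case and from
    \<open>G\<close> in the second, where the linear divisor has exact degree 1.\<close>
  proof (cases "coeff L2 1 = 0")
    case True
    define b where "b = coeff L2 0"
    have L2: "L2 = [:b:]" using lin[OF dL(2)] True by (simp add: b_def)
    have b: "b \<noteq> 0" "coeff L1 1 \<noteq> 0" using det True by (auto simp: b_def)
    define C where "C = smult (1 / b) G"
    have GC: "G = C * L2" using b by (simp add: C_def L2)
    have "F * L2 = (C * L1) * L2" using GF unfolding GC by algebra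
    then have FC: "F = C * L1" using b L2 by (metis mult_right_cancel pCons_eq_0_iff)
    have "degree C \<le> e - 1"
    proof (cases "C = 0")
      case False
      have "degree L1 = 1" using b(2) dL(1) le_degree[of L1 1] by simp
      then have "degree F = Suc (degree C)" using False unfolding FC by (subst degree_mult_eq) auto
      then show ?thesis using dFG(1) by simp
    qed simp
    then show ?thesis using GC FC by blast
  next
    case False
    define a where "a = coeff L2 1"
    define z where "z = - coeff L2 0 / a"
    have a: "a \<noteq> 0" using False by (simp add: a_def)
    have L2: "L2 = smult a [:- z, 1:]" using lin[OF dL(2)] a by (simp add: z_def a_def)
    have "poly L1 z = coeff L1 1 * z + coeff L1 0"
      by (subst lin[OF dL(1)]) (simp add: mult.commute)
    moreover have "a * z = - coeff L2 0" using a by (simp add: z_def)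
    ultimately have "a * poly L1 z = - (coeff L1 1 * coeff L2 0 - coeff L1 0 * coeff L2 1)"
      unfolding a_def by algebra
    then have L1z: "poly L1 z \<noteq> 0" using det by auto
    have "poly (G * L1) z = 0" unfolding GF L2 by simp
    then have "poly G z = 0" using L1z by simp
    then obtain C' where C': "G = [:- z, 1:] * C'" unfolding poly_eq_0_iff_dvd by (elim dvdE)
    define C where "C = smult (1 / a) C'"
    have GC: "G = C * L2" unfolding C' C_def L2 using a by simp
    have L20: "L2 \<noteq> 0" using a L2 by simp
    have "F * L2 = (C * L1) * L2" using GF unfolding GC by algebra
    then have FC: "F = C * L1" using L20 by (metis mult_right_cancel)
    have "degree C \<le> e - 1"
    proof (cases "C = 0")
      case False
      have "degree L2 = 1" using a by (simp add: L2)
      then have "degree G = Suc (degree C)" using False L20 unfolding GC by (subst degree_mult_eq) auto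
      then show ?thesis using dFG(2) by simp
    qed simp
    then show ?thesis using GC FC by blast
  qed
  then obtain C where C: "degree C \<le> e - 1" "(F, G) = (C * L1, C * L2)" by blast
  have "(L1, L2) \<in> form_pairs (e - (e - 1))" using dL e by (simp add: form_pairs_def)
  from gFG(4)[of "e - 1" C L1 L2, OF _ C(1) this C(2)] e show False by simp
qed

text \<open>A linear relation between the limit forms passes to the coprime pair with the same
  quotient. There it would make one form a multiple of the other, leaving a common factor of formal
  degree \<open>e\<close>.\<close>

lemma coprime_ratio_independent:
  assumes g: "g \<in> rat_maps e" "(F, G) \<in> g" and e: "1 \<le> e"
    and nz: "F0 \<noteq> 0 \<or> G0 \<noteq> 0" and eq: "F0 * G = G0 * F" and ab: "smult a F0 + smult b G0 = 0"
  shows "a = 0 \<and> b = 0"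
proof (rule ccontr)
  assume ne: "\<not> ?thesis"
  note gFG = rat_maps_rep[OF g]
  have dFG: "degree F \<le> e" "degree G \<le> e" using gFG(1) by (auto simp: form_pairs_def)
  have "F0 * (smult a F + smult b G) = F * (smult a F0 + smult b G0)"
    "G0 * (smult a F + smult b G) = G * (smult a F0 + smult b G0)"
    using eq by (simp_all add: distrib_left mult_ac)
  then have z: "smult a F + smult b G = 0" using ab nz by (metis mult_eq_0_iff mult_zero_right)
  show False
  proof (cases "b = 0")
    case False
    have "smult (- 1 / b) (smult a F + smult b G) = smult (- a / b) F - G" using False by (simp add: smult_add_right)
    then have "G = smult (- a / b) F" using z by simp
    then have "(F, G) = (F * 1, F * [:- a / b:])" by simp
    from gFG(4)[of e F 1 "[:- a / b:]", OF order_refl dFG(1) _ this] e show False by (simp add: form_pairs_def)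
  next
    case True
    then have "F = 0" using z ne by simp
    then have "(F, G) = (G * 0, G * 1)" by simp
    from gFG(4)[of e G 0 1, OF order_refl dFG(2) _ this] e show False by (simp add: form_pairs_def)
  qed
qed

text \<open>A common factor of largest formal degree \<open>k\<close> is taken out; this also
  extracts powers of Y, which do not show in \<open>H\<close>. Maximality makes the cofactors
  coprime.\<close>

lemma form_pair_decompose:
  assumes w: "w \<in> form_pairs D" "w \<noteq> (0, 0)"
  obtains k H A B where "k \<le> D" "w = (H * A, H * B)" "proj_class (A, B) \<in> rat_maps (D - k)"
proof -
  define X where "X = {k. k \<le> D \<and> (\<exists>H A B. degree H \<le> k \<and> (A, B) \<in> form_pairs (D - k) \<and> w = (H * A, H * B))}"
  have fX: "finite X" by (rule finite_subset[of _ "{..D}"]) (auto simp: X_def)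
  have "degree 1 \<le> (0 :: nat) \<and> (fst w, snd w) \<in> form_pairs (D - 0) \<and> w = (1 * fst w, 1 * snd w)"
    using w(1) by simp
  then have "0 \<in> X" unfolding X_def by blast
  define k where "k = Max X"
  have "k \<in> X" unfolding k_def by (rule Max_in[OF fX]) (use \<open>0 \<in> X\<close> in blast)
  then obtain H A B where k: "k \<le> D" "degree H \<le> k" "(A, B) \<in> form_pairs (D - k)" "w = (H * A, H * B)"
    unfolding X_def by blast
  have "k' = 0" if "k' \<le> D - k" "degree H' \<le> k'" "(A', B') \<in> form_pairs (D - k - k')" "A = H' * A'" "B = H' * B'" for k' H' A' B'
  proof -
    have "degree (H * H') \<le> k + k'" using degree_mult_le[of H H'] k(2) that(2) by simp
    moreover have "k + k' \<le> D" using that(1) k(1) by simp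
    moreover have "(A', B') \<in> form_pairs (D - (k + k'))" using that(3) by simp
    moreover have "w = (H * H' * A', H * H' * B')" using k(4) that(4,5) by (simp add: mult.assoc)
    ultimately have "k + k' \<in> X" unfolding X_def by blast
    then have "k + k' \<le> k" unfolding k_def by (rule Max_ge[OF fX])
    then show ?thesis by simp
  qed
  moreover have "(A, B) \<in> form_pairs (D - k) - {(0, 0)}" using k(3,4) w(2) by auto
  ultimately have "proj_class (A, B) \<in> rat_maps (D - k)" unfolding rat_maps_def by blast
  then show ?thesis using that k(1,4) by blast
qed

lemma poly_eqI_off_finite:
  fixes p q :: "complex poly"
  assumes "finite T" "\<And>z. z \<notin> T \<Longrightarrow> poly p z = poly q z"
  shows "p = q"
proof (rule ccontr)
  assume "p \<noteq> q"
  then have "p - q \<noteq> 0" by simp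
  then have "finite {z. poly (p - q) z = 0}" by (rule poly_roots_finite)
  moreover have "(UNIV :: complex set) = T \<union> {z. poly (p - q) z = 0}" using assms(2) by auto
  ultimately show False using assms(1) infinite_UNIV_char_0 by (metis finite_UnI)
qed

text \<open>Both limits are compared at single points off \<open>S\<close>. Where \<open>v0\<close>
  does not vanish, the values converge to its direction and, by hypothesis, to that of
  \<open>(F, G)\<close>, so the cross product is 0; where it vanishes, the identity is
  trivial.\<close>

lemma limit_ratio_eq:
  assumes lu: "locally_uniform_limit_off S (\<lambda>t. rat_eval D (f t)) (rat_eval e g)" and S: "finite S"
    and f: "eventually (\<lambda>t. f t = proj_class (v t) \<and> v t \<in> form_pairs D) (at 0)"
    and lim: "\<And>i. ((\<lambda>t. coeff (fst (v t)) i) \<longlongrightarrow> coeff (fst v0) i) (at 0)"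
      "\<And>i. ((\<lambda>t. coeff (snd (v t)) i) \<longlongrightarrow> coeff (snd v0) i) (at 0)"
    and v0: "v0 \<in> form_pairs D" and g: "g \<in> rat_maps e" "(F, G) \<in> g"
  shows "fst v0 * G = snd v0 * F"
proof -
  note gFG = rat_maps_rep[OF g]
  have dFG: "degree F \<le> e" "degree G \<le> e" using gFG(1) by (auto simp: form_pairs_def)
  have dv: "degree (fst v0) \<le> D" "degree (snd v0) \<le> D" using form_pairsD[OF v0] by auto
  show ?thesis
  proof (rule poly_eqI_off_finite)
    have "inj (\<lambda>x. line_class (x, 1))" using line_class_inj by (auto intro: injI)
    then show "finite {x. line_class (x, 1) \<in> S}" using finite_vimageI[OF S] by (simp add: vimage_def)
    fix x assume "x \<notin> {x. line_class (x, 1) \<in> S}"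
    define z where "z = line_class (x, 1)"
    have z: "z \<in> proj_line - S" using \<open>x \<notin> _\<close> line_class_in_proj_line[of "(x, 1)"] by (simp add: z_def)
    define a where "a t = pair_eval D (v t) (x, 1)" for t
    define a0 where "a0 = pair_eval D v0 (x, 1)"
    define b where "b = pair_eval e (F, G) (x, 1)"
    have a0: "a0 = (poly (fst v0) x, poly (snd v0) x)" using dv by (simp add: a0_def pair_eval_def form_eval_poly)
    have b: "b = (poly F x, poly G x)" using dFG by (simp add: b_def pair_eval_def form_eval_poly)
    have bnz: "b \<noteq> (0, 0)" unfolding b_def using rat_maps_nonvanishing[OF g, of "(x, 1)"] by simp
    have la: "(a \<longlongrightarrow> a0) (at 0)" unfolding a_def a0_def by (intro tendsto_pair_eval lim tendsto_const)
    show "poly (fst v0 * G) x = poly (snd v0 * F) x"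
    proof (cases "a0 = (0, 0)")
      case True
      then show ?thesis using a0 by simp
    next
      case False
      have anz: "eventually (\<lambda>t. a t \<noteq> (0, 0)) (at 0)"
        using tendsto_imp_eventually_ne[OF la] False by (simp add: zero_prod_def[symmetric])
      have gl: "rat_eval e g z \<noteq> {}" "rat_eval e g z \<subseteq> line_class b"
      proof -
        have "g \<noteq> {}" using g(2) by blast
        moreover have "pair_eval e H (x, 1) \<in> line_class b" if "H \<in> g" for H
          using pair_eval_proj[of H "(F, G)" e "(x, 1)"] that gFG(3) by (simp add: b_def)
        note * = calculation this
        show "rat_eval e g z \<noteq> {}" unfolding z_def by (rule rat_eval_line(1)[OF *])
        show "rat_eval e g z \<subseteq> line_class b" unfolding z_def by (rule rat_eval_line(2)[OF *])
      qed
      have ev: "eventually (\<lambda>t. chordal (rat_eval D (f t) z) (rat_eval e g z) = cmod (fst (a t) * snd b - snd (a t) * fst b) / (norm (a t) * norm b)) (at 0)"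
        using f anz
      proof eventually_elim
        case (elim t)
        have "f t \<noteq> {}" using elim(1) proj_class_refl by blast
        moreover have "pair_eval D H (x, 1) \<in> line_class (a t)" if "H \<in> f t" for H
          using that elim(1) pair_eval_proj unfolding a_def by blast
        note * = calculation this
        have r: "rat_eval D (f t) z \<noteq> {}" unfolding z_def by (rule rat_eval_line(1)[OF *])
        have r': "rat_eval D (f t) z \<subseteq> line_class (a t)" unfolding z_def by (rule rat_eval_line(2)[OF *])
        show ?case by (rule chordal_eq[OF elim(2) bnz r r' gl])
      qed
      have l: "((\<lambda>t. cmod (fst (a t) * snd b - snd (a t) * fst b) / (norm (a t) * norm b)) \<longlongrightarrow>
         cmod (fst a0 * snd b - snd a0 * fst b) / (norm a0 * norm b)) (at 0)"
        using False bnz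
        by (intro tendsto_divide tendsto_norm tendsto_diff tendsto_mult tendsto_const tendsto_fst[OF la] tendsto_snd[OF la] la)
           (auto simp: zero_prod_def)
      obtain \<rho> where \<rho>: "\<rho> > 0" "\<And>\<epsilon>. \<epsilon> > 0 \<Longrightarrow> \<forall>\<^sub>F t in at 0. \<forall>w \<in> proj_line - S. chordal z w < \<rho> \<longrightarrow> chordal (rat_eval D (f t) w) (rat_eval e g w) < \<epsilon>"
        using lu z unfolding locally_uniform_limit_off_def by blast
      have zz: "chordal z z = 0" unfolding z_def
        by (subst chordal_eq[of "(x, 1)" "(x, 1)"]) (auto intro: line_class_refl)
      have "cmod (fst a0 * snd b - snd a0 * fst b) / (norm a0 * norm b) \<le> \<epsilon>" if \<epsilon>: "\<epsilon> > 0" for \<epsilon>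
      proof (rule tendsto_upperbound[OF l])
        show "eventually (\<lambda>t. cmod (fst (a t) * snd b - snd (a t) * fst b) / (norm (a t) * norm b) \<le> \<epsilon>) (at 0)"
          using \<rho>(2)[OF \<epsilon>] ev
        proof eventually_elim
          case (elim t)
          have "chordal (rat_eval D (f t) z) (rat_eval e g z) < \<epsilon>" using elim(1) z zz \<rho>(1) by auto
          then show ?case using elim(2) by simp
        qed
      qed simp
      then have "cmod (fst a0 * snd b - snd a0 * fst b) / (norm a0 * norm b) \<le> 0"
        by (rule field_le_epsilon[of _ 0, simplified])
      moreover have "norm a0 * norm b > 0" using False bnz by (simp add: zero_prod_def)
      ultimately have "fst a0 * snd b - snd a0 * fst b = 0" by (simp add: divide_le_0_iff)
      then show ?thesis unfolding a0 b by simp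
    qed
  qed
qed

text \<open>All roots are at distance at least one from \<open>a\<close>, so the shift by \<open>u\<close> at most doubles each linear
  factor.\<close>

lemma poly_no_zero_bound:
  fixes q :: "complex poly"
  assumes d: "degree q \<le> D" and nz: "\<And>z. dist a z < 1 \<Longrightarrow> poly q z \<noteq> 0" and u: "cmod u \<le> 1"
  shows "cmod (poly q (a + u)) \<le> 2 ^ D * cmod (poly q a)"
proof -
  obtain x where x: "q = smult (lead_coeff q) (root_prod {..<degree q} x)"
    using poly_root_prod_factorization by blast
  have ev: "poly q z = lead_coeff q * (\<Prod>j<degree q. z - x j)" for z
    by (subst x) (simp add: poly_root_prod)
  have "q \<noteq> 0" using nz[of a] by auto
  have far: "cmod (a + u - x j) \<le> 2 * cmod (a - x j)" if "j < degree q" for j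
  proof -
    have "poly q (x j) = 0" unfolding ev using that by auto
    then have "1 \<le> cmod (a - x j)" using nz[of "x j"] by (force simp: dist_norm)
    moreover have "cmod (a + u - x j) \<le> cmod (a - x j) + cmod u"
      using norm_triangle_ineq[of "a - x j" u] by (simp add: algebra_simps)
    ultimately show ?thesis using u by simp
  qed
  have "cmod (poly q (a + u)) = cmod (lead_coeff q) * (\<Prod>j<degree q. cmod (a + u - x j))"
    unfolding ev by (simp add: norm_mult prod_norm[symmetric])
  also have "\<dots> \<le> cmod (lead_coeff q) * (\<Prod>j<degree q. 2 * cmod (a - x j))"
    by (intro mult_left_mono prod_mono) (use far in auto)
  also have "\<dots> = 2 ^ degree q * cmod (poly q a)"
    unfolding ev by (simp add: norm_mult prod_norm[symmetric] prod.distrib)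
  also have "\<dots> \<le> 2 ^ D * cmod (poly q a)"
    using d by (intro mult_right_mono power_increasing) auto
  finally show ?thesis .
qed

context newton_frame
begin

text \<open>The coordinate of \<open>K0\<close> is undone: \<open>(L1, L2)\<close> is the inverse of
  \<open>K0\<close> applied to the numerator and denominator of the Moebius map.\<close>

lemma moebius_limit_value:
  assumes V0: "V0 \<in> form_pairs D" and T: "finite T"
    and k: "moebius_off k" "\<And>z. z \<notin> T \<Longrightarrow> snd (limit_value D V0 z) \<noteq> 0 \<and> k z = fst (limit_value D V0 z) / snd (limit_value D V0 z)"
  obtains L1 L2 where "degree L1 \<le> 1" "degree L2 \<le> 1"
    "coeff L1 1 * coeff L2 0 - coeff L1 0 * coeff L2 1 \<noteq> 0" "fst V0 * L2 = snd V0 * L1"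
proof -
  have ev: "pair_eval D V0 (z, 1) = (poly (fst V0) z, poly (snd V0) z)" for z
    using form_pairsD[OF V0] by (simp add: pair_eval_def form_eval_poly)
  from k(1) obtain a b c e where m: "a * e - b * c \<noteq> 0" "finite {z. k z * (c * z + e) \<noteq> a * z + b}"
    unfolding moebius_off_def by blast
  have lv: "limit_value D V0 z = (cnj \<delta> * poly (fst V0) z - cnj \<gamma> * poly (snd V0) z, \<gamma> * poly (fst V0) z + \<delta> * poly (snd V0) z)" for z
    unfolding limit_value_def K0_eval ev by simp
  define L1 where "L1 = [:\<delta> * b + cnj \<gamma> * e, \<delta> * a + cnj \<gamma> * c:]"
  define L2 where "L2 = [:- \<gamma> * b + cnj \<delta> * e, - \<gamma> * a + cnj \<delta> * c:]"
  show ?thesis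
  proof (rule that)
    show "degree L1 \<le> 1" "degree L2 \<le> 1" by (simp_all add: L1_def L2_def)
    have "coeff L1 1 * coeff L2 0 - coeff L1 0 * coeff L2 1 = (\<gamma> * cnj \<gamma> + \<delta> * cnj \<delta>) * (a * e - b * c)"
      by (simp add: L1_def L2_def algebra_simps)
    then show "coeff L1 1 * coeff L2 0 - coeff L1 0 * coeff L2 1 \<noteq> 0" using unit m(1) by simp
    show "fst V0 * L2 = snd V0 * L1"
    proof (rule poly_eqI_off_finite)
      show "finite (T \<union> {z. k z * (c * z + e) \<noteq> a * z + b})" using T m(2) by simp
      fix z assume z: "z \<notin> T \<union> {z. k z * (c * z + e) \<noteq> a * z + b}"
      define f g where "f = poly (fst V0) z" and "g = poly (snd V0) z"
      have s: "\<gamma> * f + \<delta> * g \<noteq> 0" "k z = (cnj \<delta> * f - cnj \<gamma> * g) / (\<gamma> * f + \<delta> * g)"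
        using k(2)[of z] z by (auto simp: lv f_def g_def)
      have "k z * (c * z + e) = a * z + b" using z by simp
      then have *: "(cnj \<delta> * f - cnj \<gamma> * g) * (c * z + e) = (a * z + b) * (\<gamma> * f + \<delta> * g)"
        unfolding s(2) using s(1) by (simp add: divide_eq_eq)
      have "poly (fst V0 * L2) z - poly (snd V0 * L1) z =
        (cnj \<delta> * f - cnj \<gamma> * g) * (c * z + e) - (a * z + b) * (\<gamma> * f + \<delta> * g)"
        by (simp add: L1_def L2_def f_def g_def algebra_simps)
      then show "poly (fst V0 * L2) z = poly (snd V0 * L1) z" using * by simp
    qed
  qed
qed

text \<open>A zero of the limit denominator would be approximated by zeros of the denominators, or these would
  vanish in the limit on a whole disc; but at such zeros the iterate would be infinite.\<close>

lemma limit_form: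
  assumes V: "eventually (\<lambda>t. V t \<in> rat_conj (d ^ n) (proj_class (m t)) (rat_iter d (newton_point (P t)) n)) U"
    and lim: "\<And>i. ((\<lambda>t. coeff (fst (V t)) i) \<longlongrightarrow> coeff (fst V0) i) U"
      "\<And>i. ((\<lambda>t. coeff (snd (V t)) i) \<longlongrightarrow> coeff (snd V0) i) U"
    and V0: "V0 \<in> form_pairs (d ^ n)" "V0 \<noteq> (0, 0)"
    and g: "\<And>w z. (w \<longlongrightarrow> z) U \<Longrightarrow> ((\<lambda>t. down A0 t (newt_iter n t (up A0 t (w t)))) \<longlongrightarrow> poly g z) U"
      "\<And>w z. (w \<longlongrightarrow> z) U \<Longrightarrow> eventually (\<lambda>t. \<forall>i<n. poly (pderiv (P t)) (newt_iter i t (up A0 t (w t))) \<noteq> 0) U"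
  shows "fst (pair_conj (d ^ n) (pair_adj K0) V0) = g * snd (pair_conj (d ^ n) (pair_adj K0) V0)"
    and "degree (snd (pair_conj (d ^ n) (pair_adj K0) V0)) = 0"
proof -
  let ?D = "d ^ n"
  have adjK: "pair_eval 1 (pair_adj (K t)) (z, 1) = (coeff (snd (m t)) 0 * z + cnj \<gamma>, cnj \<delta> - coeff (snd (m t)) 1 * z)" for t z
    unfolding pair_eval_adj by (simp add: K_def algebra_simps)
  have adjK0: "pair_eval 1 (pair_adj K0) (z, 1) = (\<delta> * z + cnj \<gamma>, cnj \<delta> - \<gamma> * z)" for z
    unfolding pair_eval_adj by (simp add: K0_def algebra_simps)
  have adj2: "pair_eval 1 (pair_adj (pair_adj k)) v = pair_eval 1 k v" for k v
    unfolding pair_eval_adj by (simp add: pair_adj_def pair_eval_1[unfolded One_nat_def] algebra_simps)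
  \<comment> \<open>The adjugate of an adjugate is the matrix itself, so this is \<open>K t\<close>
    after \<open>V t\<close> after the inverse of \<open>K t\<close>, up to scalars: the iterate in
    the coordinate of \<open>A0\<close>.\<close>
  define V' where "V' t = pair_conj ?D (pair_adj (K t)) (V t)" for t
  define V'0 where "V'0 = pair_conj ?D (pair_adj K0) V0"
  have fV': "V' t \<in> form_pairs ?D" "V'0 \<in> form_pairs ?D" for t
    unfolding V'_def V'0_def pair_conj_def by (rule pair_eval_conj(1); rule pair_adj_form_pairs)+
  have eV': "pair_eval ?D (V' t) (z, 1) = pair_eval 1 (K t) (pair_eval ?D (V t) (pair_eval 1 (pair_adj (K t)) (z, 1)))" for t z
    unfolding V'_def pair_conj_def
    by (subst pair_eval_conj(2)) (simp_all only: adj2 pair_adj_form_pairs)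
  have eV'0: "pair_eval ?D V'0 (z, 1) = pair_eval 1 K0 (pair_eval ?D V0 (pair_eval 1 (pair_adj K0) (z, 1)))" for z
    unfolding V'0_def pair_conj_def
    by (subst pair_eval_conj(2)) (simp_all only: adj2 pair_adj_form_pairs)
  have pV': "pair_eval ?D (V' t) (z, 1) = (poly (fst (V' t)) z, poly (snd (V' t)) z)"
    and pV'0: "pair_eval ?D V'0 (z, 1) = (poly (fst V'0) z, poly (snd V'0) z)" for t z
    using form_pairsD[OF fV'(1)] form_pairsD[OF fV'(2)] by (simp_all add: pair_eval_def form_eval_poly)
  have lV': "((\<lambda>t. pair_eval ?D (V' t) (w t, 1)) \<longlongrightarrow> pair_eval ?D V'0 (z, 1)) U" if w: "(w \<longlongrightarrow> z) U" for w z
  proof -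
    have a: "((\<lambda>t. pair_eval 1 (pair_adj (K t)) (w t, 1)) \<longlongrightarrow> pair_eval 1 (pair_adj K0) (z, 1)) U"
      unfolding adjK adjK0 by (intro tendsto_Pair tendsto_add tendsto_diff tendsto_mult tendsto_const row w)
    have l: "((\<lambda>t. pair_eval ?D (V t) (pair_eval 1 (pair_adj (K t)) (w t, 1))) \<longlongrightarrow> pair_eval ?D V0 (pair_eval 1 (pair_adj K0) (z, 1))) U"
      by (intro tendsto_pair_eval lim a)
    show ?thesis unfolding eV' eV'0 unfolding K_eval K0_eval
      by (intro tendsto_Pair tendsto_add tendsto_diff tendsto_mult tendsto_const tendsto_fst[OF l] tendsto_snd[OF l] row)
  qed
  have line: "eventually (\<lambda>t. pair_eval ?D (V' t) (w t, 1) \<in> line_class (down A0 t (newt_iter n t (up A0 t (w t))), 1)) U"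
    if w: "(w \<longlongrightarrow> z) U" for w z
    using V kappa_nonzero g(2)[OF w]
  proof eventually_elim
    case (elim t)
    have "pair_eval 1 (K t) (pair_eval 1 (pair_adj (K t)) (w t, 1)) = (\<kappa> t * w t, \<kappa> t)"
      unfolding adjK K_eval kappa_eq by (simp add: algebra_simps)
    from conj_elem_eval(3)[OF elim(1,2) this elim(2)] elim(2,3)
    show ?case unfolding eV' by (simp add: regular_def)
  qed
  have eq: "fst V'0 = g * snd V'0"
  proof (rule poly_eqI_off_finite[of "{}"])
    fix z :: complex
    have E: "((\<lambda>t. pair_eval ?D (V' t) (z, 1)) \<longlongrightarrow> pair_eval ?D V'0 (z, 1)) U" by (rule lV'[OF tendsto_const])
    have "eventually (\<lambda>t. down A0 t (newt_iter n t (up A0 t z)) * snd (pair_eval ?D (V' t) (z, 1)) = fst (pair_eval ?D (V' t) (z, 1))) U"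
      using line[OF tendsto_const[of z]] by eventually_elim (auto simp: line_class_iff)
    from Lim_transform_eventually[OF tendsto_mult[OF g(1)[OF tendsto_const[of z]] tendsto_snd[OF E]] this]
    have "poly g z * snd (pair_eval ?D V'0 (z, 1)) = fst (pair_eval ?D V'0 (z, 1))"
      using tendsto_unique[OF ultra_neq_bot[OF U] _ tendsto_fst[OF E]] by blast
    then show "poly (fst V'0) z = poly (g * snd V'0) z" unfolding pV'0 by simp
  qed simp
  \<comment> \<open>If the denominator vanished identically, so would the numerator by
    \<open>eq\<close> and then, after undoing \<open>K0\<close>, also \<open>V0\<close>.\<close>
  have G0: "snd V'0 \<noteq> 0"
  proof
    assume "snd V'0 = 0"
    then have zero: "pair_eval ?D V'0 (z, 1) = (0, 0)" for z using eq unfolding pV'0 by simp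
    have eV0: "pair_eval ?D V0 (x, 1) = (poly (fst V0) x, poly (snd V0) x)" for x
      using form_pairsD[OF V0(1)] by (simp add: pair_eval_def form_eval_poly)
    have van: "pair_eval ?D V0 (x, 1) = (0, 0)" if x: "\<gamma> * x + \<delta> \<noteq> 0" for x
    proof -
      let ?z = "frame_coord0 x" and ?Y = "\<gamma> * x + \<delta>"
      have Yz: "?Y * ?z = cnj \<delta> * x - cnj \<gamma>" using x by (simp add: frame_coord0_def)
      have "?Y * (\<delta> * ?z + cnj \<gamma>) = \<delta> * (?Y * ?z) + cnj \<gamma> * ?Y" by (simp add: algebra_simps)
      also have "\<dots> = x * (\<gamma> * cnj \<gamma> + \<delta> * cnj \<delta>)" unfolding Yz by (simp add: algebra_simps)
      finally have 1: "?Y * (\<delta> * ?z + cnj \<gamma>) = x" using unit by simp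
      have "?Y * (cnj \<delta> - \<gamma> * ?z) = cnj \<delta> * ?Y - \<gamma> * (?Y * ?z)" by (simp add: algebra_simps)
      also have "\<dots> = \<gamma> * cnj \<gamma> + \<delta> * cnj \<delta>" unfolding Yz by (simp add: algebra_simps)
      finally have 2: "?Y * (cnj \<delta> - \<gamma> * ?z) = 1" using unit by simp
      have "(x, 1) \<in> line_class (pair_eval 1 (pair_adj K0) (?z, 1))"
        unfolding line_class_iff adjK0 by (rule exI[of _ ?Y]) (use x 1 2 in simp)
      from pair_eval_line[OF this, of ?D V0]
      have l: "pair_eval ?D V0 (x, 1) \<in> line_class (pair_eval ?D V0 (pair_eval 1 (pair_adj K0) (?z, 1)))" .
      have "pair_det K0 \<noteq> 0" using det_K0 by simp
      from pair_eval_linear_eq_0[OF this] zero[of ?z]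
      have "pair_eval ?D V0 (pair_eval 1 (pair_adj K0) (?z, 1)) = (0, 0)" unfolding eV'0 by blast
      then show ?thesis using line_class_zero[OF l] by blast
    qed
    have "fst V0 = 0" "snd V0 = 0"
      by (rule poly_eqI_off_finite[OF finite_frame_poles]; use van in \<open>simp add: eV0\<close>)+
    then show False using V0(2) by (cases V0) simp
  qed
  have noroot: "poly (snd V'0) a \<noteq> 0" for a
  proof
    assume a: "poly (snd V'0) a = 0"
    have ls: "((\<lambda>t. poly (snd (V' t)) (w t)) \<longlongrightarrow> poly (snd V'0) z) U" if "(w \<longlongrightarrow> z) U" for w z
      using tendsto_snd[OF lV'[OF that]] unfolding pV' pV'0 by simp
    have "eventually (\<lambda>t. \<exists>z. dist a z < 1 \<and> poly (snd (V' t)) z = 0) U"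
    proof (rule ultra_cases[OF U, of "\<lambda>t. \<exists>z. dist a z < 1 \<and> poly (snd (V' t)) z = 0"], assumption)
      assume no: "eventually (\<lambda>t. \<not> (\<exists>z. dist a z < 1 \<and> poly (snd (V' t)) z = 0)) U"
      \<comment> \<open>In the absence of nearby zeros the bound carries the vanishing at
        \<open>a\<close> to the whole disc, against \<open>G0\<close>.\<close>
      have "poly (snd V'0) (a + u) = 0" if u: "cmod u \<le> 1" for u
      proof -
        have "((\<lambda>t. 2 ^ ?D * cmod (poly (snd (V' t)) a)) \<longlongrightarrow> 2 ^ ?D * cmod (poly (snd V'0) a)) U"
          by (intro tendsto_mult tendsto_const tendsto_norm ls)
        then have z: "((\<lambda>t. 2 ^ ?D * cmod (poly (snd (V' t)) a)) \<longlongrightarrow> 0) U" using a by simp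
        have "eventually (\<lambda>t. norm (poly (snd (V' t)) (a + u)) \<le> 2 ^ ?D * cmod (poly (snd (V' t)) a)) U"
          using no
        proof eventually_elim
          case (elim t)
          show ?case by (rule poly_no_zero_bound[OF _ _ u]) (use elim form_pairsD[OF fV'(1)] in auto)
        qed
        then have "((\<lambda>t. poly (snd (V' t)) (a + u)) \<longlongrightarrow> 0) U" by (rule Lim_null_comparison[OF _ z])
        then show ?thesis using tendsto_unique[OF ultra_neq_bot[OF U] ls[OF tendsto_const]] by blast
      qed
      then have "cball a 1 \<subseteq> {z. poly (snd V'0) z = 0}"
      proof (intro subsetI)
        fix z assume "z \<in> cball a 1"
        then have "cmod (z - a) \<le> 1" by (simp add: dist_norm norm_minus_commute)
        then show "z \<in> {z. poly (snd V'0) z = 0}" using \<open>\<And>u. cmod u \<le> 1 \<Longrightarrow> poly (snd V'0) (a + u) = 0\<close>[of "z - a"] by simp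
      qed
      then have "finite (cball a 1)" using poly_roots_finite[OF G0] by (rule finite_subset)
      then show ?thesis using uncountable_cball[of 1 a] by (simp add: uncountable_infinite)
    qed
    define w where "w t = (SOME z. dist a z < 1 \<and> poly (snd (V' t)) z = 0)" for t
    have w: "eventually (\<lambda>t. dist a (w t) < 1 \<and> poly (snd (V' t)) (w t) = 0) U"
      using \<open>eventually (\<lambda>t. \<exists>z. dist a z < 1 \<and> poly (snd (V' t)) z = 0) U\<close>
    proof eventually_elim
      case (elim t)
      then show ?case unfolding w_def by (rule someI_ex)
    qed
    then have "eventually (\<lambda>t. w t \<in> cball a 1) U" by eventually_elim auto
    from ultra_compact[OF U compact_cball this] obtain z where z: "(w \<longlongrightarrow> z) U" by blast
    \<comment> \<open>At the zeros \<open>w t\<close> the second coordinate is 0, but since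
      \<open>w\<close> converges, \<open>line\<close> says that the value there is finite.\<close>
    from line[OF z] w have "eventually (\<lambda>t. False) U"
      by eventually_elim (auto simp: line_class_iff pV')
    then show False using U by (simp add: ultra_def trivial_limit_def)
  qed
  have "degree (snd V'0) = 0"
  proof (rule ccontr)
    assume "degree (snd V'0) \<noteq> 0"
    then have "\<not> constant (poly (snd V'0))" by (simp add: constant_degree)
    then show False using fundamental_theorem_of_algebra noroot by blast
  qed
  then show "degree (snd (pair_conj (d ^ n) (pair_adj K0) V0)) = 0" unfolding V'0_def .
  show "fst (pair_conj (d ^ n) (pair_adj K0) V0) = g * snd (pair_conj (d ^ n) (pair_adj K0) V0)"
    using eq unfolding V'0_def .
qed

end

section \<open>The theorem\<close>

lemma form_subst_identity:
  assumes "degree F \<le> D"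
  shows "form_subst D F ([:0, 1:], 1) = F"
proof -
  have "form_subst D F ([:0, 1:], 1) = (\<Sum>i\<le>D. monom (coeff F i) i)"
    unfolding form_subst_def
    by (intro sum.cong refl) (simp add: monom_altdef)
  then show ?thesis using poly_as_sum_of_monoms'[OF assms] by simp
qed

lemma rat_iter_1_eval:
  assumes "n \<in> form_pairs d" "H \<in> rat_iter d (proj_class n) 1"
  shows "pair_eval d H v \<in> line_class (pair_eval d n v)"
proof -
  from assms(2) obtain n' i' where H: "H = pair_comp d n' i'" "n' \<in> proj_class n" "i' \<in> proj_class ([:0, 1:], 1)"
    by (auto simp: rat_comp_def)
  have id: "([:0, 1:], 1) \<in> form_pairs 1" by (simp add: form_pairs_def)
  have i': "i' \<in> form_pairs 1" by (rule proj_class_form_pairs[OF H(3) id])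
  have idv: "pair_eval 1 ([:0, 1:], 1) v = v" unfolding pair_eval_1 by simp
  have "pair_eval d H v = pair_eval d n' (pair_eval 1 i' v)"
    using pair_eval_comp[OF i', of d n' v] H(1) by simp
  also have "\<dots> \<in> line_class (pair_eval d n' v)"
    by (rule pair_eval_line) (use pair_eval_proj[OF H(3), of 1 v] idv in simp)
  also have "\<dots> = line_class (pair_eval d n v)" by (rule line_class_eq[OF pair_eval_proj[OF H(2)]])
  finally show ?thesis .
qed

text \<open>\<open>pair_adj\<close> is linear, so the scalar \<open>c\<close> is produced by
  rescaling only the outer representative of the frame.\<close>

lemma scaled_conj_in_rat_conj:
  assumes m: "m \<in> f" and n: "n \<in> g" "n \<in> form_pairs d" and f: "f = proj_class m" and g: "g = proj_class n" and c: "c \<noteq> 0"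
  shows "(smult c (fst (pair_conj d m n)), smult c (snd (pair_conj d m n))) \<in> rat_conj d f (rat_iter d g 1)"
proof -
  have "n = pair_comp d n ([:0, 1:], 1)"
    using form_pairsD[OF n(2)] form_subst_identity by (simp add: pair_comp_def)
  moreover have "([:0, 1:], 1) \<in> rat_iter d g 0" by simp
  ultimately have "n \<in> rat_comp d g (rat_iter d g 0)" unfolding rat_comp_def using n(1) by blast
  then have n1: "n \<in> rat_iter d g 1" by simp
  have cm: "(smult c (fst m), smult c (snd m)) \<in> f" unfolding f proj_class_iff using c by auto
  have fs1: "form_subst 1 H W = smult (coeff H 0) (snd W) + smult (coeff H 1) (fst W)" for H W
    by (simp add: form_subst_def)
  have "(smult c (fst (pair_conj d m n)), smult c (snd (pair_conj d m n))) =
    pair_comp 1 (pair_adj (smult c (fst m), smult c (snd m))) (pair_comp d n m)"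
    unfolding pair_conj_def pair_comp_def[of 1] fs1 by (simp add: pair_adj_def smult_add_right smult_diff_right mult_ac)
  moreover have "pair_comp d n m \<in> rat_comp d (rat_iter d g 1) f" unfolding rat_comp_def using n1 m by blast
  ultimately show ?thesis unfolding rat_conj_def rat_comp_def[of 1] using cm by blast
qed

lemma holomorphic_family_rep:
  assumes "holomorphic_family D f"
  obtains X v where "open X" "0 \<in> X" "X \<subseteq> ball 0 1" "\<And>s. s \<in> X \<Longrightarrow> v s \<in> form_pairs D - {(0, 0)} \<and> f s = proj_class (v s)"
    "holomorphic_poly X (\<lambda>s. fst (v s))" "holomorphic_poly X (\<lambda>s. snd (v s))"
proof -
  have "(0 :: complex) \<in> ball 0 1" by simp
  with assms obtain X v where X: "open X" "0 \<in> X" "X \<subseteq> ball 0 1"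
    "\<forall>s\<in>X. v s \<in> form_pairs D - {(0, 0)} \<and> f s = proj_class (v s)"
    "\<forall>i\<le>D. (\<lambda>s. coeff (fst (v s)) i) holomorphic_on X \<and> (\<lambda>s. coeff (snd (v s)) i) holomorphic_on X"
    unfolding holomorphic_family_def by blast
  have "(\<lambda>s. coeff (fst (v s)) i) holomorphic_on X \<and> (\<lambda>s. coeff (snd (v s)) i) holomorphic_on X" for i
  proof (cases "i \<le> D")
    case False
    have "coeff (fst (v s)) i = 0 \<and> coeff (snd (v s)) i = 0" if "s \<in> X" for s
      using X(4) that False form_pairsD[of "v s" D] by (auto simp: coeff_eq_0)
    then show ?thesis by (auto intro: holomorphic_transform[OF holomorphic_on_const])
  qed (use X(5) in blast)
  then show ?thesis using that[of X v] X(1-4) unfolding holomorphic_poly_def by blast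
qed

lemma rat_maps_nonempty: "f \<in> rat_maps D \<Longrightarrow> \<exists>F. F \<in> f"
  unfolding rat_maps_def using proj_class_refl by blast

text \<open>The limit along the ultrafilter is upgraded to one for \<open>t \<rightarrow> 0\<close>: holomorphic coefficients converge
  after division by a power of \<open>t\<close>.\<close>

lemma period_one_limit:
  assumes N: "holomorphic_family d N" and M: "holomorphic_family 1 M"
    and no: "\<not> rescales d N M 1"
  obtains w w0 H A B where "w0 \<in> form_pairs d" "w0 \<noteq> (0, 0)" "w0 = (H * A, H * B)" "degree A \<le> 1" "degree B \<le> 1"
    "eventually (\<lambda>t. w t \<in> rat_conj d (M t) (rat_iter d (N t) 1)) (at 0)"
    "\<And>i. ((\<lambda>t. coeff (fst (w t)) i) \<longlongrightarrow> coeff (fst w0) i) (at 0)"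
    "\<And>i. ((\<lambda>t. coeff (snd (w t)) i) \<longlongrightarrow> coeff (snd w0) i) (at 0)"
proof -
  obtain X n where X: "open X" "0 \<in> X" "X \<subseteq> ball 0 1" and n: "\<And>s. s \<in> X \<Longrightarrow> n s \<in> form_pairs d - {(0, 0)} \<and> N s = proj_class (n s)"
    and hn: "holomorphic_poly X (\<lambda>s. fst (n s))" "holomorphic_poly X (\<lambda>s. snd (n s))"
    by (rule holomorphic_family_rep[OF N]) blast
  obtain Y \<mu> where Y: "open Y" "0 \<in> Y" "Y \<subseteq> ball 0 1" and \<mu>: "\<And>s. s \<in> Y \<Longrightarrow> \<mu> s \<in> form_pairs 1 - {(0, 0)} \<and> M s = proj_class (\<mu> s)"
    and h\<mu>: "holomorphic_poly Y (\<lambda>s. fst (\<mu> s))" "holomorphic_poly Y (\<lambda>s. snd (\<mu> s))"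
    by (rule holomorphic_family_rep[OF M]) blast
  define Z where "Z = X \<inter> Y"
  have Z: "open Z" "0 \<in> Z" using X Y by (auto simp: Z_def)
  have sub: "holomorphic_poly Z q" if "holomorphic_poly X q \<or> holomorphic_poly Y q" for q
    using that holomorphic_on_subset[of _ X Z] holomorphic_on_subset[of _ Y Z] unfolding holomorphic_poly_def Z_def by blast
  define W where "W s = pair_conj d (\<mu> s) (n s)" for s
  have hW: "holomorphic_poly Z (\<lambda>s. fst (W s))" "holomorphic_poly Z (\<lambda>s. snd (W s))"
    unfolding W_def using hn h\<mu> sub by (auto intro!: holomorphic_pair_conj)
  have fW: "W s \<in> form_pairs d" and eW: "pair_eval d (W s) v = pair_eval 1 (pair_adj (\<mu> s)) (pair_eval d (n s) (pair_eval 1 (\<mu> s) v))"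
    if "s \<in> Z" for s v
    using \<mu>[of s] that pair_eval_conj(1)[of "\<mu> s" "\<mu> s" d "n s"] pair_eval_conj(2)[of "\<mu> s" "\<mu> s" d "n s" v] unfolding W_def pair_conj_def by (auto simp: Z_def)
  have ev: "eventually (\<lambda>s. s \<in> Z - {0}) (at 0)"
    using eventually_at_in_open[OF Z] by simp
  have good: "N s \<in> rat_maps d" "M s \<in> rat_maps 1" "n s \<in> N s" "\<mu> s \<in> M s" if s: "s \<in> Z - {0}" for s
  proof -
    have "s \<in> ball 0 1 - {0}" using s X(3) by (auto simp: Z_def)
    then show "N s \<in> rat_maps d" "M s \<in> rat_maps 1" using N M unfolding holomorphic_family_def by blast+
    show "n s \<in> N s" "\<mu> s \<in> M s" using n[of s] \<mu>[of s] s by (auto simp: Z_def)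
  qed
  have Wnz: "pair_eval d (W s) v \<noteq> (0, 0)" if s: "s \<in> Z - {0}" and v: "v \<noteq> (0, 0)" for s v
  proof -
    have "pair_det (\<mu> s) \<noteq> 0" by (rule rat_maps_1_det[OF good(2,4)[OF s]])
    moreover then have "pair_det (pair_adj (\<mu> s)) \<noteq> 0" by (simp add: pair_det_adj)
    ultimately show ?thesis
      using eW[of s v] s v rat_maps_nonvanishing[OF good(1,3)[OF s]] pair_eval_linear_eq_0 by (metis DiffD1)
  qed
  \<comment> \<open>The pairs \<open>(b, i)\<close> put the coefficients of both forms in one
    family, so that a single power of the parameter normalises them all.\<close>
  define h where "h = (\<lambda>(b, i) s. coeff (if b then fst (W s) else snd (W s)) i)"
  obtain k l where l: "\<And>j. j \<in> UNIV \<times> {..d} \<Longrightarrow> ((\<lambda>s. h j s / s ^ k) \<longlongrightarrow> l j) (at 0)" "\<exists>j \<in> UNIV \<times> {..d}. l j \<noteq> 0"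
  proof (rule holomorphic_normalise[OF Z, of "UNIV \<times> {..d}" h])
    show "finite ((UNIV :: bool set) \<times> {..d})" by simp
    show "h j holomorphic_on Z" for j
      using hW unfolding h_def holomorphic_poly_def by (cases j; cases "fst j") auto
    show "eventually (\<lambda>s. \<exists>j \<in> UNIV \<times> {..d}. h j s \<noteq> 0) (at 0)"
      using ev
    proof (rule eventually_mono)
      fix s assume s: "s \<in> Z - {0}"
      show "\<exists>j \<in> UNIV \<times> {..d}. h j s \<noteq> 0"
      proof (rule ccontr)
        assume "\<not> ?thesis"
        then have z: "h (b, i) s = 0" if "i \<le> d" for b i using that by auto
        have "coeff (fst (W s)) i = 0 \<and> coeff (snd (W s)) i = 0" if "i \<le> d" for i
          using z[OF that, of True] z[OF that, of False] by (simp add: h_def)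
        then have "pair_eval d (W s) (1, 1) = (0, 0)" by (simp add: pair_eval_def form_eval_def)
        then show False using Wnz[OF s, of "(1, 1)"] by simp
      qed
    qed
  qed (use that in blast)
  define w where "w s = (smult (1 / s ^ k) (fst (W s)), smult (1 / s ^ k) (snd (W s)))" for s
  define w0 where "w0 = ((\<Sum>i\<le>d. monom (l (True, i)) i), (\<Sum>i\<le>d. monom (l (False, i)) i))"
  have cw0: "coeff (fst w0) i = (if i \<le> d then l (True, i) else 0)" "coeff (snd w0) i = (if i \<le> d then l (False, i) else 0)" for i
    by (simp_all add: w0_def coeff_sum)
  have fw0: "w0 \<in> form_pairs d"
    by (rule form_pairsI) (auto intro!: degree_le simp: cw0)
  have w0nz: "w0 \<noteq> (0, 0)"
  proof
    assume "w0 = (0, 0)"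
    then have "l (b, i) = 0" if "i \<le> d" for b i
      using cw0[of i] that by (cases b) auto
    then show False using l(2) by auto
  qed
  have limw': "((\<lambda>s. coeff (fst (w s)) i) \<longlongrightarrow> coeff (fst w0) i) (at 0) \<and>
    ((\<lambda>s. coeff (snd (w s)) i) \<longlongrightarrow> coeff (snd w0) i) (at 0)" for i
  proof (cases "i \<le> d")
    case True
    then show ?thesis
      using l(1)[of "(True, i)"] l(1)[of "(False, i)"] by (simp add: h_def w_def cw0)
  next
    case False
    have z: "coeff (fst (w s)) i = 0" "coeff (snd (w s)) i = 0" if "s \<in> Z - {0}" for s
      using form_pairsD[OF fW[of s]] that False by (auto simp: w_def coeff_eq_0)
    have "eventually (\<lambda>s. 0 = coeff (fst (w s)) i) (at 0)"
      using ev by (rule eventually_mono) (simp add: z)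
    moreover have "eventually (\<lambda>s. 0 = coeff (snd (w s)) i) (at 0)"
      using ev by (rule eventually_mono) (simp add: z)
    ultimately show ?thesis
      using False by (simp add: cw0 Lim_transform_eventually[OF tendsto_const])
  qed
  note limw = limw'[THEN conjunct1] limw'[THEN conjunct2]
  have wV: "w s \<in> rat_conj d (M s) (rat_iter d (N s) 1)" if s: "s \<in> Z - {0}" for s
    unfolding w_def W_def
    by (rule scaled_conj_in_rat_conj[OF good(4,3)[OF s]]) (use n[of s] \<mu>[of s] s in \<open>auto simp: Z_def\<close>)
  obtain j H A B where dec: "j \<le> d" "w0 = (H * A, H * B)" "proj_class (A, B) \<in> rat_maps (d - j)"
    by (rule form_pair_decompose[OF fw0 w0nz])
  have H0: "H \<noteq> 0" using w0nz dec(2) by auto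
  \<comment> \<open>With a reduced degree of at least 2, convergence of coefficients would give
    locally uniform convergence, hence a rescaling of period one.\<close>
  have small: "d - j \<le> 1"
  proof (rule ccontr)
    assume big: "\<not> d - j \<le> 1"
    have "\<exists>S. finite S \<and> S \<subseteq> proj_line \<and> locally_uniform_limit_off S
      (\<lambda>t. rat_eval d (rat_conj d (M t) (rat_iter d (N t) 1))) (rat_eval (d - j) (proj_class (A, B)))"
    proof (rule locally_uniform_limit_of_coeffs[OF fw0 dec(2) H0 dec(3) proj_class_refl _ limw])
      show "eventually (\<lambda>s. w s \<in> form_pairs d) (at 0)"
        using ev
      proof (rule eventually_mono)
        fix s assume "s \<in> Z - {0}"
        then show "w s \<in> form_pairs d" using form_pairsD[OF fW[of s]]
          by (intro form_pairsI) (auto simp: w_def intro: order_trans[OF degree_smult_le])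
      qed
      show "eventually (\<lambda>t. rat_conj d (M t) (rat_iter d (N t) 1) \<noteq> {} \<and>
        (\<forall>F v. F \<in> rat_conj d (M t) (rat_iter d (N t) 1) \<longrightarrow> pair_eval d F v \<in> line_class (pair_eval d (w t) v)) \<and>
        (\<forall>v. v \<noteq> (0, 0) \<longrightarrow> pair_eval d (w t) v \<noteq> (0, 0))) (at 0)"
        using ev
      proof (rule eventually_mono, intro conjI allI impI)
        fix s assume s: "s \<in> Z - {0}"
        show "rat_conj d (M s) (rat_iter d (N s) 1) \<noteq> {}" using wV[OF s] by blast
        have wW: "w s \<in> proj_class (W s)"
          unfolding proj_class_iff w_def using s by (auto intro!: exI[of _ "1 / s ^ k"])
        have wl: "pair_eval d (w s) v \<in> line_class (pair_eval d (W s) v)" for v by (rule pair_eval_proj[OF wW])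
        show "pair_eval d (w s) v \<noteq> (0, 0)" if "v \<noteq> (0, 0)" for v
          using line_class_zero[OF wl] Wnz[OF s that] by blast
        fix F v assume F: "F \<in> rat_conj d (M s) (rat_iter d (N s) 1)"
        have ms: "M s = proj_class (\<mu> s)" "\<mu> s \<in> form_pairs 1" "N s = proj_class (n s)" "n s \<in> form_pairs d"
          using n[of s] \<mu>[of s] s by (auto simp: Z_def)
        obtain G where G: "G \<in> rat_iter d (N s) 1"
          "pair_eval d F v \<in> line_class (pair_eval 1 (pair_adj (\<mu> s)) (pair_eval d G (pair_eval 1 (\<mu> s) v)))"
          using rat_conj_elem[OF F[unfolded ms(1)] ms(2)] by metis
        have "pair_eval 1 (pair_adj (\<mu> s)) (pair_eval d G (pair_eval 1 (\<mu> s) v)) \<in> line_class (pair_eval d (W s) v)"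
          using eW[of s v] s pair_eval_line[OF rat_iter_1_eval[OF ms(4) G(1)[unfolded ms(3)]]] by simp
        then show "pair_eval d F v \<in> line_class (pair_eval d (w s) v)"
          using G(2) wl line_class_sym line_class_trans by blast
      qed
    qed
    then have "rescales d N M 1"
      unfolding rescales_def using big dec(3)
      by (intro exI[of _ "d - j"] exI[of _ "proj_class (A, B)"]) auto
    then show False using no by blast
  qed
  have "(A, B) \<in> form_pairs (d - j)" by (rule rat_maps_rep(1)[OF dec(3) proj_class_refl])
  then have dAB: "degree A \<le> 1" "degree B \<le> 1" using small by (auto simp: form_pairs_def)
  have "eventually (\<lambda>t. w t \<in> rat_conj d (M t) (rat_iter d (N t) 1)) (at 0)"
    using ev by (rule eventually_mono) (rule wV)
  then show ?thesis using that[OF fw0 w0nz dec(2) dAB _ limw] by blast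
qed

text \<open>Only the bottom row is normalised: it converges along an ultrafilter by compactness of
  the unit sphere, while the possibly unbounded top row is absorbed by \<open>A0\<close>.\<close>

lemma normalised_moebius_rep:
  assumes "f \<in> rat_maps 1"
  obtains m where "m \<in> f" "norm (coeff (snd m) 1, coeff (snd m) 0) = 1"
proof -
  obtain m0 where m0: "m0 \<in> f" using rat_maps_nonempty[OF assms] by blast
  have "(coeff (snd m0) 1, coeff (snd m0) 0) \<noteq> (0, 0)"
    using rat_maps_1_det[OF assms m0] by (auto simp: pair_det_def)
  then have n0: "norm (coeff (snd m0) 1, coeff (snd m0) 0) \<noteq> 0" by (simp add: zero_prod_def)
  define c :: complex where "c = of_real (1 / norm (coeff (snd m0) 1, coeff (snd m0) 0))"
  have c: "c \<noteq> 0" using n0 by (simp add: c_def)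
  show ?thesis
  proof (rule that)
    show "(smult c (fst m0), smult c (snd m0)) \<in> f"
      using rat_maps_rep(3)[OF assms m0] c by (auto simp: proj_class_iff)
    show "norm (coeff (snd (smult c (fst m0), smult c (snd m0))) 1, coeff (snd (smult c (fst m0), smult c (snd m0))) 0) = 1"
      unfolding snd_conv coeff_smult norm_scaled_pair using n0 by (simp add: c_def norm_divide)
  qed
qed

lemma newton_root_families:
  assumes "degree P = d" "lead_coeff P = 1" "2 \<le> d"
  obtains r p s where "P = root_prod {..<d} r" "pderiv P = smult (of_nat d) (root_prod {..<d - 1} p)"
    "pderiv (pderiv P) = smult (of_nat (d * (d - 1))) (root_prod {..<d - 2} s)"
proof -
  obtain e where e: "d = Suc (Suc e)" using assms(3) by (metis Suc_le_D numeral_2_eq_2 Suc_le_mono)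
  have d1: "degree (pderiv P) = d - 1" "degree (pderiv (pderiv P)) = d - 2"
    using assms(1) by (simp_all add: degree_pderiv)
  have l1: "lead_coeff (pderiv P) = of_nat d" using assms(1,2) e unfolding d1 by (simp add: coeff_pderiv)
  have l2: "lead_coeff (pderiv (pderiv P)) = of_nat (d * (d - 1))"
    using assms(1,2) e unfolding d1 by (simp add: coeff_pderiv algebra_simps)
  obtain r where r: "P = smult (lead_coeff P) (root_prod {..<degree P} r)" by (rule poly_root_prod_factorization)
  obtain p where p: "pderiv P = smult (lead_coeff (pderiv P)) (root_prod {..<degree (pderiv P)} p)"
    by (rule poly_root_prod_factorization)
  obtain s where s: "pderiv (pderiv P) = smult (lead_coeff (pderiv (pderiv P))) (root_prod {..<degree (pderiv (pderiv P))} s)"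
    by (rule poly_root_prod_factorization)
  show ?thesis
    by (rule that[OF r[unfolded assms(2), unfolded assms(1) smult_1_left]
          p[unfolded l1, unfolded d1] s[unfolded l2, unfolded d1]])
qed

theorem proposition5p30:
  fixes d q :: nat
    and N M :: "complex \<Rightarrow> proj_pt"
    and f :: proj_pt
  assumes "d \<ge> 3"
    and "newton_family d N"
    and "q \<ge> 2"
    and "is_rescaling d N M q"
    and "converges_subalgebraically (d ^ q) (\<lambda>t. rat_conj (d ^ q) (M t) (rat_iter d (N t) q)) f"
  shows "f \<notin> Rat_ss (d ^ q)"
proof
  assume ss: "f \<in> Rat_ss (d ^ q)"
  have hN: "holomorphic_family d N" and newt: "\<And>t. t \<in> ball 0 1 - {0} \<Longrightarrow> is_newton_map d (N t)"
    using assms(2) by (auto simp: newton_family_def)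
  have hM: "holomorphic_family 1 M" and rs: "rescales d N M q" and no: "\<not> rescales d N M 1"
    using assms(3,4) by (auto simp: is_rescaling_def)
  have rN: "N t \<in> rat_maps d" and rM: "M t \<in> rat_maps 1" if "t \<in> ball 0 1 - {0}" for t
    using hN hM that unfolding holomorphic_family_def by blast+
  \<comment> \<open>The locale asks for valid data at every t, so parameters outside the punctured
    disc are replaced by 1/2; along \<open>U\<close> nothing changes.\<close>
  define \<sigma> :: "complex \<Rightarrow> complex" where "\<sigma> t = (if t \<in> ball 0 1 - {0} then t else 1 / 2)" for t
  have \<sigma>: "\<sigma> t \<in> ball 0 1 - {0}" for t by (simp add: \<sigma>_def norm_divide)
  have "\<forall>t. \<exists>P. degree P = d \<and> lead_coeff P = 1 \<and> N (\<sigma> t) = newton_point P"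
    using newt[OF \<sigma>] unfolding is_newton_map_def by blast
  then obtain P where PN: "\<And>t. degree (P t) = d" "\<And>t. lead_coeff (P t) = 1" "\<And>t. N (\<sigma> t) = newton_point (P t)"
    by metis
  have "\<forall>t. \<exists>r p s. P t = root_prod {..<d} r \<and> pderiv (P t) = smult (of_nat d) (root_prod {..<d - 1} p) \<and>
    pderiv (pderiv (P t)) = smult (of_nat (d * (d - 1))) (root_prod {..<d - 2} s)"
  proof
    fix t
    have d2: "2 \<le> d" using assms(1) by simp
    obtain r p s where "P t = root_prod {..<d} r" "pderiv (P t) = smult (of_nat d) (root_prod {..<d - 1} p)"
      "pderiv (pderiv (P t)) = smult (of_nat (d * (d - 1))) (root_prod {..<d - 2} s)"
      by (rule newton_root_families[OF PN(1)[of t] PN(2) d2]) (rule that; assumption)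
    then show "\<exists>r p s. P t = root_prod {..<d} r \<and> pderiv (P t) = smult (of_nat d) (root_prod {..<d - 1} p) \<and>
      pderiv (pderiv (P t)) = smult (of_nat (d * (d - 1))) (root_prod {..<d - 2} s)" by blast
  qed
  then obtain r p s where rps: "\<And>t. P t = root_prod {..<d} (r t)"
    "\<And>t. pderiv (P t) = smult (of_nat d) (root_prod {..<d - 1} (p t))"
    "\<And>t. pderiv (pderiv (P t)) = smult (of_nat (d * (d - 1))) (root_prod {..<d - 2} (s t))" by metis
  have "\<forall>t. \<exists>m. m \<in> M (\<sigma> t) \<and> norm (coeff (snd m) 1, coeff (snd m) 0) = 1"
    using normalised_moebius_rep[OF rM[OF \<sigma>]] by metis
  then obtain m where mM: "\<And>t. m t \<in> M (\<sigma> t)" "\<And>t. norm (coeff (snd (m t)) 1, coeff (snd (m t)) 0) = 1" by metis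
  obtain U :: "complex filter" where uf: "ultra U" "U \<le> at 0"
    using exists_ultra_le[of "at (0 :: complex)"] by auto
  have "eventually (\<lambda>t. (coeff (snd (m t)) 1, coeff (snd (m t)) 0) \<in> sphere 0 1) U" using mM(2) by simp
  from ultra_compact[OF uf(1) compact_sphere this] obtain rw where rw: "rw \<in> sphere 0 1"
    "((\<lambda>t. (coeff (snd (m t)) 1, coeff (snd (m t)) 0)) \<longlongrightarrow> rw) U" by blast
  define \<gamma> \<delta> where "\<gamma> = fst rw" and "\<delta> = snd rw"
  have unit1: "\<gamma> * cnj \<gamma> + \<delta> * cnj \<delta> = 1"
  proof -
    have "(cmod \<gamma>)\<^sup>2 + (cmod \<delta>)\<^sup>2 = 1" using rw(1) by (simp add: \<gamma>_def \<delta>_def norm_prod_def)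
    then have "complex_of_real ((cmod \<gamma>)\<^sup>2 + (cmod \<delta>)\<^sup>2) = 1" by simp
    then show ?thesis by (simp add: complex_norm_square[symmetric])
  qed
  interpret newton_frame U d P r p s m \<gamma> \<delta>
  proof
    show "ultra U" "2 \<le> d" using uf(1) assms(1) by auto
    show "m t \<in> form_pairs 1" for t by (rule rat_maps_rep(1)[OF rM[OF \<sigma>] mM(1)])
    show "pair_det (m t) \<noteq> 0" for t by (rule rat_maps_1_det[OF rM[OF \<sigma>] mM(1)])
    show "newton_point (P t) \<in> rat_maps d" for t using rN[OF \<sigma>[of t]] PN(3) by simp
    show "((\<lambda>t. coeff (snd (m t)) 1) \<longlongrightarrow> \<gamma>) U" "((\<lambda>t. coeff (snd (m t)) 0) \<longlongrightarrow> \<delta>) U"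
      using tendsto_fst[OF rw(2)] tendsto_snd[OF rw(2)] by (simp_all add: \<gamma>_def \<delta>_def)
  qed (use rps unit1 in auto)
  have "eventually (\<lambda>t. t \<in> ball 0 1 - {0}) (at (0 :: complex))"
    by (rule eventually_at_in_open) auto
  then have "eventually (\<lambda>t. \<sigma> t = t) (at 0)" by (rule eventually_mono) (simp add: \<sigma>_def)
  then have ev\<sigma>: "eventually (\<lambda>t. \<sigma> t = t) U" using uf(2) by (rule filter_leD[rotated])
  have NM: "N (\<sigma> t) = newton_point (P t)" "M (\<sigma> t) = proj_class (m t)" for t
    using PN(3) rat_maps_rep(3)[OF rM[OF \<sigma>] mM(1)] by auto
  let ?D = "d ^ q"
  from assms(5) obtain v v0 where v0: "v0 \<in> form_pairs ?D - {(0, 0)}" "f = proj_class v0"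
    and v: "\<forall>\<^sub>F t in at 0. v t \<in> form_pairs ?D - {(0, 0)} \<and> rat_conj ?D (M t) (rat_iter d (N t) q) = proj_class (v t)"
    and lim: "\<forall>i\<le>?D. ((\<lambda>t. coeff (fst (v t)) i) \<longlongrightarrow> coeff (fst v0) i) (at 0) \<and> ((\<lambda>t. coeff (snd (v t)) i) \<longlongrightarrow> coeff (snd v0) i) (at 0)"
    unfolding converges_subalgebraically_def by blast
  have fv0: "v0 \<in> form_pairs ?D" "v0 \<noteq> (0, 0)" using v0 by auto
  have limv: "((\<lambda>t. coeff (fst (v t)) i) \<longlongrightarrow> coeff (fst v0) i) (at 0)"
    "((\<lambda>t. coeff (snd (v t)) i) \<longlongrightarrow> coeff (snd v0) i) (at 0)" for i
  proof -
    have "((\<lambda>t. coeff (fst (v t)) i) \<longlongrightarrow> coeff (fst v0) i) (at 0) \<and> ((\<lambda>t. coeff (snd (v t)) i) \<longlongrightarrow> coeff (snd v0) i) (at 0)"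
    proof (cases "i \<le> ?D")
      case False
      have z: "coeff (fst (v t)) i = 0 \<and> coeff (snd (v t)) i = 0" if "v t \<in> form_pairs ?D" for t
        using form_pairsD[OF that] False by (auto simp: coeff_eq_0)
      have "eventually (\<lambda>t. 0 = coeff (fst (v t)) i) (at 0)"
        using v by (rule eventually_mono) (simp add: z)
      moreover have "eventually (\<lambda>t. 0 = coeff (snd (v t)) i) (at 0)"
        using v by (rule eventually_mono) (simp add: z)
      moreover have "coeff (fst v0) i = 0" "coeff (snd v0) i = 0" using form_pairsD[OF fv0(1)] False by (auto simp: coeff_eq_0)
      ultimately show ?thesis by (simp add: Lim_transform_eventually[OF tendsto_const])
    qed (use lim in blast)
    then show "((\<lambda>t. coeff (fst (v t)) i) \<longlongrightarrow> coeff (fst v0) i) (at 0)"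
      "((\<lambda>t. coeff (snd (v t)) i) \<longlongrightarrow> coeff (snd v0) i) (at 0)" by auto
  qed
  note limU = tendsto_mono[OF uf(2) limv(1)] tendsto_mono[OF uf(2) limv(2)]
  have "eventually (\<lambda>t. v t \<in> form_pairs ?D - {(0, 0)} \<and> rat_conj ?D (M t) (rat_iter d (N t) q) = proj_class (v t)) U"
    by (rule filter_leD[OF uf(2) v])
  with ev\<sigma> have vU: "eventually (\<lambda>t. v t \<in> rat_conj ?D (proj_class (m t)) (rat_iter d (newton_point (P t)) q)) U"
  proof eventually_elim
    case (elim t)
    have "v t \<in> rat_conj ?D (M (\<sigma> t)) (rat_iter d (N (\<sigma> t)) q)" using elim by simp
    then show ?case unfolding NM .
  qed
  from rs obtain e g S where e: "2 \<le> e" and g: "g \<in> rat_maps e" and S: "finite S"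
    "locally_uniform_limit_off S (\<lambda>t. rat_eval ?D (rat_conj ?D (M t) (rat_iter d (N t) q))) (rat_eval e g)"
    unfolding rescales_def by blast
  obtain F G where FG: "(F, G) \<in> g" using rat_maps_nonempty[OF g] by (metis surj_pair)
  \<comment> \<open>Through this identity \<open>v0\<close> inherits from the coprime
    \<open>g\<close> the independence of its two forms and the impossibility of a Moebius
    quotient.\<close>
  have ratio: "fst v0 * G = snd v0 * F"
    by (rule limit_ratio_eq[OF S(2,1) _ limv fv0(1) g FG]) (use v in \<open>auto elim: eventually_mono\<close>)
  have nz: "fst v0 \<noteq> 0 \<or> snd v0 \<noteq> 0" using fv0(2) by (cases v0) auto
  obtain S1 where S1: "lim_off U (\<lambda>t z. down A0 t (newt_iter q t (up A0 t (frame_coord t z))))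
     (\<lambda>z. fst (limit_value ?D v0 z) / snd (limit_value ?D v0 z)) S1"
     "\<forall>z. z \<notin> S1 \<longrightarrow> snd (limit_value ?D v0 z) \<noteq> 0"
    using return_lim[OF vU limU fv0(1) coprime_ratio_independent[OF g FG _ nz ratio]] e by auto
  \<comment> \<open>As there is no rescaling of period one, a limit from \<open>A0\<close> to itself
    would be Moebius. The q-th iterate would then make the forms of \<open>v0\<close> proportional
    to two linear ones, while \<open>g\<close> has degree at least 2.\<close>
  have no_fixed: "\<not> lim_off U (\<lambda>t z. down A0 t (newt (P t) (up A0 t z))) h T" for h T
  proof
    assume h: "lim_off U (\<lambda>t z. down A0 t (newt (P t) (up A0 t z))) h T"
    obtain w w0 H A B where w0: "w0 \<in> form_pairs d" "w0 \<noteq> (0, 0)" "w0 = (H * A, H * B)" "degree A \<le> 1" "degree B \<le> 1"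
      and w: "eventually (\<lambda>t. w t \<in> rat_conj d (M t) (rat_iter d (N t) 1)) (at 0)"
      and limw: "\<And>i. ((\<lambda>t. coeff (fst (w t)) i) \<longlongrightarrow> coeff (fst w0) i) (at 0)"
        "\<And>i. ((\<lambda>t. coeff (snd (w t)) i) \<longlongrightarrow> coeff (snd w0) i) (at 0)"
      by (rule period_one_limit[OF hN hM no]) blast
    have wU: "eventually (\<lambda>t. w t \<in> rat_conj (d ^ 1) (proj_class (m t)) (rat_iter d (newton_point (P t)) 1)) U"
      using filter_leD[OF uf(2) w] ev\<sigma>
    proof eventually_elim
      case (elim t)
      have "w t \<in> rat_conj d (M (\<sigma> t)) (rat_iter d (N (\<sigma> t)) 1)" using elim by simp
      then show ?case unfolding NM by simp
    qed
    obtain k T' where k: "lim_off U (\<lambda>t z. down A0 t (newt_iter q t (up A0 t (frame_coord t z)))) k T'" "moebius_off k"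
      by (rule moebius_iterate_limits[OF h wU tendsto_mono[OF uf(2) limw(1)] tendsto_mono[OF uf(2) limw(2)] _ w0(3,2,4,5), of q])
         (use w0(1) in auto)
    have "finite (S1 \<union> T')" using lim_off_finite[OF S1(1)] lim_off_finite[OF k(1)] by simp
    then obtain L1 L2 where "degree L1 \<le> 1" "degree L2 \<le> 1"
      "coeff L1 1 * coeff L2 0 - coeff L1 0 * coeff L2 1 \<noteq> 0" "fst v0 * L2 = snd v0 * L1"
      using moebius_limit_value[OF fv0(1) _ k(2), of "S1 \<union> T'"] S1(2) lim_off_eq[OF k(1) S1(1) uf(1)] by blast
    then show False using no_moebius_ratio[OF g FG e nz ratio] by blast
  qed
  obtain gp where gp: "2 * degree gp \<le> ?D"
    "\<And>w z. (w \<longlongrightarrow> z) U \<Longrightarrow> ((\<lambda>t. down A0 t (newt_iter q t (up A0 t (w t)))) \<longlongrightarrow> poly gp z) U"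
    "\<And>w z. (w \<longlongrightarrow> z) U \<Longrightarrow> eventually (\<lambda>t. \<forall>i<q. poly (pderiv (P t)) (newt_iter i t (up A0 t (w t))) \<noteq> 0) U"
    by (rule periodic_orbit[OF scale_A0 _ start_lim S1(1) no_fixed]) (use assms(3) in auto)
  \<comment> \<open>Conjugation by the inverse of \<open>K0\<close>, a matrix of determinant 1, puts
    all holes at infinity and does not change the value of an invariant.\<close>
  define V where "V = pair_conj ?D (pair_adj K0) v0"
  have V: "fst V = gp * snd V" "degree (snd V) = 0"
    unfolding V_def by (rule limit_form[OF vU limU fv0 gp(2,3)]; assumption)+
  from ss obtain n Q where Q: "n \<ge> 1" "homogeneous_mpoly ?D n Q" "SL2_invariant ?D Q" "\<forall>v\<in>f. mpoly_eval Q v \<noteq> 0"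
    unfolding Rat_ss_def by blast
  have "degree (fst V) \<le> degree gp" using degree_mult_le[of gp "snd V"] V by simp
  then have dV: "2 * degree (fst V) \<le> ?D" using gp(1) by simp
  have "d ^ 1 \<le> ?D" using assms(1,3) by (intro power_increasing) auto
  then have D2: "2 \<le> ?D" using assms(1) by simp
  have "mpoly_eval Q V = 0"
    using unstable_of_small_degree[OF dV V(2) D2 Q(1-3)] by simp
  moreover have "mpoly_eval Q V = mpoly_eval Q v0"
  proof -
    have "pair_det (pair_adj K0) = 1" using det_K0 by (simp add: pair_det_adj)
    then show ?thesis using Q(3) fv0(1) unfolding SL2_invariant_def V_def by (meson pair_adj_form_pairs)
  qed
  ultimately show False using Q(4) v0(2) by simp
qed

end
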